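(* Let $n,m\ge4$ be fixed and let $p\to\infty$. In both Case S1 and Case S2, assume: (i) There are constants $0<a\le A<\infty$, $0<a'\le A'<\infty$, $0<a''\le A''<\infty$ such that, uniformly over $p$, for all $1\le i\le p$: $a\le E\rho_i(X_{(i)},X'_{(i)})\le A$, $a'\le E\rho_i(Y_{(i)},Y'_{(i)})\le A'$, $a''\le E\rho_i(X_{(i)},Y_{(i)})\le A''$. (ii) $L(X,Y)=O_p(a_p)$, $L(X,X')=O_p(b_p)$, $L(Y,Y')=O_p(c_p)$ for positive real sequences $a_p,b_p,c_p=o(1)$ with $\tau a_p^2+\tau_Xb_p^2+\tau_Yc_p^2=o(1)$. (iii) As $p\to\infty$, the vector consisting of all $H(X_k,Y_l)$ ($1\le k\le n$, $1\le l\le m$), $H(X_s,X_t)$ ($1\le s<t\le n$), $H(Y_u,Y_v)$ ($1\le u<v\le m$) converges jointly in distribution to a zero-mean jointly Gaussian vector $(a_{kl},b_{st},c_{uv})$ all of whose entries are independent of each other, with $\mathrm{var}(a_{kl})=\sigma^2=\lim_p E[H^2(X_k,Y_l)]$, $\mathrm{var}(b_{st})=\sigma_X^2=\lim_pE[H^2(X_s,X_t)]$, $\mathrm{var}(c_{uv})=\sigma_Y^2=\lim_pE[H^2(Y_u,Y_v)]$. (iv) $(P_X,P_Y)\in\mathcal P$, that is, $E[\tau L(X,Y)-\tau_XL(X,X')\mid X]=o_p(1)$ and $E[\tau L(X,Y)-\tau_YL(Y,Y')\mid Y]=o_p(1)$. Then $$\frac{\mathcal E_{n,m}(X,Y)-(2\tau-\tau_X-\tau_Y)}{a_{nm}\sqrt{S_{n,m}}}\overset{d}{\longrightarrow}\frac{\sigma_{nm}Z}{a_{nm}\sqrt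 M},$$ where $Z\sim N(0,1)$ is independent of $$M\overset{d}{=}\frac{\sigma^2\chi^2_{(n-1)(m-1)}+\sigma_X^2\chi^2_{v_n}+\sigma_Y^2\chi^2_{v_m}}{(n-1)(m-1)+v_n+v_m},$$ with $\chi^2_{(n-1)(m-1)},\chi^2_{v_n},\chi^2_{v_m}$ independent chi-squared random variables with the indicated degrees of freedom. In other words, with $\Delta:=\lim_{p\to\infty}(2\tau-\tau_X-\tau_Y)$, $$T_{n,m}\overset{d}{\longrightarrow}\frac{\sigma_{nm}\,N(\Delta/\sigma_{nm},1)}{a_{nm}\sqrt M}$$ (the normal variable being independent of $M$). In particular, under $H_0:X\overset{d}{=}Y$, $$T_{n,m}\overset{d}{\longrightarrow}t_{(n-1)(m-1)+v_n+v_m},$$ the (central) Student $t$-distribution with $(n-1)(m-1)+v_n+v_m$ degrees of freedom.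
   Context: For each $p$, $X=(X_{(1)},\dots,X_{(p)})\sim P_X$ and $Y=(Y_{(1)},\dots,Y_{(p)})\sim P_Y$ are independent random vectors in $\mathbb R^{\tilde p}$, $\tilde p=\sum_{i=1}^pd_i$, with $X_{(i)},Y_{(i)}\in\mathbb R^{d_i}$ and $d_i$ bounded; $(X',Y')$ is an independent copy of $(X,Y)$. $X_1,\dots,X_n$ are i.i.d. copies of $X$ and, independently, $Y_1,\dots,Y_m$ are i.i.d. copies of $Y$, with groups $X_{k(i)},Y_{l(i)}$. Distance: $K(x,x')=\sqrt{\sum_{i=1}^p\rho_i(x_{(i)},x'_{(i)})}$. Case S1: each $\rho_i$ is a metric of strong negative type on $\mathbb R^{d_i}$. Case S2: $\rho_i(x_{(i)},x'_{(i)})=\|x_{(i)}-x'_{(i)}\|^2$ for each $i$. A metric space $(\mathcal X,d)$ has negative type if for all $N\ge1$, $x_1,\dots,x_N\in\mathcal X$ and $\alpha_1,\dots,\alpha_N\in\mathbb R$ with $\sum_i\alpha_i=0$ one has $\sum_{i,j}\alpha_i\alpha_jd(x_i,x_j)\le0$; it has strong negative type if moreover (for distinct points $x_1,\dots,x_N$) equality holds only when $\alpha_i=0$ for all $i$. $\tau_X^2=EK(X,X')^2$, $\tau_Y^2=EK(Y,Y')^2$, $\tau^2=EK(X,Y)^2$; $L(X,Y)=\frac{K^2(X,Y)-\tau^2}{\tau^2}$, $L(X,X')=\frac{K^2(X,X')-\tau_X^2}{\tau_X^2}$, $L(Y,Y')=\frac{K^2(Y,Y')-\tau_Y^2}{\tau_Y^2}$.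 Double-centered distances: $d_{kl}(i)=\rho_i(X_{k(i)},Y_{l(i)})-E[\rho_i(X_{k(i)},Y_{l(i)})|X_{k(i)}]-E[\rho_i(X_{k(i)},Y_{l(i)})|Y_{l(i)}]+E[\rho_i(X_{k(i)},Y_{l(i)})]$; $d^X_{kl}(i)$ and $d^Y_{kl}(i)$ are defined in the same way from the pairs $(X_{k(i)},X_{l(i)})$ and $(Y_{k(i)},Y_{l(i)})$, $k\ne l$. $H(X_k,Y_l)=\frac1\tau\sum_{i=1}^pd_{kl}(i)$, $H(X_k,X_l)=\frac1{\tau_X}\sum_{i=1}^pd^X_{kl}(i)$, $H(Y_k,Y_l)=\frac1{\tau_Y}\sum_{i=1}^pd^Y_{kl}(i)$. Statistics: $$\mathcal E_{n,m}(X,Y)=\frac2{nm}\sum_{k=1}^n\sum_{l=1}^mK(X_k,Y_l)-\frac1{n(n-1)}\sum_{k\ne l}K(X_k,X_l)-\frac1{m(m-1)}\sum_{k\ne l}K(Y_k,Y_l).$$ $cdCov^2_{n,m}(X,Y)=\frac1{(n-1)(m-1)}\sum_{k=1}^n\sum_{l=1}^m\widehat K(X_k,Y_l)^2$, where $\widehat K(X_k,Y_l)=K(X_k,Y_l)-\frac1n\sum_{i=1}^nK(X_i,Y_l)-\frac1m\sum_{j=1}^mK(X_k,Y_j)+\frac1{nm}\sum_{i=1}^n\sum_{j=1}^mK(X_i,Y_j)$. For an $n\times n$ matrix $A=(a_{kl})$ its $\mathcal U$-centered version has entries $\tilde a_{kl}=a_{kl}-\frac1{n-2}\sum_ja_{kj}-\frac1{n-2}\sum_ia_{il}+\frac1{(n-1)(n-2)}\sum_{i,j}a_{ij}$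 for $k\ne l$ and $\tilde a_{kk}=0$. $\widetilde{\mathcal D^2_n}(X,X)=\frac1{n(n-3)}\sum_{k\ne l}\tilde a_{kl}^2$ with $a_{kl}=K(X_k,X_l)$; $\widetilde{\mathcal D^2_m}(Y,Y)$ is defined likewise from $(K(Y_k,Y_l))_{k,l=1}^m$. $v_s=s(s-3)/2$; $$S_{n,m}=\frac{4(n-1)(m-1)\,cdCov^2_{n,m}(X,Y)+4v_n\widetilde{\mathcal D^2_n}(X,X)+4v_m\widetilde{\mathcal D^2_m}(Y,Y)}{(n-1)(m-1)+v_n+v_m};$$ $a_{nm}=\sqrt{\frac1{nm}+\frac1{2n(n-1)}+\frac1{2m(m-1)}}$, $\sigma_{nm}=\sqrt{\frac{\sigma^2}{nm}+\frac{\sigma_X^2}{2n(n-1)}+\frac{\sigma_Y^2}{2m(m-1)}}$, $T_{n,m}=\frac{\mathcal E_{n,m}(X,Y)}{a_{nm}\sqrt{S_{n,m}}}$.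
   Formalization: The limiting variances σ², σ_X², σ_Y² are assumed not all zero (otherwise σ_nm = 0 and M = 0, so the limit is 0/0), and in Case S1 each metric ρ_i is assumed jointly Borel measurable, so that its expectations make sense. *)

theory Defs
  imports "HOL-Probability.Probability"
begin

section \<open>Data vectors with group structure\<close>

text \<open>
  A point of \<open>\<real>\<^sup>k\<close> is an extensional function on \<open>{1..k}\<close>.  A data vector with \<open>p\<close> groups of
  dimensions \<open>d 1, \<dots>, d p\<close> is the function \<open>i \<mapsto>\<close> (its \<open>i\<close>-th group), so the
  data space below is \<open>\<real>\<close> to the power \<open>d 1 + \<dots> + d p\<close> with its Borel sets.
\<close>

type_synonym point = "nat \<Rightarrow> real"
type_synonym data = "nat \<Rightarrow> point"

definition group_space :: "nat \<Rightarrow> point measure" where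
  "group_space k = (\<Pi>\<^sub>M j\<in>{1..k}. borel)"

definition data_space :: "nat \<Rightarrow> (nat \<Rightarrow> nat) \<Rightarrow> data measure" where
  "data_space p d = (\<Pi>\<^sub>M i\<in>{1..p}. group_space (d i))"


section \<open>Distances\<close>

definition negative_type :: "'a set \<Rightarrow> ('a \<Rightarrow> 'a \<Rightarrow> real) \<Rightarrow> bool" where
  "negative_type S r \<longleftrightarrow>
     (\<forall>N\<ge>1. \<forall>x \<alpha>. (\<forall>i\<in>{1..N::nat}. x i \<in> S) \<and> (\<Sum>i=1..N. \<alpha> i) = 0 \<longrightarrow>
        (\<Sum>i=1..N. \<Sum>j=1..N. \<alpha> i * \<alpha> j * r (x i) (x j)) \<le> 0)"

definition strong_negative_type :: "'a set \<Rightarrow> ('a \<Rightarrow> 'a \<Rightarrow> real) \<Rightarrow> bool" where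
  "strong_negative_type S r \<longleftrightarrow> negative_type S r \<and>
     (\<forall>N\<ge>1. \<forall>x \<alpha>. (\<forall>i\<in>{1..N::nat}. x i \<in> S) \<and> inj_on x {1..N} \<and> (\<Sum>i=1..N. \<alpha> i) = 0 \<and>
        (\<Sum>i=1..N. \<Sum>j=1..N. \<alpha> i * \<alpha> j * r (x i) (x j)) = 0 \<longrightarrow> (\<forall>i\<in>{1..N}. \<alpha> i = 0))"

text \<open>
  In case S1 joint Borel measurability makes \<open>r (U \<omega>) (V \<omega>)\<close> a random variable for
  random \<open>U\<close>, \<open>V\<close>; an arbitrary metric on \<open>\<real>\<^sup>k\<close> need not be measurable.
  In case S2 \<open>r\<close> is the squared Euclidean distance.
\<close>

definition case_S1 :: "nat \<Rightarrow> (point \<Rightarrow> point \<Rightarrow> real) \<Rightarrow> bool" where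
  "case_S1 k r \<longleftrightarrow>
     Metric_space (space (group_space k)) r \<and>
     strong_negative_type (space (group_space k)) r \<and>
     (\<lambda>(x, y). r x y) \<in> borel_measurable (group_space k \<Otimes>\<^sub>M group_space k)"

definition case_S2 :: "nat \<Rightarrow> (point \<Rightarrow> point \<Rightarrow> real) \<Rightarrow> bool" where
  "case_S2 k r \<longleftrightarrow>
     (\<forall>x\<in>space (group_space k). \<forall>y\<in>space (group_space k). r x y = (\<Sum>j=1..k. (x j - y j)\<^sup>2))"

definition dist_K :: "nat \<Rightarrow> (nat \<Rightarrow> point \<Rightarrow> point \<Rightarrow> real) \<Rightarrow> data \<Rightarrow> data \<Rightarrow> real" where
  "dist_K p \<rho> x y = sqrt (\<Sum>i=1..p. \<rho> i (x i) (y i))"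


section \<open>Population quantities\<close>

text \<open>The square root of \<open>E K(U,V)\<^sup>2\<close>; this is \<open>\<tau>\<close>, \<open>\<tau>\<^sub>X\<close> or \<open>\<tau>\<^sub>Y\<close> for
  \<open>(U,V) = (X,Y)\<close>, \<open>(X,X')\<close> or \<open>(Y,Y')\<close>.\<close>

definition tau :: "'w measure \<Rightarrow> ('a \<Rightarrow> 'a \<Rightarrow> real) \<Rightarrow> ('w \<Rightarrow> 'a) \<Rightarrow> ('w \<Rightarrow> 'a) \<Rightarrow> real" where
  "tau P K U V = sqrt (\<integral>\<omega>. (K (U \<omega>) (V \<omega>))\<^sup>2 \<partial>P)"

definition L :: "'w measure \<Rightarrow> ('a \<Rightarrow> 'a \<Rightarrow> real) \<Rightarrow> ('w \<Rightarrow> 'a) \<Rightarrow> ('w \<Rightarrow> 'a) \<Rightarrow> 'w \<Rightarrow> real" where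
  "L P K U V \<omega> = ((K (U \<omega>) (V \<omega>))\<^sup>2 - (tau P K U V)\<^sup>2) / (tau P K U V)\<^sup>2"

text \<open>\<open>E[f | U]\<close> for a random element \<open>U\<close> of the measurable space \<open>N\<close>.\<close>

definition cond_exp_given ::
    "'w measure \<Rightarrow> 'a measure \<Rightarrow> ('w \<Rightarrow> 'a) \<Rightarrow> ('w \<Rightarrow> real) \<Rightarrow> 'w \<Rightarrow> real" where
  "cond_exp_given P N U f = real_cond_exp P (vimage_algebra (space P) U N) f"

definition double_centered ::
    "'w measure \<Rightarrow> 'a measure \<Rightarrow> ('a \<Rightarrow> 'a \<Rightarrow> real) \<Rightarrow> ('w \<Rightarrow> 'a) \<Rightarrow> ('w \<Rightarrow> 'a) \<Rightarrow> 'w \<Rightarrow> real" where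
  "double_centered P N r U V \<omega> =
     r (U \<omega>) (V \<omega>)
     - cond_exp_given P N U (\<lambda>w. r (U w) (V w)) \<omega>
     - cond_exp_given P N V (\<lambda>w. r (U w) (V w)) \<omega>
     + (\<integral>w. r (U w) (V w) \<partial>P)"

definition H :: "'w measure \<Rightarrow> nat \<Rightarrow> (nat \<Rightarrow> nat) \<Rightarrow> (nat \<Rightarrow> point \<Rightarrow> point \<Rightarrow> real) \<Rightarrow> real
    \<Rightarrow> ('w \<Rightarrow> data) \<Rightarrow> ('w \<Rightarrow> data) \<Rightarrow> 'w \<Rightarrow> real" where
  "H P p d \<rho> t U V \<omega> =
     1 / t * (\<Sum>i=1..p. double_centered P (group_space (d i)) (\<rho> i) (\<lambda>w. U w i) (\<lambda>w. V w i) \<omega>)"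


section \<open>Stochastic orders and joint convergence in distribution\<close>

text \<open>\<open>Z p\<close> lives on the probability space \<open>P p\<close>; the spaces for different \<open>p\<close> are unrelated.\<close>

definition bigOp :: "(nat \<Rightarrow> 'w measure) \<Rightarrow> (nat \<Rightarrow> 'w \<Rightarrow> real) \<Rightarrow> (nat \<Rightarrow> real) \<Rightarrow> bool" where
  "bigOp P Z a \<longleftrightarrow>
     (\<forall>\<epsilon>>0. \<exists>C>0. \<forall>\<^sub>F p in sequentially. measure (P p) {\<omega> \<in> space (P p). \<bar>Z p \<omega>\<bar> > C * a p} < \<epsilon>)"

definition smallop1 :: "(nat \<Rightarrow> 'w measure) \<Rightarrow> (nat \<Rightarrow> 'w \<Rightarrow> real) \<Rightarrow> bool" where
  "smallop1 P Z \<longleftrightarrow>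
     (\<forall>\<epsilon>>0. (\<lambda>p. measure (P p) {\<omega> \<in> space (P p). \<bar>Z p \<omega>\<bar> > \<epsilon>}) \<longlonglongrightarrow> 0)"

text \<open>Weak convergence in \<open>\<real>\<close> to the power \<open>I\<close> (\<open>I\<close> finite), via bounded continuous test functions.\<close>

definition joint_conv ::
    "(nat \<Rightarrow> 'w measure) \<Rightarrow> 'i set \<Rightarrow> (nat \<Rightarrow> 'i \<Rightarrow> 'w \<Rightarrow> real) \<Rightarrow> ('i \<Rightarrow> real) measure \<Rightarrow> bool" where
  "joint_conv P I V \<mu> \<longleftrightarrow>
     (\<forall>f :: ('i \<Rightarrow> real) \<Rightarrow> real.
        continuous_on (\<Pi>\<^sub>E i\<in>I. UNIV) f \<and> bounded (f ` (\<Pi>\<^sub>E i\<in>I. UNIV)) \<longrightarrow>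
        (\<lambda>p. \<integral>\<omega>. f (\<lambda>i\<in>I. V p i \<omega>) \<partial>P p) \<longlonglongrightarrow> (\<integral>x. f x \<partial>\<mu>))"

definition second_moment_tendsto ::
    "(nat \<Rightarrow> 'w measure) \<Rightarrow> (nat \<Rightarrow> 'w \<Rightarrow> real) \<Rightarrow> real \<Rightarrow> bool" where
  "second_moment_tendsto P Z v \<longleftrightarrow>
     (\<forall>\<^sub>F p in sequentially. integrable (P p) (\<lambda>\<omega>. (Z p \<omega>)\<^sup>2)) \<and>
     (\<lambda>p. \<integral>\<omega>. (Z p \<omega>)\<^sup>2 \<partial>P p) \<longlonglongrightarrow> v"


section \<open>Limit distributions\<close>

text \<open>Normal distribution with mean \<open>\<mu>\<close> and variance \<open>v \<ge> 0\<close>; \<open>v = 0\<close> gives the point mass at \<open>\<mu>\<close>.\<close>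

definition normal_law :: "real \<Rightarrow> real \<Rightarrow> real measure" where
  "normal_law \<mu> v = distr (density lborel std_normal_density) borel (\<lambda>z. \<mu> + sqrt v * z)"

definition chi_square :: "nat \<Rightarrow> real measure" where
  "chi_square k = distr (\<Pi>\<^sub>M i\<in>{1..k}. normal_law 0 1) borel (\<lambda>z. \<Sum>i=1..k. (z i)\<^sup>2)"

definition student_t :: "nat \<Rightarrow> real measure" where
  "student_t k =
     distr (normal_law 0 1 \<Otimes>\<^sub>M chi_square k) borel (\<lambda>(z, q). z / sqrt (q / real k))"

text \<open>\<open>s (s - 3)\<close> is even, so for \<open>s \<ge> 3\<close> the division is exact.\<close>

definition v :: "nat \<Rightarrow> nat" where
  "v s = s * (s - 3) div 2"

definition M_law :: "nat \<Rightarrow> nat \<Rightarrow> real \<Rightarrow> real \<Rightarrow> real \<Rightarrow> real measure" where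
  "M_law n m \<sigma>2 \<sigma>X2 \<sigma>Y2 =
     distr (chi_square ((n - 1) * (m - 1)) \<Otimes>\<^sub>M chi_square (v n) \<Otimes>\<^sub>M chi_square (v m)) borel
       (\<lambda>(q, qX, qY). (\<sigma>2 * q + \<sigma>X2 * qX + \<sigma>Y2 * qY) / real ((n - 1) * (m - 1) + v n + v m))"

definition a_nm :: "nat \<Rightarrow> nat \<Rightarrow> real" where
  "a_nm n m = sqrt (1 / (real n * real m) + 1 / (2 * real n * (real n - 1))
                    + 1 / (2 * real m * (real m - 1)))"

definition sigma_nm :: "nat \<Rightarrow> nat \<Rightarrow> real \<Rightarrow> real \<Rightarrow> real \<Rightarrow> real" where
  "sigma_nm n m \<sigma>2 \<sigma>X2 \<sigma>Y2 = sqrt (\<sigma>2 / (real n * real m) + \<sigma>X2 / (2 * real n * (real n - 1))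
                    + \<sigma>Y2 / (2 * real m * (real m - 1)))"

text \<open>The positions in the vector of all \<open>H(X\<^sub>k,Y\<^sub>l)\<close>, \<open>H(X\<^sub>s,X\<^sub>t)\<close>, \<open>H(Y\<^sub>u,Y\<^sub>v)\<close>.\<close>

datatype entry = XY nat nat | XX nat nat | YY nat nat

definition entries :: "nat \<Rightarrow> nat \<Rightarrow> entry set" where
  "entries n m = {XY k l | k l. 1 \<le> k \<and> k \<le> n \<and> 1 \<le> l \<and> l \<le> m}
     \<union> {XX s t | s t. 1 \<le> s \<and> s < t \<and> t \<le> n} \<union> {YY s t | s t. 1 \<le> s \<and> s < t \<and> t \<le> m}"

text \<open>A jointly Gaussian vector with independent centred entries has the product law.\<close>

definition entries_limit :: "nat \<Rightarrow> nat \<Rightarrow> real \<Rightarrow> real \<Rightarrow> real \<Rightarrow> (entry \<Rightarrow> real) measure" where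
  "entries_limit n m \<sigma>2 \<sigma>X2 \<sigma>Y2 =
     (\<Pi>\<^sub>M e\<in>entries n m. normal_law 0 (case e of XY _ _ \<Rightarrow> \<sigma>2 | XX _ _ \<Rightarrow> \<sigma>X2 | YY _ _ \<Rightarrow> \<sigma>Y2))"


section \<open>Statistics\<close>

definition energy_stat ::
    "('a \<Rightarrow> 'a \<Rightarrow> real) \<Rightarrow> nat \<Rightarrow> nat \<Rightarrow> (nat \<Rightarrow> 'a) \<Rightarrow> (nat \<Rightarrow> 'a) \<Rightarrow> real" where
  "energy_stat K n m x y =
     2 / (real n * real m) * (\<Sum>k=1..n. \<Sum>l=1..m. K (x k) (y l))
     - 1 / (real n * (real n - 1)) * (\<Sum>k=1..n. \<Sum>l\<in>{1..n} - {k}. K (x k) (x l))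
     - 1 / (real m * (real m - 1)) * (\<Sum>k=1..m. \<Sum>l\<in>{1..m} - {k}. K (y k) (y l))"

definition K_hat ::
    "('a \<Rightarrow> 'a \<Rightarrow> real) \<Rightarrow> nat \<Rightarrow> nat \<Rightarrow> (nat \<Rightarrow> 'a) \<Rightarrow> (nat \<Rightarrow> 'a) \<Rightarrow> nat \<Rightarrow> nat \<Rightarrow> real" where
  "K_hat K n m x y k l =
     K (x k) (y l) - 1 / real n * (\<Sum>i=1..n. K (x i) (y l)) - 1 / real m * (\<Sum>j=1..m. K (x k) (y j))
     + 1 / (real n * real m) * (\<Sum>i=1..n. \<Sum>j=1..m. K (x i) (y j))"

definition cdCov2 ::
    "('a \<Rightarrow> 'a \<Rightarrow> real) \<Rightarrow> nat \<Rightarrow> nat \<Rightarrow> (nat \<Rightarrow> 'a) \<Rightarrow> (nat \<Rightarrow> 'a) \<Rightarrow> real" where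
  "cdCov2 K n m x y =
     1 / ((real n - 1) * (real m - 1)) * (\<Sum>k=1..n. \<Sum>l=1..m. (K_hat K n m x y k l)\<^sup>2)"

definition U_centered :: "nat \<Rightarrow> (nat \<Rightarrow> nat \<Rightarrow> real) \<Rightarrow> nat \<Rightarrow> nat \<Rightarrow> real" where
  "U_centered n A k l =
     (if k = l then 0
      else A k l - 1 / (real n - 2) * (\<Sum>j=1..n. A k j) - 1 / (real n - 2) * (\<Sum>i=1..n. A i l)
           + 1 / ((real n - 1) * (real n - 2)) * (\<Sum>i=1..n. \<Sum>j=1..n. A i j))"

definition D2 :: "('a \<Rightarrow> 'a \<Rightarrow> real) \<Rightarrow> nat \<Rightarrow> (nat \<Rightarrow> 'a) \<Rightarrow> real" where
  "D2 K n x =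
     1 / (real n * (real n - 3)) *
       (\<Sum>k=1..n. \<Sum>l\<in>{1..n} - {k}. (U_centered n (\<lambda>i j. K (x i) (x j)) k l)\<^sup>2)"

definition S_stat ::
    "('a \<Rightarrow> 'a \<Rightarrow> real) \<Rightarrow> nat \<Rightarrow> nat \<Rightarrow> (nat \<Rightarrow> 'a) \<Rightarrow> (nat \<Rightarrow> 'a) \<Rightarrow> real" where
  "S_stat K n m x y =
     (4 * (real n - 1) * (real m - 1) * cdCov2 K n m x y
        + 4 * real (v n) * D2 K n x + 4 * real (v m) * D2 K m y)
     / ((real n - 1) * (real m - 1) + real (v n) + real (v m))"

definition T_stat ::
    "('a \<Rightarrow> 'a \<Rightarrow> real) \<Rightarrow> nat \<Rightarrow> nat \<Rightarrow> (nat \<Rightarrow> 'a) \<Rightarrow> (nat \<Rightarrow> 'a) \<Rightarrow> real" where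
  "T_stat K n m x y = energy_stat K n m x y / (a_nm n m * sqrt (S_stat K n m x y))"

end

theory Submission
  imports Defs
begin

text \<open>
  Expanding \<open>K = \<tau> sqrt (1 + L)\<close> to first order gives \<open>2 K(x, y) = H(x, y) + g(x) + h(y) + R\<close>, where
  \<open>R\<close> is of order \<open>\<tau> L\<^sup>2\<close> and so vanishes in probability by (ii). Double centering and
  \<open>U\<close>-centering annihilate \<open>g\<close> and \<open>h\<close>; in the energy statistic they leave \<open>2 \<tau> - \<tau>X - \<tau>Y\<close> plus
  averages of the conditional expectations in (iv), which vanish as well. The statistics are therefore
  asymptotically a linear form and a quadratic form in the vector of the \<open>H\<close>-values. The quadratic form is
  a sum of squares along orthonormal vectors spanning the ranges of the three centering projections; these
  vectors have sum 0 in each block, hence are orthogonal to the linear form, and in the Gaussian limit the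
  linear form is independent of the three chi-square variables. The ratio is reduced to one-dimensional
  weak convergence by rewriting \<open>E / (a sqrt S) \<le> t\<close> as \<open>E - t a sqrt S \<le> 0\<close>.
\<close>

section \<open>Independence of orthonormal Gaussian variables\<close>

text \<open>The ratio is discontinuous where the quadratic form vanishes, so convergence against
  bounded continuous functions says nothing about it directly. The difference
  \<open>f w - t * g w\<close> is continuous for each \<open>t\<close>, and its distribution
  function converges at 0 because in the limit the linear form is Gaussian with positive variance
  and independent of the quadratic form, which excludes an atom. This, and the positivity of the
  limiting quadratic form, are where some limiting variance has to be positive.

  The degrees of freedom are ranks, computed as traces: (n-1)(m-1) for a tensor product of two
  centerings, and \<open>v n\<close>, which is n(n-1)/2 - n, for U-centering, where n row sums are
  removed from the symmetric matrices with zero diagonal. A matrix is therefore represented by its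
  entries above the diagonal, one coordinate per independent Gaussian.

  Assumptions (ii) and (iv) speak of \<open>X\<close>, \<open>Y\<close> and their copies, the
  statistics of the samples. Only equality of laws connects the two, so the quantities in these
  assumptions, including the conditional expectations, are first written as functions of the data
  vectors.\<close>

text \<open>Levy's uniqueness theorem with a signed weight: \<open>f + (C + 1)\<close> is positive, and normalising it to a
  density reduces the claim to the unweighted theorem.\<close>

lemma (in prob_space) weighted_char_uniqueness:
  fixes X f :: "'a \<Rightarrow> real"
  assumes X[measurable]: "random_variable borel X"
    and f[measurable]: "f \<in> borel_measurable M"
    and bounded: "\<And>\<omega>. \<bar>f \<omega>\<bar> \<le> C"
    and N: "real_distribution N"
    and char_X: "\<And>s. (\<integral>\<omega>. iexp (s * X \<omega>) \<partial>M) = char N s"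
    and char_fX: "\<And>s. (\<integral>\<omega>. f \<omega> *\<^sub>R iexp (s * X \<omega>) \<partial>M) = of_real \<kappa> * char N s"
    and B[measurable]: "B \<in> sets borel"
  shows "(\<integral>\<omega>. f \<omega> * indicator B (X \<omega>) \<partial>M) = \<kappa> * measure N B"
proof -
  interpret N: real_distribution N by fact
  have int_f[simp]: "integrable M f"
    by (rule integrable_const_bound[where B=C]) (auto simp: bounded)
  \<comment> \<open>Adding \<open>C\<close> alone would only give nonnegativity; the extra 1 keeps
    the total mass \<open>c\<close> at least 1, so that dividing by it is legitimate.\<close>
  define g where "g \<omega> = f \<omega> + (C + 1)" for \<omega>
  have g[measurable]: "g \<in> borel_measurable M" unfolding g_def by measurable
  have g_ge: "g \<omega> \<ge> 1" for \<omega>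
    using bounded[of \<omega>] unfolding g_def by linarith
  have int_g[simp]: "integrable M g" unfolding g_def by simp
  define c where "c = \<kappa> + (C + 1)"
  \<comment> \<open>At frequency 0 the hypothesis on \<open>f\<close> yields its total
    weight.\<close>
  have "(\<integral>\<omega>. f \<omega> \<partial>M) = \<kappa>"
    using char_fX[of 0] by (simp add: N.char_zero flip: of_real_def)
  then have Eg: "(\<integral>\<omega>. g \<omega> \<partial>M) = c"
    by (simp add: g_def c_def prob_space)
  have "1 \<le> (\<integral>\<omega>. g \<omega> \<partial>M)"
    using integral_mono[of M "\<lambda>_. 1" g] g_ge by (simp add: prob_space)
  then have c: "c > 0" using Eg by simp
  have distr_X: "distr M borel X = N"
  proof (rule Levy_uniqueness[OF _ N])
    show "real_distribution (distr M borel X)" by (rule real_distribution_distr) simp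
    show "char (distr M borel X) = char N"
      by (rule ext) (use char_X in \<open>simp add: char_def integral_distr del: of_real_mult\<close>)
  qed
  define M' where "M' = density M (\<lambda>\<omega>. ennreal (g \<omega> / c))"
  have pos: "g \<omega> / c \<ge> 0" for \<omega> using g_ge[of \<omega>] c by simp
  have M': "prob_space M'"
  proof (rule prob_spaceI)
    have "emeasure M' (space M') = (\<integral>\<^sup>+\<omega>. ennreal (g \<omega> / c) \<partial>M)"
      unfolding M'_def by (simp add: emeasure_density cong: nn_integral_cong)
    also have "\<dots> = ennreal (\<integral>\<omega>. g \<omega> / c \<partial>M)"
      by (rule nn_integral_eq_integral) (auto intro: pos)
    also have "\<dots> = 1" using Eg c by simp
    finally show "emeasure M' (space M') = 1" .
  qed
  interpret M': prob_space M' by fact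
  have XM'[measurable]: "X \<in> borel_measurable M'" unfolding M'_def by simp
  have distr_M': "distr M' borel X = N"
  proof (rule Levy_uniqueness[OF _ N])
    show "real_distribution (distr M' borel X)" by (rule M'.real_distribution_distr) simp
    show "char (distr M' borel X) = char N"
    proof
      fix s
      have int1: "integrable M (\<lambda>\<omega>. f \<omega> *\<^sub>R iexp (s * X \<omega>))"
        by (rule integrable_const_bound[where B=C]) (auto simp: bounded)
      have int2: "integrable M (\<lambda>\<omega>. iexp (s * X \<omega>))"
        by (rule integrable_const_bound[where B=1]) auto
      have eq: "(g \<omega> / c) *\<^sub>R iexp (s * X \<omega>) = (1 / c) *\<^sub>R (f \<omega> *\<^sub>R iexp (s * X \<omega>) + (C + 1) *\<^sub>R iexp (s * X \<omega>))" for \<omega>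
        by (simp only: g_def scaleR_add_left[symmetric] scaleR_scaleR) simp
      have "char (distr M' borel X) s = (\<integral>\<omega>. iexp (s * X \<omega>) \<partial>M')"
        by (simp add: char_def integral_distr)
      also have "\<dots> = (\<integral>\<omega>. (g \<omega> / c) *\<^sub>R iexp (s * X \<omega>) \<partial>M)"
        unfolding M'_def by (rule integral_density) (auto intro: pos)
      also have "\<dots> = (\<integral>\<omega>. (1 / c) *\<^sub>R (f \<omega> *\<^sub>R iexp (s * X \<omega>) + (C + 1) *\<^sub>R iexp (s * X \<omega>)) \<partial>M)"
        by (simp only: eq)
      also have "\<dots> = (1 / c) *\<^sub>R (of_real \<kappa> * char N s + (C + 1) *\<^sub>R char N s)"
        using int1 int2 by (simp only: integral_scaleR_right Bochner_Integration.integral_add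
            integrable_scaleR_right char_fX char_X)
      also have "\<dots> = char N s"
      proof -
        have "of_real \<kappa> * char N s + (C + 1) *\<^sub>R char N s = c *\<^sub>R char N s"
          by (simp add: scaleR_conv_of_real c_def algebra_simps)
        then show ?thesis using c by simp
      qed
      finally show "char (distr M' borel X) s = char N s" .
    qed
  qed
  have int_fB: "integrable M (\<lambda>\<omega>. f \<omega> * indicator B (X \<omega>))"
    by (rule integrable_const_bound[where B=C]) (auto simp: bounded indicator_def intro: order_trans[OF abs_ge_zero bounded])
  have int_B: "integrable M (\<lambda>\<omega>. indicator B (X \<omega>) :: real)"
    by (rule integrable_const_bound[where B=1]) (auto simp: indicator_def)
  have NB: "measure N B = (\<integral>\<omega>. indicator B (X \<omega>) \<partial>M)"
    by (subst distr_X[symmetric]) (simp add: measure_distr flip: integral_distr[of X M borel "indicator B"])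
  have "measure N B = (\<integral>\<omega>. indicator B (X \<omega>) \<partial>M')"
    by (subst distr_M'[symmetric]) (simp flip: integral_distr[of X M' borel "indicator B"])
  also have "\<dots> = (\<integral>\<omega>. (g \<omega> / c) *\<^sub>R indicator B (X \<omega>) \<partial>M)"
    unfolding M'_def by (rule integral_density) (auto intro: pos)
  also have "\<dots> = (\<integral>\<omega>. (1 / c) * (f \<omega> * indicator B (X \<omega>) + (C + 1) * indicator B (X \<omega>)) \<partial>M)"
    by (rule Bochner_Integration.integral_cong) (auto simp: g_def algebra_simps divide_simps)
  also have "\<dots> = (1 / c) * ((\<integral>\<omega>. f \<omega> * indicator B (X \<omega>) \<partial>M) + (C + 1) * measure N B)"
    using int_fB int_B by (simp only: integral_mult_right_zero Bochner_Integration.integral_add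
            integrable_mult_right NB)
  finally show ?thesis using c by (simp add: c_def field_simps)
qed

lemma real_distribution_std_normal: "real_distribution std_normal_distribution"
proof -
  interpret prob_space std_normal_distribution
    by (rule prob_space_normal_density) simp
  show ?thesis by unfold_locales auto
qed

text \<open>In place of a multivariate uniqueness theorem, the coordinates in \<open>J\<close> are converted one after the
  other from characteristic functions to indicators of Borel sets.\<close>

lemma (in prob_space) gaussian_mixed_expectation:
  fixes X :: "'i \<Rightarrow> 'a \<Rightarrow> real"
  assumes I: "finite I"
    and X[measurable]: "\<And>i. i \<in> I \<Longrightarrow> random_variable borel (X i)"
    and char_X: "\<And>t. (\<integral>\<omega>. iexp (\<Sum>i\<in>I. t i * X i \<omega>) \<partial>M) = of_real (exp (- (\<Sum>i\<in>I. (t i)\<^sup>2) / 2))"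
    and A[measurable]: "\<And>i. i \<in> I \<Longrightarrow> A i \<in> sets borel"
    and J: "J \<subseteq> I"
  shows "(\<integral>\<omega>. (\<Prod>i\<in>J. indicator (A i) (X i \<omega>)) *\<^sub>R iexp (\<Sum>i\<in>I - J. t i * X i \<omega>) \<partial>M)
         = of_real ((\<Prod>i\<in>J. measure std_normal_distribution (A i)) * exp (- (\<Sum>i\<in>I - J. (t i)\<^sup>2) / 2))"
proof -
  have "finite J" using I J finite_subset by auto
  then show ?thesis using J
  proof (induction J arbitrary: t)
    case empty
    then show ?case by (simp add: char_X del: of_real_sum of_real_mult)
  next
    case (insert j J)
    define W where "W \<omega> = (\<Prod>i\<in>J. indicator (A i) (X i \<omega>) :: real)" for \<omega>
    define R where "R = I - insert j J"
    have R: "I - J = insert j R" "j \<notin> R" "finite R" "R \<subseteq> I"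
      using insert I by (auto simp: R_def)
    define S where "S \<omega> = (\<Sum>i\<in>R. t i * X i \<omega>)" for \<omega>
    define c where "c = (\<Prod>i\<in>J. measure std_normal_distribution (A i))"
    define e where "e = exp (- (\<Sum>i\<in>R. (t i)\<^sup>2) / 2)"
    have jI: "j \<in> I" and JI: "J \<subseteq> I" using insert by auto
    have [measurable]: "X j \<in> borel_measurable M" "A j \<in> sets borel" using jI by auto
    have W_m[measurable]: "W \<in> borel_measurable M"
      unfolding W_def using JI A X by (intro borel_measurable_prod borel_measurable_indicator') auto
    have S_m[measurable]: "S \<in> borel_measurable M"
      unfolding S_def using R(4) X by (intro borel_measurable_sum borel_measurable_times) auto
    have W01: "0 \<le> W \<omega>" "W \<omega> \<le> 1" for \<omega>
      unfolding W_def by (auto intro!: prod_nonneg prod_le_1)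
    have bW: "\<bar>W \<omega> * x\<bar> \<le> 1" if "\<bar>x\<bar> \<le> 1" for \<omega> x
      using W01[of \<omega>] that by (simp add: abs_mult mult_le_one)
    \<comment> \<open>The weight in \<open>weighted_char_uniqueness\<close> has to be real, so the
      exponential of \<open>S\<close> is split into cosine and sine. Both are combinations of the
      cases \<open>u = 1\<close> and \<open>u = -1\<close>.\<close>
    have IH: "(\<integral>\<omega>. W \<omega> *\<^sub>R iexp (u * S \<omega> + s * X j \<omega>) \<partial>M) = of_real (c * e * exp (- s\<^sup>2 / 2))"
      if "u = 1 \<or> u = -1" for u s
    proof -
      have eq: "(\<Sum>i\<in>R. (if i = j then s else u * t i) * X i \<omega>) = u * S \<omega>" for \<omega>
        unfolding S_def sum_distrib_left using R(2) by (intro sum.cong) auto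
      have eq2: "(\<Sum>i\<in>R. (if i = j then s else u * t i)\<^sup>2) = (\<Sum>i\<in>R. (t i)\<^sup>2)"
        using R(2) that by (intro sum.cong) auto
      show ?thesis
        using insert.IH[OF JI, of "\<lambda>i. if i = j then s else u * t i"] R
        by (simp add: eq eq2 W_def[symmetric] c_def[symmetric] e_def add.commute
            diff_divide_distrib mult.assoc flip: exp_add)
    qed
    have int: "integrable M (\<lambda>\<omega>. W \<omega> *\<^sub>R iexp (u * S \<omega> + s * X j \<omega>))" for u s
      by (rule integrable_const_bound[where B=1]) (use W01 in auto)
    have char_j: "(\<integral>\<omega>. iexp (s * X j \<omega>) \<partial>M) = char std_normal_distribution s" for s
    proof -
      have "(\<Sum>i\<in>I. (if i = j then s else 0) * X i \<omega>) = s * X j \<omega>" for \<omega>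
        using I jI by (subst sum.remove[of _ j]) (auto intro!: sum.neutral)
      moreover have "(\<Sum>i\<in>I. (if i = j then s else 0)\<^sup>2) = s\<^sup>2"
        using I jI by (subst sum.remove[of _ j]) (auto intro!: sum.neutral)
      ultimately show ?thesis
        using char_X[of "\<lambda>i. if i = j then s else 0"] by (simp add: char_std_normal_distribution)
    qed
    have "(\<integral>\<omega>. (W \<omega> * cos (S \<omega>)) *\<^sub>R iexp (s * X j \<omega>) \<partial>M)
          = of_real (c * e) * char std_normal_distribution s" for s
    proof -
      have "(W \<omega> * cos (S \<omega>)) *\<^sub>R iexp (s * X j \<omega>)
        = (1/2) *\<^sub>R (W \<omega> *\<^sub>R iexp (1 * S \<omega> + s * X j \<omega>) + W \<omega> *\<^sub>R iexp ((-1) * S \<omega> + s * X j \<omega>))" for \<omega>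
        by (auto simp: complex_eq_iff Re_exp Im_exp cos_add sin_add cos_diff sin_diff algebra_simps)
      then show ?thesis
        using int by (simp only: integral_scaleR_right Bochner_Integration.integral_add IH simp_thms)
          (simp add: char_std_normal_distribution scaleR_conv_of_real)
    qed
    then have cos: "(\<integral>\<omega>. (W \<omega> * cos (S \<omega>)) * indicator (A j) (X j \<omega>) \<partial>M)
          = c * e * measure std_normal_distribution (A j)"
      by (intro weighted_char_uniqueness[where C=1] char_j real_distribution_std_normal bW) auto
    \<comment> \<open>The values for \<open>u = 1\<close> and \<open>u = -1\<close> agree, because
      the Gaussian factor sees only the squares of the coefficients. They cancel in the sine, which
      is the case of weight 0.\<close>
    have "(\<integral>\<omega>. (W \<omega> * sin (S \<omega>)) *\<^sub>R iexp (s * X j \<omega>) \<partial>M)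
          = of_real 0 * char std_normal_distribution s" for s
    proof -
      have "(W \<omega> * sin (S \<omega>)) *\<^sub>R iexp (s * X j \<omega>)
        = (- \<i> / 2) * (W \<omega> *\<^sub>R iexp (1 * S \<omega> + s * X j \<omega>) - W \<omega> *\<^sub>R iexp ((-1) * S \<omega> + s * X j \<omega>))" for \<omega>
        by (auto simp: complex_eq_iff Re_exp Im_exp cos_add sin_add cos_diff sin_diff field_simps)
      then show ?thesis
        using int by (simp only: integral_mult_right_zero Bochner_Integration.integral_diff IH simp_thms) simp
    qed
    then have sin: "(\<integral>\<omega>. (W \<omega> * sin (S \<omega>)) * indicator (A j) (X j \<omega>) \<partial>M)
          = 0 * measure std_normal_distribution (A j)"
      by (intro weighted_char_uniqueness[where C=1] char_j real_distribution_std_normal bW) auto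
    have int_cs: "integrable M (\<lambda>\<omega>. (W \<omega> * h (S \<omega>)) * indicator (A j) (X j \<omega>))"
      if "h \<in> borel_measurable borel" "\<And>x. \<bar>h x\<bar> \<le> 1" for h :: "real \<Rightarrow> real"
      using that(1) by (intro integrable_const_bound[where B=1]) (use bW that(2) in \<open>auto simp: indicator_def\<close>)
    have prod: "(\<Prod>i\<in>insert j J. indicator (A i) (X i \<omega>)) *\<^sub>R iexp (S \<omega>)
       = of_real (W \<omega> * cos (S \<omega>) * indicator (A j) (X j \<omega>))
         + \<i> * of_real (W \<omega> * sin (S \<omega>) * indicator (A j) (X j \<omega>))" for \<omega>
    proof -
      have "(\<Prod>i\<in>insert j J. indicator (A i) (X i \<omega>)) = W \<omega> * indicator (A j) (X j \<omega>)"
        using insert(1,2) by (simp add: W_def)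
      then show ?thesis by (simp add: complex_eq_iff Re_exp Im_exp)
    qed
    have int_c: "complex_integrable M (\<lambda>\<omega>. of_real (W \<omega> * cos (S \<omega>) * indicator (A j) (X j \<omega>)))"
      by (intro integrable_of_real int_cs) auto
    have int_s: "complex_integrable M (\<lambda>\<omega>. \<i> * of_real (W \<omega> * sin (S \<omega>) * indicator (A j) (X j \<omega>)))"
      by (intro integrable_mult_right integrable_of_real int_cs) auto
    have "(\<integral>\<omega>. (\<Prod>i\<in>insert j J. indicator (A i) (X i \<omega>)) *\<^sub>R iexp (S \<omega>) \<partial>M)
      = of_real (c * e * measure std_normal_distribution (A j))"
      by (simp only: prod Bochner_Integration.integral_add[OF int_c int_s] integral_mult_right_zero
          integral_complex_of_real cos sin) simp
    then show ?case
      using insert(1,2) by (simp add: S_def R_def c_def e_def mult_ac)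
  qed
qed

text \<open>Setting the remaining frequencies to zero in the mixed expectation leaves the
  probability of a box, and the other side becomes the product of the standard normal masses. A box
  over a single index identifies the marginal law.\<close>

lemma (in prob_space) gaussian_char_imp_indep:
  fixes X :: "'i \<Rightarrow> 'a \<Rightarrow> real"
  assumes I: "finite I"
    and X[measurable]: "\<And>i. i \<in> I \<Longrightarrow> random_variable borel (X i)"
    and char_X: "\<And>t. (\<integral>\<omega>. iexp (\<Sum>i\<in>I. t i * X i \<omega>) \<partial>M) = of_real (exp (- (\<Sum>i\<in>I. (t i)\<^sup>2) / 2))"
  shows "indep_vars (\<lambda>_. borel) X I"
    and "i \<in> I \<Longrightarrow> distr M borel (X i) = std_normal_distribution"
proof -
  interpret N: real_distribution std_normal_distribution by (rule real_distribution_std_normal)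
  have joint: "prob (\<Inter>i\<in>J. X i -` A i \<inter> space M) = (\<Prod>i\<in>J. measure std_normal_distribution (A i))"
    if J: "J \<subseteq> I" "J \<noteq> {}" and A: "\<And>i. i \<in> I \<Longrightarrow> A i \<in> sets borel" for J A
  proof -
    have fin: "finite J" using I J finite_subset by auto
    have sets: "(\<Inter>i\<in>J. X i -` A i \<inter> space M) \<in> events"
      using J fin A X by (intro sets.finite_INT) (auto intro!: measurable_sets[where A=borel])
    have "complex_of_real (prob (\<Inter>i\<in>J. X i -` A i \<inter> space M))
      = of_real (\<integral>\<omega>. (\<Prod>i\<in>J. indicator (A i) (X i \<omega>)) \<partial>M)"
    proof -
      have "(\<integral>\<omega>. (\<Prod>i\<in>J. indicator (A i) (X i \<omega>) :: real) \<partial>M) = (\<integral>\<omega>. indicator (\<Inter>i\<in>J. X i -` A i \<inter> space M) \<omega> \<partial>M)"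
      proof (rule Bochner_Integration.integral_cong)
        fix \<omega> assume "\<omega> \<in> space M"
        then have "\<And>i. indicator (A i) (X i \<omega>) = (indicator (X i -` A i \<inter> space M) \<omega> :: real)"
          by (auto simp: indicator_def)
        then show "(\<Prod>i\<in>J. indicator (A i) (X i \<omega>)) = (indicator (\<Inter>i\<in>J. X i -` A i \<inter> space M) \<omega> :: real)"
          using fin J(2) \<open>\<omega> \<in> space M\<close> by (auto simp: indicator_def prod_zero_iff)
      qed simp
      then show ?thesis using sets by simp
    qed
    also have "\<dots> = (\<integral>\<omega>. (\<Prod>i\<in>J. indicator (A i) (X i \<omega>)) *\<^sub>R iexp (\<Sum>i\<in>I - J. 0 * X i \<omega>) \<partial>M)"
      by (subst integral_complex_of_real[symmetric]) (simp add: scaleR_conv_of_real)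
    also have "\<dots> = of_real (\<Prod>i\<in>J. measure std_normal_distribution (A i))"
      by (subst gaussian_mixed_expectation[OF I X char_X A J(1)]) auto
    finally show ?thesis by (simp only: of_real_eq_iff)
  qed
  have one: "prob (X i -` A \<inter> space M) = measure std_normal_distribution A"
    if "i \<in> I" "A \<in> sets borel" for i A
    using joint[of "{i}" "\<lambda>_. A"] that by simp
  show "distr M borel (X i) = std_normal_distribution" if "i \<in> I" for i
    using that one[OF that]
    by (intro measure_eqI) (auto simp: emeasure_distr emeasure_eq_measure N.emeasure_eq_measure)
  show "indep_vars (\<lambda>_. borel) X I"
    unfolding indep_vars_def2
  proof (intro conjI ballI indep_setsI)
    fix A J assume J: "J \<noteq> {}" "J \<subseteq> I" "finite J"
      and A: "\<forall>j\<in>J. A j \<in> {X j -` A \<inter> space M |A. A \<in> sets borel}"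
    then obtain B where B: "\<And>j. j \<in> J \<Longrightarrow> B j \<in> sets borel \<and> A j = X j -` B j \<inter> space M"
      by (auto simp: Ball_def) metis
    \<comment> \<open>\<open>joint\<close> wants a Borel set at every index in \<open>I\<close>; the
      value outside \<open>J\<close> does not enter the product.\<close>
    define B' where "B' j = (if j \<in> J then B j else UNIV)" for j
    have "(\<Inter>j\<in>J. A j) = (\<Inter>j\<in>J. X j -` B' j \<inter> space M)"
      using B by (intro INF_cong) (auto simp: B'_def)
    moreover have "(\<Prod>j\<in>J. prob (A j)) = (\<Prod>j\<in>J. measure std_normal_distribution (B' j))"
      using B J by (intro prod.cong) (auto simp: B'_def one)
    ultimately show "prob (\<Inter>j\<in>J. A j) = (\<Prod>j\<in>J. prob (A j))"
      using joint[of J B'] J B by (auto simp: B'_def)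
  qed (auto intro!: measurable_sets[where A=borel])
qed

section \<open>Orthonormal linear forms in independent standard normal variables\<close>

lemma prob_space_std_normal: "prob_space std_normal_distribution"
  by (rule prob_space_normal_density) simp

lemma normal_law_0_1: "normal_law 0 1 = std_normal_distribution"
  unfolding normal_law_def by (simp add: distr_id2)

lemma indep_vars_PiM_components:
  assumes N: "\<And>i. i \<in> I \<Longrightarrow> prob_space (N i)"
    and sets_N: "\<And>i. i \<in> I \<Longrightarrow> sets (N i) = sets (B i)"
  shows "prob_space.indep_vars (PiM I N) B (\<lambda>i x. x i) I"
proof (cases "I = {}")
  \<comment> \<open>The criterion by the joint law used below is for nonempty index sets; an empty
    family is independent outright.\<close>
  case True
  interpret prob_space "PiM I N" by (rule prob_space_PiM) (simp add: N)
  show ?thesis unfolding indep_vars_def indep_sets_def by (simp add: True)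
next
  case False
  interpret prob_space "PiM I N" by (rule prob_space_PiM) (simp add: N)
  have rv: "random_variable (B i) (\<lambda>x. x i)" if "i \<in> I" for i
    using measurable_component_singleton[OF that, of N] sets_N[OF that]
    by (simp cong: measurable_cong_sets)
  have comp: "distr (PiM I N) (B i) (\<lambda>x. x i) = N i" if "i \<in> I" for i
  proof -
    have "distr (PiM I N) (B i) (\<lambda>x. x i) = distr (PiM I N) (N i) (\<lambda>x. x i)"
      by (rule distr_cong) (simp_all add: sets_N that)
    then show ?thesis using distr_PiM_component[of I N i] N that by simp
  qed
  have "distr (PiM I N) (PiM I B) (\<lambda>x. \<lambda>i\<in>I. x i) = distr (PiM I N) (PiM I N) (\<lambda>x. x)"
    by (rule distr_cong) (auto intro!: sets_PiM_cong simp: sets_N space_PiM)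
  also have "\<dots> = PiM I N" by simp
  also have "\<dots> = PiM I (\<lambda>i. distr (PiM I N) (B i) (\<lambda>x. x i))"
    by (intro PiM_cong) (simp_all add: comp)
  finally show ?thesis
    by (subst indep_vars_iff_distr_eq_PiM'[OF False rv]) auto
qed

lemma distr_PiM_std_normal_component:
  "e \<in> I \<Longrightarrow> distr (PiM I (\<lambda>_. std_normal_distribution)) borel (\<lambda>z. z e) = std_normal_distribution"
proof -
  assume e: "e \<in> I"
  have "distr (PiM I (\<lambda>_. std_normal_distribution)) borel (\<lambda>z. z e)
     = distr (PiM I (\<lambda>_. std_normal_distribution)) std_normal_distribution (\<lambda>z. z e)"
    by (rule distr_cong) simp_all
  then show ?thesis
    using distr_PiM_component[OF _ e, of "\<lambda>_. std_normal_distribution"] prob_space_std_normal by simp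
qed

text \<open>Rotation invariance: the characteristic function of \<open>G\<close> depends on a
  frequency vector only through its Euclidean norm, and by orthonormality the combination of the
  \<open>u j\<close> with coefficients \<open>t j\<close> has the norm of \<open>t\<close>.\<close>

lemma orthonormal_gaussian_indep:
  fixes u :: "'j \<Rightarrow> 'i \<Rightarrow> real"
  assumes I: "finite I" and J: "finite J"
    and ortho: "\<And>j k. j \<in> J \<Longrightarrow> k \<in> J \<Longrightarrow> (\<Sum>e\<in>I. u j e * u k e) = (if j = k then 1 else 0)"
  defines "G \<equiv> PiM I (\<lambda>_. std_normal_distribution)"
  shows "prob_space.indep_vars G (\<lambda>_. borel) (\<lambda>j z. \<Sum>e\<in>I. u j e * z e) J"
    and "j \<in> J \<Longrightarrow> distr G borel (\<lambda>z. \<Sum>e\<in>I. u j e * z e) = std_normal_distribution"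
proof -
  interpret prob_space G unfolding G_def by (intro prob_space_PiM prob_space_std_normal)
  have comp[measurable]: "random_variable borel (\<lambda>z. z e)" if "e \<in> I" for e
    using measurable_component_singleton[OF that, of "\<lambda>_. std_normal_distribution"]
    unfolding G_def by (simp cong: measurable_cong_sets)
  have indep: "indep_vars (\<lambda>_. borel) (\<lambda>e z. z e) I"
    unfolding G_def by (rule indep_vars_PiM_components) (auto intro: prob_space_std_normal)
  have indep_c: "indep_vars (\<lambda>_. borel) (\<lambda>e z. c e * z e) I" for c :: "'i \<Rightarrow> real"
    by (rule indep_vars_compose2[OF indep]) auto
  have char1: "char (distr G borel (\<lambda>z. c * z e)) 1 = of_real (exp (- c\<^sup>2 / 2))" if e: "e \<in> I" for c e
  proof -
    have "char (distr G borel (\<lambda>z. c * z e)) 1 = char (distr G borel (\<lambda>z. z e)) c"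
      using e by (simp add: char_def integral_distr)
    then show ?thesis
      using e distr_PiM_std_normal_component[OF e] by (simp add: G_def char_std_normal_distribution)
  qed
  have char_c: "(\<integral>z. iexp (\<Sum>e\<in>I. c e * z e) \<partial>G) = of_real (exp (- (\<Sum>e\<in>I. (c e)\<^sup>2) / 2))" for c
  proof -
    have "(\<integral>z. iexp (\<Sum>e\<in>I. c e * z e) \<partial>G) = char (distr G borel (\<lambda>z. \<Sum>e\<in>I. c e * z e)) 1"
      by (simp add: char_def integral_distr)
    also have "\<dots> = (\<Prod>e\<in>I. of_real (exp (- (c e)\<^sup>2 / 2)))"
      by (simp only: char_distr_sum[OF indep_c] char1 cong: prod.cong)
    also have "\<dots> = of_real (exp (\<Sum>e\<in>I. - (c e)\<^sup>2 / 2))"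
      by (simp add: exp_sum[OF I])
    also have "(\<Sum>e\<in>I. - (c e)\<^sup>2 / 2) = - (\<Sum>e\<in>I. (c e)\<^sup>2) / 2"
      by (simp add: sum_divide_distrib sum_negf)
    finally show ?thesis .
  qed
  have char_u: "(\<integral>z. iexp (\<Sum>j\<in>J. t j * (\<Sum>e\<in>I. u j e * z e)) \<partial>G) = of_real (exp (- (\<Sum>j\<in>J. (t j)\<^sup>2) / 2))" for t
  proof -
    have lin: "(\<Sum>j\<in>J. t j * (\<Sum>e\<in>I. u j e * z e)) = (\<Sum>e\<in>I. (\<Sum>j\<in>J. t j * u j e) * z e)" for z
      unfolding sum_distrib_left sum_distrib_right by (subst sum.swap) (simp add: mult_ac)
    have "(\<Sum>e\<in>I. (\<Sum>j\<in>J. t j * u j e)\<^sup>2) = (\<Sum>e\<in>I. \<Sum>j\<in>J. \<Sum>k\<in>J. t j * t k * (u j e * u k e))"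
      by (simp add: power2_eq_square sum_product mult_ac)
    also have "\<dots> = (\<Sum>j\<in>J. \<Sum>k\<in>J. t j * t k * (\<Sum>e\<in>I. u j e * u k e))"
      by (subst sum.swap, intro sum.cong refl, subst sum.swap) (simp add: sum_distrib_left)
    also have "\<dots> = (\<Sum>j\<in>J. \<Sum>k\<in>J. if j = k then t j * t k else 0)"
      by (intro sum.cong refl) (simp add: ortho)
    also have "\<dots> = (\<Sum>j\<in>J. (t j)\<^sup>2)"
      using J by (simp add: power2_eq_square)
    finally show ?thesis by (simp only: lin char_c)
  qed
  note * = gaussian_char_imp_indep[OF J _ char_u]
  show "indep_vars (\<lambda>_. borel) (\<lambda>j z. \<Sum>e\<in>I. u j e * z e) J"
    by (rule *(1)) auto
  show "distr G borel (\<lambda>z. \<Sum>e\<in>I. u j e * z e) = std_normal_distribution" if "j \<in> J"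
    by (rule *(2)) (use that in auto)
qed

section \<open>Orthonormal bases of projections and chi-square laws\<close>

text \<open>An orthogonal projection needs no spectral theorem: each of its columns is already fixed
  by it, so a normalised nonzero column can be split off as a rank-one projection. The induction on
  the trace proves at the same time that trace and rank agree.\<close>

lemma symmetric_idempotent_decomposition:
  fixes p :: "'i \<Rightarrow> 'i \<Rightarrow> real"
  assumes I: "finite I"
    and sym: "\<And>e f. e \<in> I \<Longrightarrow> f \<in> I \<Longrightarrow> p e f = p f e"
    and idem: "\<And>e f. e \<in> I \<Longrightarrow> f \<in> I \<Longrightarrow> (\<Sum>g\<in>I. p e g * p g f) = p e f"
    and trace: "(\<Sum>e\<in>I. p e e) = real r"
  obtains u :: "nat \<Rightarrow> 'i \<Rightarrow> real" where
    "\<And>i j. i \<in> {1..r} \<Longrightarrow> j \<in> {1..r} \<Longrightarrow> (\<Sum>e\<in>I. u i e * u j e) = (if i = j then 1 else 0)"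
    "\<And>e f. e \<in> I \<Longrightarrow> f \<in> I \<Longrightarrow> p e f = (\<Sum>i=1..r. u i e * u i f)"
proof -
  have "\<exists>u :: nat \<Rightarrow> 'i \<Rightarrow> real.
     (\<forall>i\<in>{1..r}. \<forall>j\<in>{1..r}. (\<Sum>e\<in>I. u i e * u j e) = (if i = j then 1 else 0)) \<and>
     (\<forall>e\<in>I. \<forall>f\<in>I. p e f = (\<Sum>i=1..r. u i e * u i f))"
    using sym idem trace
  proof (induction r arbitrary: p)
    case 0
    \<comment> \<open>A diagonal entry of a symmetric idempotent matrix is the squared norm of its
      row. A zero trace therefore forces the whole matrix to vanish.\<close>
    have diag: "p e e = (\<Sum>g\<in>I. (p e g)\<^sup>2)" if "e \<in> I" for e
      unfolding 0(2)[OF that that, symmetric] power2_eq_square by (intro sum.cong refl) (simp add: 0(1) that)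
    have "p e e = 0" if "e \<in> I" for e
    proof -
      have "p f f \<ge> 0" if "f \<in> I" for f unfolding diag[OF that] by (rule sum_nonneg) simp
      then show ?thesis using 0(3) sum_nonneg_eq_0_iff[OF I, of "\<lambda>e. p e e"] that by simp
    qed
    then have "(\<Sum>g\<in>I. (p e g)\<^sup>2) = 0" if "e \<in> I" for e
      unfolding diag[OF that, symmetric] using that by blast
    then have "p e f = 0" if "e \<in> I" "f \<in> I" for e f
      using sum_nonneg_eq_0_iff[OF I, of "\<lambda>g. (p e g)\<^sup>2"] that by simp
    then show ?case by simp
  next
    case (Suc r)
    \<comment> \<open>Split off the rank-one projection onto a normalised nonzero column \<open>w\<close>; the trace drops by 1.\<close>
    have diag: "p e e = (\<Sum>g\<in>I. (p e g)\<^sup>2)" if "e \<in> I" for e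
      unfolding Suc.prems(2)[OF that that, symmetric] power2_eq_square by (intro sum.cong refl) (simp add: Suc.prems(1) that)
    have "\<exists>e\<in>I. p e e \<noteq> 0"
    proof (rule ccontr)
      assume "\<not> (\<exists>e\<in>I. p e e \<noteq> 0)"
      then have "(\<Sum>e\<in>I. p e e) = 0" by (intro sum.neutral) blast
      then show False using Suc.prems(3) by simp
    qed
    then obtain e0 where e0: "e0 \<in> I" "p e0 e0 \<noteq> 0" by auto
    have pos: "p e0 e0 > 0"
    proof -
      have "p e0 e0 \<ge> 0" unfolding diag[OF e0(1)] by (rule sum_nonneg) simp
      then show ?thesis using e0(2) by simp
    qed
    \<comment> \<open>By \<open>diag\<close> the squared norm of this column is
      \<open>p e0 e0\<close> itself, hence the root in the denominator.\<close>
    define w where "w e = p e e0 / sqrt (p e0 e0)" for e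
    have w_norm: "(\<Sum>e\<in>I. w e * w e) = 1"
    proof -
      have "(\<Sum>e\<in>I. w e * w e) = (\<Sum>e\<in>I. (p e0 e)\<^sup>2 / p e0 e0)"
      proof (intro sum.cong refl)
        fix e assume "e \<in> I"
        then have "p e e0 = p e0 e" by (rule Suc.prems(1)[OF _ e0(1)])
        then show "w e * w e = (p e0 e)\<^sup>2 / p e0 e0"
          using pos by (simp add: w_def power2_eq_square)
      qed
      also have "\<dots> = 1"
        unfolding sum_divide_distrib[symmetric] diag[OF e0(1), symmetric] using pos by simp
      finally show ?thesis .
    qed
    have p_w: "(\<Sum>g\<in>I. p e g * w g) = w e" if "e \<in> I" for e
      using Suc.prems(2)[OF that e0(1)] by (simp add: w_def sum_divide_distrib[symmetric])
    define q where "q e f = p e f - w e * w f" for e f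
    have q_sym: "q e f = q f e" if "e \<in> I" "f \<in> I" for e f
      using Suc.prems(1)[OF that] by (simp add: q_def)
    have q_idem: "(\<Sum>g\<in>I. q e g * q g f) = q e f" if ef: "e \<in> I" "f \<in> I" for e f
    proof -
      have "(\<Sum>g\<in>I. q e g * q g f) = (\<Sum>g\<in>I. p e g * p g f - (p e g * w g) * w f - w e * (p f g * w g) + w e * w f * (w g * w g))"
      proof (intro sum.cong refl)
        fix g assume "g \<in> I"
        then have "p f g = p g f" by (rule Suc.prems(1)[OF ef(2)])
        then show "q e g * q g f = p e g * p g f - (p e g * w g) * w f - w e * (p f g * w g) + w e * w f * (w g * w g)"
          by (simp add: q_def algebra_simps)
      qed
      also have "\<dots> = p e f - w e * w f - w e * w f + w e * w f * 1"
        by (simp add: sum.distrib sum_subtractf sum_distrib_left[symmetric] sum_distrib_right[symmetric]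
            Suc.prems(2) p_w w_norm ef)
      finally show ?thesis by (simp add: q_def)
    qed
    have q_trace: "(\<Sum>e\<in>I. q e e) = real r"
      using Suc.prems(3) w_norm by (simp add: q_def sum_subtractf)
    obtain u :: "nat \<Rightarrow> 'i \<Rightarrow> real" where
      u1: "\<And>i j. i \<in> {1..r} \<Longrightarrow> j \<in> {1..r} \<Longrightarrow> (\<Sum>e\<in>I. u i e * u j e) = (if i = j then 1 else 0)" and
      u2: "\<And>e f. e \<in> I \<Longrightarrow> f \<in> I \<Longrightarrow> q e f = (\<Sum>i=1..r. u i e * u i f)"
      using Suc.IH[OF q_sym q_idem q_trace] by blast
    \<comment> \<open>All these inner products vanish at once: the sum of their squares is the
      quadratic form of \<open>q\<close> at \<open>w\<close>, and \<open>q\<close> maps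
      \<open>w\<close> to 0.\<close>
    have u_w: "(\<Sum>e\<in>I. u i e * w e) = 0" if "i \<in> {1..r}" for i
    proof -
      have "(\<Sum>i=1..r. (\<Sum>e\<in>I. u i e * w e)\<^sup>2) = (\<Sum>e\<in>I. \<Sum>f\<in>I. w e * w f * (\<Sum>i=1..r. u i e * u i f))"
        unfolding power2_eq_square sum_product unfolding sum_distrib_left
        by (subst sum.swap, intro sum.cong refl, subst sum.swap) (simp add: mult_ac)
      also have "\<dots> = (\<Sum>e\<in>I. w e * (\<Sum>f\<in>I. q e f * w f))"
        by (simp add: u2 sum_distrib_left mult_ac cong: sum.cong)
      also have "\<dots> = (\<Sum>e\<in>I. w e * ((\<Sum>f\<in>I. p e f * w f) - w e * (\<Sum>f\<in>I. w f * w f)))"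
        by (simp add: q_def algebra_simps sum_subtractf sum_distrib_left)
      also have "\<dots> = 0" by (simp add: p_w w_norm)
      finally show ?thesis
        using sum_nonneg_eq_0_iff[of "{1..r}" "\<lambda>i. (\<Sum>e\<in>I. u i e * w e)\<^sup>2"] that by simp
    qed
    define u' where "u' i = (if i = Suc r then w else u i)" for i
    have "(\<Sum>e\<in>I. u' i e * u' j e) = (if i = j then 1 else 0)"
      if "i \<in> {1..Suc r}" "j \<in> {1..Suc r}" for i j
      using that u1[of i j] u_w[of i] u_w[of j] w_norm by (auto simp: u'_def mult.commute le_Suc_eq)
    moreover have "p e f = (\<Sum>i=1..Suc r. u' i e * u' i f)" if "e \<in> I" "f \<in> I" for e f
    proof -
      have "(\<Sum>i=1..r. u' i e * u' i f) = q e f"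
        unfolding u2[OF that] by (intro sum.cong) (auto simp: u'_def)
      then show ?thesis by (simp add: u'_def q_def)
    qed
    ultimately show ?case by blast
  qed
  then show thesis using that by blast
qed

lemma sets_chi_square[simp, measurable_cong]: "sets (chi_square k) = sets borel"
  by (simp add: chi_square_def)

text \<open>\<open>chi_square\<close> lives on \<open>{1..k}\<close>; a bijection carries the
  product law over to an arbitrary index set of size \<open>k\<close>. Allowing any \<open>J\<close>
  makes it applicable to a union of blocks, which is how degrees of freedom get added.\<close>

lemma (in prob_space) distr_sum_squares_chi_square:
  fixes X :: "'i \<Rightarrow> 'a \<Rightarrow> real"
  assumes indep: "indep_vars (\<lambda>_. borel) X J" and J: "finite J" "card J = k"
    and std: "\<And>j. j \<in> J \<Longrightarrow> distr M borel (X j) = std_normal_distribution"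
  shows "distr M borel (\<lambda>\<omega>. \<Sum>j\<in>J. (X j \<omega>)\<^sup>2) = chi_square k"
proof -
  obtain h where h: "bij_betw h {1..k} J"
    using J ex_bij_betw_nat_finite_1 by blast
  have hJ: "h ` {1..k} = J" "inj_on h {1..k}" using h by (auto simp: bij_betw_def)
  have X[measurable]: "\<And>j. j \<in> J \<Longrightarrow> random_variable borel (X j)"
    using indep by (auto simp: indep_vars_def2)
  have Xh[measurable]: "\<And>i. i \<in> {1..k} \<Longrightarrow> random_variable borel (X (h i))"
    using hJ by (intro X) blast
  have PiM: "distr M (PiM {1..k} (\<lambda>_. borel)) (\<lambda>\<omega>. \<lambda>i\<in>{1..k}. X (h i) \<omega>)
      = PiM {1..k} (\<lambda>_. std_normal_distribution)"
  proof (cases "{1..k} = {}")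
    \<comment> \<open>For \<open>k = 0\<close> both sides are probability measures on a one-point
      space.\<close>
    case True
    interpret D: prob_space "distr M (PiM {1..k} (\<lambda>_. borel)) (\<lambda>\<omega>. \<lambda>i\<in>{1..k}. X (h i) \<omega>)"
      by (rule prob_space_distr) simp
    show ?thesis
      using D.emeasure_space_1 unfolding True
      by (intro measure_eqI) (auto simp: sets_PiM_empty space_PiM_empty)
  next
    case False
    then have "J \<noteq> {}" using hJ(1) by blast
    have "distr M (PiM J (\<lambda>_. borel)) (\<lambda>\<omega>. \<lambda>j\<in>J. X j \<omega>) = PiM J (\<lambda>j. distr M borel (X j))"
      using indep by (subst (asm) indep_vars_iff_distr_eq_PiM'[OF \<open>J \<noteq> {}\<close>]) auto
    also have "\<dots> = PiM J (\<lambda>_. std_normal_distribution)"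
      by (intro PiM_cong refl std)
    finally have J_law: "distr M (PiM J (\<lambda>_. borel)) (\<lambda>\<omega>. \<lambda>j\<in>J. X j \<omega>) = PiM J (\<lambda>_. std_normal_distribution)" .
    have h_mem: "h i \<in> J" if "i \<in> {1..k}" for i using that hJ(1) by blast
    have "PiM {1..k} (\<lambda>_. std_normal_distribution)
      = distr (PiM J (\<lambda>_. std_normal_distribution)) (PiM {1..k} (\<lambda>_. std_normal_distribution))
          (\<lambda>z. \<lambda>i\<in>{1..k}. z (h i))"
      using distr_PiM_reindex[of J "\<lambda>_. std_normal_distribution" h "{1..k}"] hJ prob_space_std_normal by auto
    also have "\<dots> = distr (PiM J (\<lambda>_. std_normal_distribution)) (PiM {1..k} (\<lambda>_. borel)) (\<lambda>z. \<lambda>i\<in>{1..k}. z (h i))"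
      by (rule distr_cong) (auto intro!: sets_PiM_cong)
    also have "\<dots> = distr M (PiM {1..k} (\<lambda>_. borel)) (\<lambda>\<omega>. \<lambda>i\<in>{1..k}. X (h i) \<omega>)"
      unfolding J_law[symmetric]
      by (subst distr_distr) (use h_mem in \<open>auto simp: comp_def intro!: distr_cong measurable_restrict measurable_component_singleton\<close>)
    finally show ?thesis by (rule sym)
  qed
  have "chi_square k = distr (distr M (PiM {1..k} (\<lambda>_. borel)) (\<lambda>\<omega>. \<lambda>i\<in>{1..k}. X (h i) \<omega>)) borel
     (\<lambda>z. \<Sum>i=1..k. (z i)\<^sup>2)"
    unfolding PiM chi_square_def normal_law_0_1 ..
  also have "\<dots> = distr M borel (\<lambda>\<omega>. \<Sum>i=1..k. (X (h i) \<omega>)\<^sup>2)"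
    by (subst distr_distr) (auto simp: comp_def)
  also have "\<dots> = distr M borel (\<lambda>\<omega>. \<Sum>j\<in>J. (X j \<omega>)\<^sup>2)"
    by (intro arg_cong[where f="distr M borel"] ext sum.reindex_bij_betw[OF h])
  finally show ?thesis by simp
qed

text \<open>Phrased with product laws, so that several blocks can be split off one at a time from a
  single independent family.\<close>

lemma (in prob_space) distr_pair_indep_groups:
  assumes indep: "indep_vars M' X I" and AB: "A \<inter> B = {}" "A \<subseteq> I" "B \<subseteq> I"
    and f: "f \<in> measurable (PiM A M') S" and g: "g \<in> measurable (PiM B M') T"
  shows "distr M (S \<Otimes>\<^sub>M T) (\<lambda>\<omega>. (f (\<lambda>i\<in>A. X i \<omega>), g (\<lambda>i\<in>B. X i \<omega>)))
    = distr M S (\<lambda>\<omega>. f (\<lambda>i\<in>A. X i \<omega>)) \<Otimes>\<^sub>M distr M T (\<lambda>\<omega>. g (\<lambda>i\<in>B. X i \<omega>))"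
proof -
  have rv: "(\<lambda>\<omega>. \<lambda>i\<in>A. X i \<omega>) \<in> measurable M (PiM A M')" "(\<lambda>\<omega>. \<lambda>i\<in>B. X i \<omega>) \<in> measurable M (PiM B M')"
    and joint: "distr M (PiM A M') (\<lambda>\<omega>. \<lambda>i\<in>A. X i \<omega>) \<Otimes>\<^sub>M distr M (PiM B M') (\<lambda>\<omega>. \<lambda>i\<in>B. X i \<omega>)
      = distr M (PiM A M' \<Otimes>\<^sub>M PiM B M') (\<lambda>\<omega>. (\<lambda>i\<in>A. X i \<omega>, \<lambda>i\<in>B. X i \<omega>))"
    using indep_var_restrict[OF indep AB] unfolding indep_var_distribution_eq by auto
  note [measurable] = rv f g
  interpret D: prob_space "distr (distr M (PiM B M') (\<lambda>\<omega>. \<lambda>i\<in>B. X i \<omega>)) T g"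
    by (intro prob_space.prob_space_distr prob_space_distr) auto
  have "distr M S (\<lambda>\<omega>. f (\<lambda>i\<in>A. X i \<omega>)) \<Otimes>\<^sub>M distr M T (\<lambda>\<omega>. g (\<lambda>i\<in>B. X i \<omega>))
    = distr (distr M (PiM A M') (\<lambda>\<omega>. \<lambda>i\<in>A. X i \<omega>)) S f \<Otimes>\<^sub>M distr (distr M (PiM B M') (\<lambda>\<omega>. \<lambda>i\<in>B. X i \<omega>)) T g"
    by (simp add: distr_distr comp_def)
  also have "\<dots> = distr (distr M (PiM A M') (\<lambda>\<omega>. \<lambda>i\<in>A. X i \<omega>) \<Otimes>\<^sub>M distr M (PiM B M') (\<lambda>\<omega>. \<lambda>i\<in>B. X i \<omega>)) (S \<Otimes>\<^sub>M T) (\<lambda>(x, y). (f x, g y))"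
    by (rule pair_measure_distr) (auto intro: D.sigma_finite_measure_axioms)
  also have "\<dots> = distr M (S \<Otimes>\<^sub>M T) (\<lambda>\<omega>. (f (\<lambda>i\<in>A. X i \<omega>), g (\<lambda>i\<in>B. X i \<omega>)))"
    unfolding joint by (subst distr_distr) (auto simp: comp_def)
  finally show ?thesis ..
qed

text \<open>Two versions of one fact: for unequal variances the three sums of squares carry
  different weights and have to be kept apart, for equal variances they merge into one chi-square
  variable and lead to Student's distribution.\<close>

lemma (in prob_space) gaussian_block_law:
  fixes X :: "nat \<times> nat \<Rightarrow> 'a \<Rightarrow> real"
  assumes indep: "indep_vars (\<lambda>_. borel) X J"
    and J: "J = {(0, 1)} \<union> {1} \<times> {1..r1} \<union> {2} \<times> {1..r2} \<union> {3} \<times> {1..r3}"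
    and std: "\<And>j. j \<in> J \<Longrightarrow> distr M borel (X j) = std_normal_distribution"
  defines "Q \<equiv> \<lambda>b r \<omega>. \<Sum>i=1..r. (X (b, i) \<omega>)\<^sup>2"
  shows "distr M (borel \<Otimes>\<^sub>M borel \<Otimes>\<^sub>M borel \<Otimes>\<^sub>M borel) (\<lambda>\<omega>. (X (0, 1) \<omega>, Q 1 r1 \<omega>, Q 2 r2 \<omega>, Q 3 r3 \<omega>))
      = normal_law 0 1 \<Otimes>\<^sub>M chi_square r1 \<Otimes>\<^sub>M chi_square r2 \<Otimes>\<^sub>M chi_square r3"
    and "distr M (borel \<Otimes>\<^sub>M borel) (\<lambda>\<omega>. (X (0, 1) \<omega>, Q 1 r1 \<omega> + Q 2 r2 \<omega> + Q 3 r3 \<omega>))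
      = normal_law 0 1 \<Otimes>\<^sub>M chi_square (r1 + r2 + r3)"
proof -
  note One_nat_def[simp del]
  let ?B1 = "{1} \<times> {1..r1} :: (nat \<times> nat) set" and ?B2 = "{2} \<times> {1..r2} :: (nat \<times> nat) set" and ?B3 = "{3} \<times> {1..r3} :: (nat \<times> nat) set"
  have block: "(\<Sum>j\<in>{b} \<times> {1..r}. f j) = (\<Sum>i=1..r. f (b, i))" for f :: "nat \<times> nat \<Rightarrow> real" and b r :: nat
  proof -
    have "(\<Sum>j\<in>{b} \<times> {1..r}. f j) = (\<Sum>x\<in>{b}. \<Sum>i\<in>{1..r}. f (x, i))"
      by (simp only: sum.cartesian_product) (simp add: case_prod_beta)
    then show ?thesis by simp
  qed
  have chi: "distr M borel (Q b r) = chi_square r" if "{b} \<times> {1..r} \<subseteq> J" for b r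
  proof -
    have "distr M borel (\<lambda>\<omega>. \<Sum>j\<in>{b} \<times> {1..r}. (X j \<omega>)\<^sup>2) = chi_square r"
      using that by (intro distr_sum_squares_chi_square indep_vars_subset[OF indep] std) (auto simp: card_cartesian_product)
    then show ?thesis unfolding Q_def block .
  qed
  have sq[measurable]: "(\<lambda>z. \<Sum>j\<in>B. (z j)\<^sup>2) \<in> borel_measurable (PiM B (\<lambda>_. borel :: real measure))" for B :: "(nat \<times> nat) set"
    by (intro borel_measurable_sum borel_measurable_power) auto
  have restr: "(\<Sum>j\<in>B. ((\<lambda>j\<in>B'. X j \<omega>) j)\<^sup>2) = (\<Sum>j\<in>B. (X j \<omega>)\<^sup>2)" if "B \<subseteq> B'" for B B' \<omega>
    using that by (intro sum.cong) auto
  have sq'[measurable]: "(\<lambda>z. \<Sum>j\<in>B. (z j)\<^sup>2) \<in> borel_measurable (PiM B' (\<lambda>_. borel :: real measure))"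
    if "B \<subseteq> B'" for B B' :: "(nat \<times> nat) set"
    using that by (intro borel_measurable_sum borel_measurable_power measurable_component_singleton) auto
  have Q1: "Q b r \<omega> = (\<Sum>j\<in>{b} \<times> {1..r}. (X j \<omega>)\<^sup>2)" for b r \<omega>
    unfolding Q_def block ..
  have chi1: "distr M borel (\<lambda>\<omega>. Q 1 r1 \<omega>) = chi_square r1" and chi2: "distr M borel (\<lambda>\<omega>. Q 2 r2 \<omega>) = chi_square r2"
    and chi3: "distr M borel (\<lambda>\<omega>. Q 3 r3 \<omega>) = chi_square r3"
    by (intro chi; auto simp: J)+
  \<comment> \<open>The product measure is nested to the right, so the blocks are assembled from the
    last one backwards.\<close>
  have "distr M (borel \<Otimes>\<^sub>M borel) (\<lambda>\<omega>. ((\<lambda>z. \<Sum>j\<in>?B2. (z j)\<^sup>2) (\<lambda>j\<in>?B2. X j \<omega>), (\<lambda>z. \<Sum>j\<in>?B3. (z j)\<^sup>2) (\<lambda>j\<in>?B3. X j \<omega>)))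
    = distr M borel (\<lambda>\<omega>. (\<lambda>z. \<Sum>j\<in>?B2. (z j)\<^sup>2) (\<lambda>j\<in>?B2. X j \<omega>)) \<Otimes>\<^sub>M distr M borel (\<lambda>\<omega>. (\<lambda>z. \<Sum>j\<in>?B3. (z j)\<^sup>2) (\<lambda>j\<in>?B3. X j \<omega>))"
    by (rule distr_pair_indep_groups[OF indep]) (auto simp: J)
  then have s3: "distr M (borel \<Otimes>\<^sub>M borel) (\<lambda>\<omega>. (Q 2 r2 \<omega>, Q 3 r3 \<omega>)) = chi_square r2 \<Otimes>\<^sub>M chi_square r3"
    unfolding restr[OF order_refl] unfolding Q1[symmetric] chi2 chi3 .
  have "distr M (borel \<Otimes>\<^sub>M (borel \<Otimes>\<^sub>M borel)) (\<lambda>\<omega>. ((\<lambda>z. \<Sum>j\<in>?B1. (z j)\<^sup>2) (\<lambda>j\<in>?B1. X j \<omega>),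
       (\<lambda>z. (\<Sum>j\<in>?B2. (z j)\<^sup>2, \<Sum>j\<in>?B3. (z j)\<^sup>2)) (\<lambda>j\<in>?B2 \<union> ?B3. X j \<omega>)))
    = distr M borel (\<lambda>\<omega>. (\<lambda>z. \<Sum>j\<in>?B1. (z j)\<^sup>2) (\<lambda>j\<in>?B1. X j \<omega>)) \<Otimes>\<^sub>M
      distr M (borel \<Otimes>\<^sub>M borel) (\<lambda>\<omega>. (\<lambda>z. (\<Sum>j\<in>?B2. (z j)\<^sup>2, \<Sum>j\<in>?B3. (z j)\<^sup>2)) (\<lambda>j\<in>?B2 \<union> ?B3. X j \<omega>))"
    by (rule distr_pair_indep_groups[OF indep]) (auto simp: J intro!: measurable_Pair sq')
  then have s2: "distr M (borel \<Otimes>\<^sub>M borel \<Otimes>\<^sub>M borel) (\<lambda>\<omega>. (Q 1 r1 \<omega>, Q 2 r2 \<omega>, Q 3 r3 \<omega>))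
      = chi_square r1 \<Otimes>\<^sub>M chi_square r2 \<Otimes>\<^sub>M chi_square r3"
    unfolding restr[OF order_refl] restr[OF Un_upper1] restr[OF Un_upper2]
    unfolding Q1[symmetric] chi1 s3 .
  let ?B = "?B1 \<union> ?B2 \<union> ?B3"
  have sub: "?B1 \<subseteq> ?B" "?B2 \<subseteq> ?B" "?B3 \<subseteq> ?B" by auto
  have "distr M (borel \<Otimes>\<^sub>M (borel \<Otimes>\<^sub>M borel \<Otimes>\<^sub>M borel)) (\<lambda>\<omega>. ((\<lambda>z. z (0,1)) (\<lambda>j\<in>{(0,1)}. X j \<omega>),
       (\<lambda>z. (\<Sum>j\<in>?B1. (z j)\<^sup>2, \<Sum>j\<in>?B2. (z j)\<^sup>2, \<Sum>j\<in>?B3. (z j)\<^sup>2)) (\<lambda>j\<in>?B. X j \<omega>)))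
    = distr M borel (\<lambda>\<omega>. (\<lambda>z. z (0,1)) (\<lambda>j\<in>{(0,1)}. X j \<omega>)) \<Otimes>\<^sub>M
      distr M (borel \<Otimes>\<^sub>M borel \<Otimes>\<^sub>M borel) (\<lambda>\<omega>. (\<lambda>z. (\<Sum>j\<in>?B1. (z j)\<^sup>2, \<Sum>j\<in>?B2. (z j)\<^sup>2, \<Sum>j\<in>?B3. (z j)\<^sup>2)) (\<lambda>j\<in>?B. X j \<omega>))"
    by (rule distr_pair_indep_groups[OF indep]) (auto simp: J intro!: measurable_Pair sq' sub)
  then show "distr M (borel \<Otimes>\<^sub>M borel \<Otimes>\<^sub>M borel \<Otimes>\<^sub>M borel) (\<lambda>\<omega>. (X (0, 1) \<omega>, Q 1 r1 \<omega>, Q 2 r2 \<omega>, Q 3 r3 \<omega>))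
      = normal_law 0 1 \<Otimes>\<^sub>M chi_square r1 \<Otimes>\<^sub>M chi_square r2 \<Otimes>\<^sub>M chi_square r3"
    unfolding restr[OF sub(1)] restr[OF sub(2)] restr[OF sub(3)]
    using std[of "(0,1)"] s2 by (simp add: Q1[symmetric] J normal_law_0_1)
  have sumB: "(\<Sum>j\<in>?B. (X j \<omega>)\<^sup>2) = Q 1 r1 \<omega> + Q 2 r2 \<omega> + Q 3 r3 \<omega>" for \<omega>
    by (subst sum.union_disjoint; (subst sum.union_disjoint)?) (auto simp: Q1)
  have cardB: "card ?B = r1 + r2 + r3"
    by (subst card_Un_disjoint; (subst card_Un_disjoint)?) (auto simp: card_cartesian_product)
  have "distr M (borel \<Otimes>\<^sub>M borel) (\<lambda>\<omega>. ((\<lambda>z. z (0,1)) (\<lambda>j\<in>{(0,1)}. X j \<omega>),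
       (\<lambda>z. \<Sum>j\<in>?B. (z j)\<^sup>2) (\<lambda>j\<in>?B. X j \<omega>)))
    = distr M borel (\<lambda>\<omega>. (\<lambda>z. z (0,1)) (\<lambda>j\<in>{(0,1)}. X j \<omega>)) \<Otimes>\<^sub>M
      distr M borel (\<lambda>\<omega>. (\<lambda>z. \<Sum>j\<in>?B. (z j)\<^sup>2) (\<lambda>j\<in>?B. X j \<omega>))"
    by (rule distr_pair_indep_groups[OF indep]) (auto simp: J intro!: measurable_Pair sq')
  moreover have "distr M borel (\<lambda>\<omega>. \<Sum>j\<in>?B. (X j \<omega>)\<^sup>2) = chi_square (r1 + r2 + r3)"
    by (rule distr_sum_squares_chi_square[OF indep_vars_subset[OF indep]]) (use cardB std in \<open>auto simp: J\<close>)
  ultimately show "distr M (borel \<Otimes>\<^sub>M borel) (\<lambda>\<omega>. (X (0, 1) \<omega>, Q 1 r1 \<omega> + Q 2 r2 \<omega> + Q 3 r3 \<omega>))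
      = normal_law 0 1 \<Otimes>\<^sub>M chi_square (r1 + r2 + r3)"
    unfolding restr[OF order_refl] using std[of "(0,1)"] by (simp add: sumB J normal_law_0_1)
qed

section \<open>Centering as a projection\<close>

declare One_nat_def [simp del]

text \<open>One coordinate for each unordered pair of observations: the limit has an independent
  Gaussian for each \<open>s < t\<close>, not for each ordered pair.\<close>

definition upper_pairs :: "nat \<Rightarrow> (nat \<times> nat) set" where
  "upper_pairs n = {(s, t). 1 \<le> s \<and> s < t \<and> t \<le> n}"

text \<open>Reads \<open>c\<close> only above the diagonal. This turns a vector indexed by
  \<open>upper_pairs n\<close> into a matrix on which \<open>U_centered\<close> can act.\<close>

definition sym_matrix :: "(nat \<Rightarrow> nat \<Rightarrow> real) \<Rightarrow> nat \<Rightarrow> nat \<Rightarrow> real" where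
  "sym_matrix c k l = (if k < l then c k l else if l < k then c l k else 0)"

lemma finite_upper_pairs[simp]: "finite (upper_pairs n)"
  by (rule finite_subset[of _ "{1..n} \<times> {1..n}"]) (auto simp: upper_pairs_def)

lemma sum_upper_pairs:
  "(\<Sum>(s, t)\<in>upper_pairs n. f s t) = (\<Sum>s=1..n. \<Sum>t=1..n. if s < t then f s t else (0::real))"
proof -
  have "upper_pairs n = {p \<in> {1..n} \<times> {1..n}. fst p < snd p}"
    by (auto simp: upper_pairs_def)
  then have "(\<Sum>(s, t)\<in>upper_pairs n. f s t) = (\<Sum>p\<in>{1..n} \<times> {1..n}. if fst p < snd p then f (fst p) (snd p) else 0)"
    by (simp add: case_prod_unfold sum.inter_filter)
  then show ?thesis by (simp add: sum.cartesian_product case_prod_unfold)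
qed

lemma sym_matrix_sym: "sym_matrix c k l = sym_matrix c l k"
  and sym_matrix_diag[simp]: "sym_matrix c k k = 0"
  by (auto simp: sym_matrix_def)

lemma sym_matrix_of_symmetric:
  assumes "\<And>i j. A i j = A j i" "\<And>i. A i i = 0"
  shows "sym_matrix A = A"
  using assms by (auto simp: fun_eq_iff sym_matrix_def not_less_iff_gr_or_eq)

text \<open>In the coordinates \<open>s < t\<close> a row sum collects the pairs that contain
  \<open>k\<close>. This is the origin of the incidence terms in the kernel of U-centering.\<close>

lemma row_sum_sym_matrix:
  assumes k: "k \<in> {1..n}"
  shows "(\<Sum>j=1..n. sym_matrix c k j)
    = (\<Sum>(s, t)\<in>upper_pairs n. (of_bool (k = s) + of_bool (k = t)) * c s t)"
proof -
  have "(\<Sum>(s, t)\<in>upper_pairs n. (of_bool (k = s) + of_bool (k = t)) * c s t)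
    = (\<Sum>s=1..n. \<Sum>t=1..n. if k = s then (if s < t then c s t else 0) else 0)
      + (\<Sum>s=1..n. \<Sum>t=1..n. if k = t then (if s < t then c s t else 0) else 0)"
    unfolding sum_upper_pairs sum.distrib[symmetric]
    by (intro sum.cong refl) auto
  also have "(\<Sum>s=1..n. \<Sum>t=1..n. if k = s then (if s < t then c s t else 0) else 0)
      = (\<Sum>t=1..n. if k < t then c k t else 0)"
    by (subst sum.swap) (use k in simp)
  also have "(\<Sum>s=1..n. \<Sum>t=1..n. if k = t then (if s < t then c s t else 0) else 0)
      = (\<Sum>s=1..n. if s < k then c s k else 0)"
    using k by simp
  finally show ?thesis
    unfolding sum.distrib[symmetric] by (auto simp: sym_matrix_def intro!: sum.cong)
qed

lemma total_sum_sym_matrix: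
  "(\<Sum>i=1..n. \<Sum>j=1..n. sym_matrix c i j) = 2 * (\<Sum>(s, t)\<in>upper_pairs n. c s t)"
proof -
  have "(\<Sum>i=1..n. \<Sum>j=1..n. sym_matrix c i j)
    = (\<Sum>i=1..n. \<Sum>j=1..n. if i < j then c i j else 0) + (\<Sum>i=1..n. \<Sum>j=1..n. if j < i then c j i else 0)"
    unfolding sum.distrib[symmetric] by (intro sum.cong refl) (auto simp: sym_matrix_def)
  also have "(\<Sum>i=1..n. \<Sum>j=1..n. if j < i then c j i else 0) = (\<Sum>i=1..n. \<Sum>j=1..n. if i < j then c i j else 0)"
    by (rule sum.swap)
  finally show ?thesis by (simp add: sum_upper_pairs)
qed

lemma sum_off_diagonal:
  fixes f :: "nat \<Rightarrow> nat \<Rightarrow> real"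
  shows "(\<Sum>k=1..n. \<Sum>l\<in>{1..n} - {k}. f k l) = (\<Sum>k=1..n. \<Sum>l=1..n. if k = l then 0 else f k l)"
  by (intro sum.cong refl sum.mono_neutral_cong_left) auto

lemma sum_off_diagonal_symmetric:
  fixes f :: "nat \<Rightarrow> nat \<Rightarrow> real"
  assumes sym: "\<And>k l. k \<in> {1..n} \<Longrightarrow> l \<in> {1..n} \<Longrightarrow> f k l = f l k"
  shows "(\<Sum>k=1..n. \<Sum>l\<in>{1..n} - {k}. f k l) = 2 * (\<Sum>(s, t)\<in>upper_pairs n. f s t)"
proof -
  have "(\<Sum>k=1..n. \<Sum>l\<in>{1..n} - {k}. f k l) = (\<Sum>k=1..n. \<Sum>l=1..n. sym_matrix f k l)"
    unfolding sum_off_diagonal using sym by (intro sum.cong refl) (auto simp: sym_matrix_def)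
  then show ?thesis by (simp only: total_sum_sym_matrix)
qed

lemma card_upper_pairs: "real (card (upper_pairs n)) = real n * (real n - 1) / 2"
proof -
  have "2 * real (card (upper_pairs n)) = (\<Sum>k=1..n. \<Sum>l\<in>{1..n} - {k}. 1)"
    by (subst sum_off_diagonal_symmetric) auto
  also have "\<dots> = real n * (real n - 1)"
    by (cases n) (auto simp: algebra_simps)
  finally show ?thesis by simp
qed

lemma two_v: "3 \<le> n \<Longrightarrow> 2 * real (v n) = real n * (real n - 3)"
proof -
  assume n: "3 \<le> n"
  have "even (n * (n - 3))" using n by (cases "even n") auto
  then have "2 * v n = n * (n - 3)" by (simp add: v_def)
  then have "real (2 * v n) = real (n * (n - 3))" by simp
  then show ?thesis using n by (simp add: of_nat_diff)
qed

text \<open>Only n - 1 entries of a row are off the diagonal: the row sum is subtracted n - 1 times,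
  and the column sums, which leave out column \<open>k\<close>, give it back once. With denominator
  n - 2 this removes the row sum exactly.\<close>

lemma U_centered_row_sum:
  assumes n: "3 \<le> n" and k: "k \<in> {1..n}"
    and sym: "\<And>i j. A i j = A j i" and diag: "\<And>i. A i i = 0"
  shows "(\<Sum>l=1..n. U_centered n A k l) = 0"
proof -
  define r where "r i = (\<Sum>j=1..n. A i j)" for i
  define T where "T = (\<Sum>i=1..n. r i)"
  have "(\<Sum>l=1..n. U_centered n A k l)
    = (\<Sum>l\<in>{1..n} - {k}. A k l - r k / (real n - 2) - r l / (real n - 2) + T / ((real n - 1) * (real n - 2)))"
    using k by (subst sum.remove[of _ k]) (auto simp: U_centered_def r_def T_def intro!: sum.cong intro: sym)
  \<comment> \<open>The sum is completed by the formula's value at \<open>l = k\<close>, which is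
    then taken off again; there the row and the column correction coincide, hence the factor
    2.\<close>
  also have "\<dots> = (\<Sum>l=1..n. A k l - r k / (real n - 2) - r l / (real n - 2) + T / ((real n - 1) * (real n - 2)))
     + 2 * r k / (real n - 2) - T / ((real n - 1) * (real n - 2))"
    using k diag by (subst (2) sum.remove[of _ k]) auto
  also have "\<dots> = r k - real n * (r k / (real n - 2)) - T / (real n - 2) + real n * (T / ((real n - 1) * (real n - 2)))
     + 2 * r k / (real n - 2) - T / ((real n - 1) * (real n - 2))"
    by (simp add: sum.distrib sum_subtractf sum_divide_distrib[symmetric] r_def T_def)
  also have "\<dots> = 0"
  proof -
    define y where "y = real n - 2"
    have ry: "real n = y + 2" "y \<noteq> 0" "y + 1 \<noteq> 0" using n by (auto simp: y_def)
    show ?thesis unfolding ry(1) using ry(2,3) by (simp add: divide_simps) (simp add: algebra_simps)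
  qed
  finally show ?thesis .
qed

lemma U_centered_sym:
  assumes "\<And>i j. A i j = A j i"
  shows "U_centered n A k l = U_centered n A l k"
proof -
  have "(\<Sum>i=1..n. A i j) = (\<Sum>i=1..n. A j i)" for j
    by (intro sum.cong refl assms)
  then show ?thesis by (simp add: U_centered_def assms[of k l])
qed

lemma U_centered_diag[simp]: "U_centered n A k k = 0"
  by (simp add: U_centered_def)

text \<open>The corrections of a second centering are row, column and total sums of the first, and
  these are all zero.\<close>

lemma U_centered_idem:
  assumes n: "3 \<le> n" and kl: "k \<in> {1..n}" "l \<in> {1..n}"
    and sym: "\<And>i j. A i j = A j i" and diag: "\<And>i. A i i = 0"
  shows "U_centered n (U_centered n A) k l = U_centered n A k l"
proof -
  have row: "(\<Sum>j=1..n. U_centered n A i j) = 0" if "i \<in> {1..n}" for i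
    by (rule U_centered_row_sum) (use n that sym diag in auto)
  have col: "(\<Sum>i=1..n. U_centered n A i l) = 0"
    using row[OF kl(2)] by (simp add: U_centered_sym[of A n l, OF sym])
  show ?thesis
  proof (cases "k = l")
    case True then show ?thesis by (simp add: U_centered_def)
  next
    case False
    then show ?thesis
      using row[OF kl(1)] col row by (subst U_centered_def) simp
  qed
qed

text \<open>\<open>F\<close> is the orthogonal projection with kernel \<open>p\<close>, and its
  squared norm is expanded along an orthonormal basis of its range. Evaluating this identity at the
  constant vector, which \<open>F\<close> annihilates, forces every basis vector to have sum 0; this
  is what will make the squares independent of the linear form, whose coefficients are constant on
  each block.\<close>

lemma projection_sum_of_squares:
  fixes F :: "('i \<Rightarrow> real) \<Rightarrow> 'i \<Rightarrow> real"
  assumes I: "finite I"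
    and F: "\<And>w e. e \<in> I \<Longrightarrow> F w e = (\<Sum>f\<in>I. p e f * w f)"
    and sym: "\<And>e f. e \<in> I \<Longrightarrow> f \<in> I \<Longrightarrow> p e f = p f e"
    and idem: "\<And>w e. e \<in> I \<Longrightarrow> F (F w) e = F w e"
    and trace: "(\<Sum>e\<in>I. p e e) = real r"
    and one: "\<And>e. e \<in> I \<Longrightarrow> F (\<lambda>_. 1) e = 0"
  obtains u :: "nat \<Rightarrow> 'i \<Rightarrow> real" where
    "\<And>i j. i \<in> {1..r} \<Longrightarrow> j \<in> {1..r} \<Longrightarrow> (\<Sum>e\<in>I. u i e * u j e) = (if i = j then 1 else 0)"
    "\<And>i. i \<in> {1..r} \<Longrightarrow> (\<Sum>e\<in>I. u i e) = 0"
    "\<And>w. (\<Sum>e\<in>I. (F w e)\<^sup>2) = (\<Sum>i=1..r. (\<Sum>e\<in>I. u i e * w e)\<^sup>2)"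
proof -
  have p_idem: "(\<Sum>g\<in>I. p e g * p g f) = p e f" if "e \<in> I" "f \<in> I" for e f
  proof -
    \<comment> \<open>The columns of \<open>p\<close> are the images of the unit vectors, so
      idempotence of the map \<open>F\<close> becomes idempotence of the matrix.\<close>
    have F1: "F (\<lambda>g. of_bool (g = f)) e = p e f" if "e \<in> I" for e
      using I \<open>f \<in> I\<close> that by (simp add: F)
    have "(\<Sum>g\<in>I. p e g * p g f) = F (F (\<lambda>g. of_bool (g = f))) e"
      unfolding F[OF that(1)] by (intro sum.cong refl) (simp add: F1)
    then show ?thesis using that by (simp add: idem F1)
  qed
  obtain u :: "nat \<Rightarrow> 'i \<Rightarrow> real" where
    u1: "\<And>i j. i \<in> {1..r} \<Longrightarrow> j \<in> {1..r} \<Longrightarrow> (\<Sum>e\<in>I. u i e * u j e) = (if i = j then 1 else 0)" and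
    u2: "\<And>e f. e \<in> I \<Longrightarrow> f \<in> I \<Longrightarrow> p e f = (\<Sum>i=1..r. u i e * u i f)"
    using symmetric_idempotent_decomposition[OF I sym p_idem trace] by blast
  have sq: "(\<Sum>e\<in>I. (F w e)\<^sup>2) = (\<Sum>i=1..r. (\<Sum>e\<in>I. u i e * w e)\<^sup>2)" for w
  proof -
    define \<alpha> where "\<alpha> i = (\<Sum>f\<in>I. u i f * w f)" for i
    have Fw: "F w e = (\<Sum>i=1..r. \<alpha> i * u i e)" if "e \<in> I" for e
      unfolding F[OF that] \<alpha>_def sum_distrib_right
      by (subst sum.swap) (simp add: u2[OF that] sum_distrib_left sum_distrib_right mult_ac cong: sum.cong)
    have "(\<Sum>e\<in>I. (F w e)\<^sup>2) = (\<Sum>e\<in>I. \<Sum>i=1..r. \<Sum>j=1..r. \<alpha> i * \<alpha> j * (u i e * u j e))"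
      by (simp add: Fw power2_eq_square sum_product mult_ac)
    also have "\<dots> = (\<Sum>i=1..r. \<Sum>j=1..r. \<alpha> i * \<alpha> j * (\<Sum>e\<in>I. u i e * u j e))"
      by (subst sum.swap, intro sum.cong refl, subst sum.swap) (simp add: sum_distrib_left)
    also have "\<dots> = (\<Sum>i=1..r. \<Sum>j=1..r. if i = j then \<alpha> i * \<alpha> j else 0)"
      by (intro sum.cong refl) (simp add: u1)
    also have "\<dots> = (\<Sum>i=1..r. (\<alpha> i)\<^sup>2)"
      by (simp add: power2_eq_square)
    finally show ?thesis by (simp add: \<alpha>_def)
  qed
  have "(\<Sum>i=1..r. (\<Sum>e\<in>I. u i e)\<^sup>2) = 0"
    using sq[of "\<lambda>_. 1"] one by simp
  then have zero: "(\<Sum>e\<in>I. u i e) = 0" if "i \<in> {1..r}" for i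
    using sum_nonneg_eq_0_iff[of "{1..r}" "\<lambda>i. (\<Sum>e\<in>I. u i e)\<^sup>2"] that by simp
  show thesis by (rule that[OF u1 zero sq])
qed

text \<open>Double centering is the tensor product of the centering matrices
  \<open>\<delta> n\<close> and \<open>\<delta> m\<close>, so its trace is the product of their
  traces n - 1 and m - 1. Taking the indices themselves as sample points lets \<open>K_hat\<close>
  act on an arbitrary array.\<close>

lemma K_hat_sum_of_squares:
  assumes n: "1 \<le> n" and m: "1 \<le> m"
  obtains u :: "nat \<Rightarrow> nat \<times> nat \<Rightarrow> real" where
    "\<And>i j. i \<in> {1..(n-1)*(m-1)} \<Longrightarrow> j \<in> {1..(n-1)*(m-1)} \<Longrightarrow>
      (\<Sum>e\<in>{1..n}\<times>{1..m}. u i e * u j e) = (if i = j then 1 else 0)"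
    "\<And>i. i \<in> {1..(n-1)*(m-1)} \<Longrightarrow> (\<Sum>e\<in>{1..n}\<times>{1..m}. u i e) = 0"
    "\<And>w. (\<Sum>k=1..n. \<Sum>l=1..m. (K_hat (\<lambda>i j. w (i, j)) n m (\<lambda>i. i) (\<lambda>j. j) k l)\<^sup>2)
      = (\<Sum>i=1..(n-1)*(m-1). (\<Sum>e\<in>{1..n}\<times>{1..m}. u i e * w e)\<^sup>2)"
proof -
  define \<delta> where "\<delta> N i j = of_bool (i = j) - 1 / real N" for N i j :: nat
  define p where "p e f = \<delta> n (fst e) (fst f) * \<delta> m (snd e) (snd f)" for e f
  define F where "F w e = K_hat (\<lambda>i j. w (i, j)) n m (\<lambda>i. i) (\<lambda>j. j) (fst e) (snd e)" for w e
  have \<delta>_idem: "(\<Sum>j=1..N. \<delta> N i j * \<delta> N j k) = \<delta> N i k" if "i \<in> {1..N}" "k \<in> {1..N}" for N i k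
  proof -
    have "(\<Sum>j=1..N. \<delta> N i j * \<delta> N j k) = (\<Sum>j=1..N. (if i = j then of_bool (j = k) else 0)
       - (if i = j then 1 / real N else 0) - (if j = k then 1 / real N else 0) + 1 / real N * (1 / real N))"
      by (intro sum.cong refl) (auto simp: \<delta>_def algebra_simps)
    also have "\<dots> = \<delta> N i k"
      using that by (simp add: sum.distrib sum_subtractf \<delta>_def)
    finally show ?thesis .
  qed
  have prod: "(\<Sum>e\<in>{1..n}\<times>{1..m}. f (fst e) * g (snd e)) = (\<Sum>i=1..n. f i) * (\<Sum>j=1..m. g j)" for f g :: "nat \<Rightarrow> real"
    by (simp add: sum_product sum.cartesian_product case_prod_unfold)
  have F_p: "F w e = (\<Sum>f\<in>{1..n}\<times>{1..m}. p e f * w f)" if e: "e \<in> {1..n}\<times>{1..m}" for w e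
  proof -
    obtain k l where kl: "e = (k, l)" "k \<in> {1..n}" "l \<in> {1..m}" using e by auto
    have "(\<Sum>f\<in>{1..n}\<times>{1..m}. p e f * w f) = (\<Sum>i=1..n. \<Sum>j=1..m. p e (i, j) * w (i, j))"
      by (simp add: sum.cartesian_product case_prod_unfold)
    also have "\<dots> = (\<Sum>i=1..n. \<Sum>j=1..m. (if k = i then (if l = j then w (i, j) else 0) else 0)
        - 1 / real n * (if l = j then w (i, j) else 0) - 1 / real m * (if k = i then w (i, j) else 0)
        + 1 / (real n * real m) * w (i, j))"
      by (intro sum.cong refl) (auto simp: p_def \<delta>_def kl algebra_simps)
    also have "\<dots> = (\<Sum>i=1..n. if k = i then w (i, l) else 0)
        - 1 / real n * (\<Sum>i=1..n. w (i, l)) - 1 / real m * (\<Sum>j=1..m. \<Sum>i=1..n. if k = i then w (i, j) else 0)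
        + 1 / (real n * real m) * (\<Sum>i=1..n. \<Sum>j=1..m. w (i, j))"
    proof -
      have "(\<Sum>j=1..m. if k = i then (if l = j then w (i, j) else 0) else 0) = (if k = i then w (i, l) else 0)" for i
        using kl by simp
      moreover have "(\<Sum>j=1..m. \<Sum>i=1..n. if k = i then w (i, j) else 0) = (\<Sum>i=1..n. \<Sum>j=1..m. if k = i then w (i, j) else 0)"
        by (rule sum.swap)
      ultimately show ?thesis
        using kl by (simp only: sum.distrib sum_subtractf sum_distrib_left[symmetric]) simp
    qed
    also have "\<dots> = F w e"
      using kl by (simp add: F_def K_hat_def)
    finally show ?thesis ..
  qed
  have p_sym: "p e f = p f e" for e f by (simp add: p_def \<delta>_def eq_commute)
  have idem: "F (F w) e = F w e" if e: "e \<in> {1..n}\<times>{1..m}" for w e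
  proof -
    have pp: "(\<Sum>g\<in>{1..n}\<times>{1..m}. p e g * p g f) = p e f" if f: "f \<in> {1..n}\<times>{1..m}" for f
    proof -
      have "(\<Sum>g\<in>{1..n}\<times>{1..m}. p e g * p g f)
        = (\<Sum>g\<in>{1..n}\<times>{1..m}. (\<delta> n (fst e) (fst g) * \<delta> n (fst g) (fst f)) * (\<delta> m (snd e) (snd g) * \<delta> m (snd g) (snd f)))"
        by (simp add: p_def mult_ac)
      also have "\<dots> = p e f"
        unfolding prod[of "\<lambda>i. \<delta> n (fst e) i * \<delta> n i (fst f)" "\<lambda>j. \<delta> m (snd e) j * \<delta> m j (snd f)"]
        using e f by (auto simp: \<delta>_idem p_def)
      finally show ?thesis .
    qed
    have "F (F w) e = (\<Sum>g\<in>{1..n}\<times>{1..m}. \<Sum>f\<in>{1..n}\<times>{1..m}. p e g * p g f * w f)"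
      by (simp add: F_p e sum_distrib_left mult.assoc cong: sum.cong)
    also have "\<dots> = (\<Sum>f\<in>{1..n}\<times>{1..m}. (\<Sum>g\<in>{1..n}\<times>{1..m}. p e g * p g f) * w f)"
      by (subst sum.swap) (simp add: sum_distrib_right)
    also have "\<dots> = F w e"
      by (simp add: pp F_p e cong: sum.cong)
    finally show ?thesis .
  qed
  have trace: "(\<Sum>e\<in>{1..n}\<times>{1..m}. p e e) = real ((n-1)*(m-1))"
    unfolding p_def prod using n m by (simp add: \<delta>_def of_nat_diff field_simps)
  have one: "F (\<lambda>_. 1) e = 0" for e
    using n m by (simp add: F_def K_hat_def)
  have F_sum: "(\<Sum>e\<in>{1..n}\<times>{1..m}. (F w e)\<^sup>2) = (\<Sum>k=1..n. \<Sum>l=1..m. (K_hat (\<lambda>i j. w (i, j)) n m (\<lambda>i. i) (\<lambda>j. j) k l)\<^sup>2)" for w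
    by (simp add: F_def sum.cartesian_product case_prod_unfold)
  show thesis
    by (rule projection_sum_of_squares[OF _ F_p p_sym idem trace one, unfolded F_sum]) (rule that, assumption+ | simp)+
qed

text \<open>The rank \<open>v n\<close> is the number n(n-1)/2 of pairs less the n row sums that
  U-centering sets to zero. Halving the sum over ordered pairs makes it a squared norm in the
  coordinates \<open>s < t\<close>.\<close>

lemma U_centered_sum_of_squares:
  assumes n: "3 \<le> n"
  obtains u :: "nat \<Rightarrow> nat \<times> nat \<Rightarrow> real" where
    "\<And>i j. i \<in> {1..v n} \<Longrightarrow> j \<in> {1..v n} \<Longrightarrow>
      (\<Sum>e\<in>upper_pairs n. u i e * u j e) = (if i = j then 1 else 0)"
    "\<And>i. i \<in> {1..v n} \<Longrightarrow> (\<Sum>e\<in>upper_pairs n. u i e) = 0"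
    "\<And>w. (\<Sum>k=1..n. \<Sum>l\<in>{1..n} - {k}. (U_centered n (sym_matrix (\<lambda>i j. w (i, j))) k l)\<^sup>2) / 2
      = (\<Sum>i=1..v n. (\<Sum>e\<in>upper_pairs n. u i e * w e)\<^sup>2)"
proof -
  \<comment> \<open>For pairs \<open>s < t\<close> this counts the common endpoints, so
    \<open>meet e e\<close> is 2. In \<open>p\<close> the last coefficient has numerator 2 because
    the total sum of the matrix contains every pair twice.\<close>
  define meet where "meet e f = (of_bool (fst e = fst f) + of_bool (fst e = snd f)
      + of_bool (snd e = fst f) + of_bool (snd e = snd f) :: real)" for e f :: "nat \<times> nat"
  define p where "p e f = of_bool (e = f) - meet e f / (real n - 2) + 2 / ((real n - 1) * (real n - 2))" for e f
  define F where "F w e = U_centered n (sym_matrix (\<lambda>i j. w (i, j))) (fst e) (snd e)" for w e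
  have F_p: "F w e = (\<Sum>f\<in>upper_pairs n. p e f * w f)" if e: "e \<in> upper_pairs n" for w e
  proof -
    obtain k l where kl: "e = (k, l)" "k \<in> {1..n}" "l \<in> {1..n}" "k < l"
      using e by (auto simp: upper_pairs_def)
    have row: "(\<Sum>j=1..n. sym_matrix (\<lambda>i j. w (i, j)) i j)
        = (\<Sum>f\<in>upper_pairs n. (of_bool (i = fst f) + of_bool (i = snd f)) * w f)" if "i \<in> {1..n}" for i
      by (simp only: row_sum_sym_matrix[OF that] case_prod_unfold prod.collapse)
    have col: "(\<Sum>i=1..n. sym_matrix (\<lambda>i j. w (i, j)) i l) = (\<Sum>j=1..n. sym_matrix (\<lambda>i j. w (i, j)) l j)"
      by (simp add: sym_matrix_sym[of _ l])
    have "(\<Sum>f\<in>upper_pairs n. p e f * w f)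
      = (\<Sum>f\<in>upper_pairs n. (if e = f then w f else 0)
          - 1 / (real n - 2) * ((of_bool (k = fst f) + of_bool (k = snd f)) * w f)
          - 1 / (real n - 2) * ((of_bool (l = fst f) + of_bool (l = snd f)) * w f)
          + 1 / ((real n - 1) * (real n - 2)) * (2 * w f))"
      by (intro sum.cong refl) (simp add: p_def meet_def kl algebra_simps add_divide_distrib diff_divide_distrib)
    also have "\<dots> = w e - 1 / (real n - 2) * (\<Sum>f\<in>upper_pairs n. (of_bool (k = fst f) + of_bool (k = snd f)) * w f)
       - 1 / (real n - 2) * (\<Sum>f\<in>upper_pairs n. (of_bool (l = fst f) + of_bool (l = snd f)) * w f)
       + 1 / ((real n - 1) * (real n - 2)) * (2 * (\<Sum>f\<in>upper_pairs n. w f))"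
      using e by (simp only: sum.distrib sum_subtractf sum_distrib_left[symmetric]) simp
    also have "\<dots> = F w e"
      using kl by (simp only: F_def U_centered_def col total_sum_sym_matrix case_prod_unfold prod.collapse
        row fst_conv snd_conv) (simp add: sym_matrix_def)
    finally show ?thesis ..
  qed
  have p_sym: "p e f = p f e" for e f
    by (simp add: p_def meet_def eq_commute add_ac)
  have idem: "F (F w) e = F w e" if e: "e \<in> upper_pairs n" for w e
  proof -
    \<comment> \<open>A U-centered matrix is again symmetric with zero diagonal and is therefore
      recovered from its upper entries; idempotence on vectors reduces to idempotence on
      matrices.\<close>
    have "sym_matrix (\<lambda>i j. F w (i, j)) = U_centered n (sym_matrix (\<lambda>i j. w (i, j)))"
      unfolding F_def fst_conv snd_conv
      by (rule sym_matrix_of_symmetric) (simp_all add: U_centered_sym[OF sym_matrix_sym])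
    then have "F (F w) e = U_centered n (U_centered n (sym_matrix (\<lambda>i j. w (i, j)))) (fst e) (snd e)"
      by (simp only: F_def[of "F w"])
    also have "\<dots> = F w e"
      unfolding F_def by (rule U_centered_idem[OF n]) (use e in \<open>auto simp: upper_pairs_def intro: sym_matrix_sym\<close>)
    finally show ?thesis .
  qed
  have trace: "(\<Sum>e\<in>upper_pairs n. p e e) = real (v n)"
  proof -
    define y where "y = real n - 3"
    have y: "real n = y + 3" "y + 1 \<noteq> 0" "y + 2 \<noteq> 0" using n by (auto simp: y_def)
    have "(\<Sum>e\<in>upper_pairs n. p e e) = (\<Sum>e\<in>upper_pairs n. 1 - 2 / (real n - 2) + 2 / ((real n - 1) * (real n - 2)))"
      by (intro sum.cong refl) (auto simp: p_def meet_def upper_pairs_def)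
    also have "\<dots> = real n * (real n - 1) / 2 * (1 - 2 / (real n - 2) + 2 / ((real n - 1) * (real n - 2)))"
      by (simp add: card_upper_pairs)
    also have "\<dots> = real n * (real n - 3) / 2"
      unfolding y(1) using y(2,3) by (simp add: divide_simps) (simp add: algebra_simps)
    finally show ?thesis using two_v[OF n] by simp
  qed
  have one: "F (\<lambda>_. 1) e = 0" if e: "e \<in> upper_pairs n" for e
  proof -
    obtain k l where kl: "e = (k, l)" "k \<in> {1..n}" "l \<in> {1..n}" "k < l"
      using e by (auto simp: upper_pairs_def)
    have row: "(\<Sum>j=1..n. sym_matrix (\<lambda>i j. 1) i j) = real n - 1" if "i \<in> {1..n}" for i
    proof -
      have "(\<Sum>j=1..n. sym_matrix (\<lambda>i j. 1) i j) = (\<Sum>j\<in>{1..n} - {i}. 1)"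
        by (rule sum.mono_neutral_cong_right) (auto simp: sym_matrix_def)
      then show ?thesis using that by (simp add: of_nat_diff)
    qed
    have col: "(\<Sum>i=1..n. sym_matrix (\<lambda>i j. 1) i l) = real n - 1"
      using row[OF kl(3)] by (simp add: sym_matrix_sym[of _ l])
    have tot: "(\<Sum>i=1..n. \<Sum>j=1..n. sym_matrix (\<lambda>i j. 1) i j) = real n * (real n - 1)"
      using row by simp
    define y where "y = real n - 3"
    have y: "real n = y + 3" "y + 1 \<noteq> 0" "y + 2 \<noteq> 0" using n by (auto simp: y_def)
    show ?thesis
      using kl(4) unfolding F_def U_centered_def kl(1) fst_conv snd_conv row[OF kl(2)] col tot
      unfolding y(1) using y(2,3) by (simp add: sym_matrix_def divide_simps)
  qed
  have F_sum: "(\<Sum>e\<in>upper_pairs n. (F w e)\<^sup>2)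
     = (\<Sum>k=1..n. \<Sum>l\<in>{1..n} - {k}. (U_centered n (sym_matrix (\<lambda>i j. w (i, j))) k l)\<^sup>2) / 2" for w
  proof -
    have "(U_centered n (sym_matrix c) k l)\<^sup>2 = (U_centered n (sym_matrix c) l k)\<^sup>2" for c k l
      by (subst U_centered_sym[OF sym_matrix_sym]) (rule refl)
    then show ?thesis
      by (subst sum_off_diagonal_symmetric) (simp_all add: F_def case_prod_unfold)
  qed
  show thesis
    by (rule projection_sum_of_squares[OF _ F_p p_sym idem trace one, unfolded F_sum]) (rule that, assumption+ | simp)+
qed

section \<open>The statistics as functions of the entries\<close>

text \<open>The entries \<open>w\<close> stand for \<open>2 K\<close>, up to functions of a single observation; this absorbs the factors 2 and 4
  of the energy statistic and of \<open>S\<close>.\<close>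

definition by_block :: "real \<Rightarrow> real \<Rightarrow> real \<Rightarrow> entry \<Rightarrow> real" where
  "by_block a b c e = (case e of XY _ _ \<Rightarrow> a | XX _ _ \<Rightarrow> b | YY _ _ \<Rightarrow> c)"

text \<open>The coefficient of a pair \<open>s < t\<close> carries no factor 2, because the two
  occurrences of the pair in the energy statistic are already contained in \<open>w\<close>.\<close>

definition lin_stat :: "nat \<Rightarrow> nat \<Rightarrow> (entry \<Rightarrow> real) \<Rightarrow> real" where
  "lin_stat n m w = (\<Sum>e\<in>entries n m.
     by_block (1 / (real n * real m)) (- 1 / (real n * (real n - 1))) (- 1 / (real m * (real m - 1))) e * w e)"

text \<open>The numerator adds the squared norms of the images under three orthogonal projections,
  and the divisor is the sum of their ranks.\<close>

definition quad_stat :: "nat \<Rightarrow> nat \<Rightarrow> (entry \<Rightarrow> real) \<Rightarrow> real" where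
  "quad_stat n m w =
     ((\<Sum>k=1..n. \<Sum>l=1..m. (K_hat (\<lambda>i j. w (XY i j)) n m (\<lambda>i. i) (\<lambda>j. j) k l)\<^sup>2)
      + (\<Sum>k=1..n. \<Sum>l\<in>{1..n} - {k}. (U_centered n (sym_matrix (\<lambda>i j. w (XX i j))) k l)\<^sup>2) / 2
      + (\<Sum>k=1..m. \<Sum>l\<in>{1..m} - {k}. (U_centered m (sym_matrix (\<lambda>i j. w (YY i j))) k l)\<^sup>2) / 2)
     / real ((n - 1) * (m - 1) + v n + v m)"

lemma entries_eq:
  "entries n m = (\<lambda>e. XY (fst e) (snd e)) ` ({1..n} \<times> {1..m})
     \<union> (\<lambda>e. XX (fst e) (snd e)) ` upper_pairs n \<union> (\<lambda>e. YY (fst e) (snd e)) ` upper_pairs m"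
  by (force simp: entries_def upper_pairs_def image_iff)

lemma finite_entries[simp]: "finite (entries n m)"
  by (simp add: entries_eq)

lemma sum_entries:
  "(\<Sum>e\<in>entries n m. f e) = (\<Sum>e\<in>{1..n} \<times> {1..m}. f (XY (fst e) (snd e)))
     + (\<Sum>e\<in>upper_pairs n. f (XX (fst e) (snd e))) + (\<Sum>e\<in>upper_pairs m. f (YY (fst e) (snd e)))"
proof -
  have inj: "inj_on (\<lambda>e. XY (fst e) (snd e)) A" "inj_on (\<lambda>e. XX (fst e) (snd e)) A" "inj_on (\<lambda>e. YY (fst e) (snd e)) A" for A
    by (auto simp: inj_on_def prod_eq_iff)
  show ?thesis
    unfolding entries_eq
    by (subst sum.union_disjoint; (subst sum.union_disjoint)?)
       (auto simp: sum.reindex[OF inj(1)] sum.reindex[OF inj(2)] sum.reindex[OF inj(3)])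
qed

text \<open>The first component is the block: 1 for \<open>XY\<close>, 2 for \<open>XX\<close>, 3 for \<open>YY\<close>. Index \<open>(0, 1)\<close> is kept for the
  direction of the linear form.\<close>

definition basis_index :: "nat \<Rightarrow> nat \<Rightarrow> (nat \<times> nat) set" where
  "basis_index n m = {1} \<times> {1..(n - 1) * (m - 1)} \<union> {2} \<times> {1..v n} \<union> {3} \<times> {1..v m}"

text \<open>That a basis vector is supported in one block is expressed by making it an eigenvector
  of every \<open>by_block\<close> multiplier. In this form it is applied when the entries are
  scaled by their standard deviations.\<close>

definition centering_basis :: "nat \<Rightarrow> nat \<Rightarrow> (nat \<times> nat \<Rightarrow> entry \<Rightarrow> real) \<Rightarrow> bool" where
  "centering_basis n m U \<longleftrightarrow>
     (\<forall>i\<in>basis_index n m. \<forall>j\<in>basis_index n m. (\<Sum>e\<in>entries n m. U i e * U j e) = (if i = j then 1 else 0)) \<and>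
     (\<forall>j\<in>basis_index n m. \<forall>a b c. (\<Sum>e\<in>entries n m. U j e * by_block a b c e) = 0) \<and>
     (\<forall>i a b c e. U (1, i) e * by_block a b c e = a * U (1, i) e) \<and>
     (\<forall>i a b c e. U (2, i) e * by_block a b c e = b * U (2, i) e) \<and>
     (\<forall>i a b c e. U (3, i) e * by_block a b c e = c * U (3, i) e) \<and>
     (\<forall>w. quad_stat n m w = ((\<Sum>i=1..(n - 1) * (m - 1). (\<Sum>e\<in>entries n m. U (1, i) e * w e)\<^sup>2)
       + (\<Sum>i=1..v n. (\<Sum>e\<in>entries n m. U (2, i) e * w e)\<^sup>2)
       + (\<Sum>i=1..v m. (\<Sum>e\<in>entries n m. U (3, i) e * w e)\<^sup>2)) / real ((n - 1) * (m - 1) + v n + v m))"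

lemma centering_basis_exists:
  assumes n: "4 \<le> n" and m: "4 \<le> m"
  shows "\<exists>U. centering_basis n m U"
proof -
  define r1 r2 r3 where r: "r1 = (n - 1) * (m - 1)" "r2 = v n" "r3 = v m"
  obtain u1 :: "nat \<Rightarrow> nat \<times> nat \<Rightarrow> real" where u1:
    "\<And>i j. i \<in> {1..r1} \<Longrightarrow> j \<in> {1..r1} \<Longrightarrow> (\<Sum>e\<in>{1..n}\<times>{1..m}. u1 i e * u1 j e) = (if i = j then 1 else 0)"
    "\<And>i. i \<in> {1..r1} \<Longrightarrow> (\<Sum>e\<in>{1..n}\<times>{1..m}. u1 i e) = 0"
    "\<And>w. (\<Sum>k=1..n. \<Sum>l=1..m. (K_hat (\<lambda>i j. w (i, j)) n m (\<lambda>i. i) (\<lambda>j. j) k l)\<^sup>2)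
      = (\<Sum>i=1..r1. (\<Sum>e\<in>{1..n}\<times>{1..m}. u1 i e * w e)\<^sup>2)"
    unfolding r by (rule K_hat_sum_of_squares[of n m]) (use n m in auto)
  obtain u2 :: "nat \<Rightarrow> nat \<times> nat \<Rightarrow> real" where u2:
    "\<And>i j. i \<in> {1..r2} \<Longrightarrow> j \<in> {1..r2} \<Longrightarrow> (\<Sum>e\<in>upper_pairs n. u2 i e * u2 j e) = (if i = j then 1 else 0)"
    "\<And>i. i \<in> {1..r2} \<Longrightarrow> (\<Sum>e\<in>upper_pairs n. u2 i e) = 0"
    "\<And>w. (\<Sum>k=1..n. \<Sum>l\<in>{1..n} - {k}. (U_centered n (sym_matrix (\<lambda>i j. w (i, j))) k l)\<^sup>2) / 2
      = (\<Sum>i=1..r2. (\<Sum>e\<in>upper_pairs n. u2 i e * w e)\<^sup>2)"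
    unfolding r by (rule U_centered_sum_of_squares[of n]) (use n in auto)
  obtain u3 :: "nat \<Rightarrow> nat \<times> nat \<Rightarrow> real" where u3:
    "\<And>i j. i \<in> {1..r3} \<Longrightarrow> j \<in> {1..r3} \<Longrightarrow> (\<Sum>e\<in>upper_pairs m. u3 i e * u3 j e) = (if i = j then 1 else 0)"
    "\<And>i. i \<in> {1..r3} \<Longrightarrow> (\<Sum>e\<in>upper_pairs m. u3 i e) = 0"
    "\<And>w. (\<Sum>k=1..m. \<Sum>l\<in>{1..m} - {k}. (U_centered m (sym_matrix (\<lambda>i j. w (i, j))) k l)\<^sup>2) / 2
      = (\<Sum>i=1..r3. (\<Sum>e\<in>upper_pairs m. u3 i e * w e)\<^sup>2)"
    unfolding r by (rule U_centered_sum_of_squares[of m]) (use m in auto)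
  define U where "U j e = (case e of
      XY k l \<Rightarrow> if fst j = 1 then u1 (snd j) (k, l) else 0
    | XX k l \<Rightarrow> if fst j = 2 then u2 (snd j) (k, l) else 0
    | YY k l \<Rightarrow> if fst j = 3 then u3 (snd j) (k, l) else 0)" for j :: "nat \<times> nat" and e
  have "centering_basis n m U"
    unfolding centering_basis_def
  proof (intro conjI ballI allI)
    fix i j assume "i \<in> basis_index n m" "j \<in> basis_index n m"
    then show "(\<Sum>e\<in>entries n m. U i e * U j e) = (if i = j then 1 else 0)"
      unfolding sum_entries basis_index_def r[symmetric]
      by (auto simp: U_def u1(1) u2(1) u3(1) split: if_splits)
  next
    fix j a b c assume "j \<in> basis_index n m"
    then show "(\<Sum>e\<in>entries n m. U j e * by_block a b c e) = 0"
      unfolding sum_entries basis_index_def r[symmetric]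
      by (auto simp: U_def by_block_def u1(2) u2(2) u3(2) sum_distrib_right[symmetric])
  next
    fix w
    show "quad_stat n m w = ((\<Sum>i=1..(n - 1) * (m - 1). (\<Sum>e\<in>entries n m. U (1, i) e * w e)\<^sup>2)
       + (\<Sum>i=1..v n. (\<Sum>e\<in>entries n m. U (2, i) e * w e)\<^sup>2)
       + (\<Sum>i=1..v m. (\<Sum>e\<in>entries n m. U (3, i) e * w e)\<^sup>2)) / real ((n - 1) * (m - 1) + v n + v m)"
      unfolding quad_stat_def sum_entries r[symmetric]
      using u1(3)[of "\<lambda>e. w (XY (fst e) (snd e))"] u2(3)[of "\<lambda>e. w (XX (fst e) (snd e))"] u3(3)[of "\<lambda>e. w (YY (fst e) (snd e))"]
      by (simp add: U_def)
  qed (auto simp: U_def by_block_def split: entry.split)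
  then show ?thesis by blast
qed

lemma lin_stat_measurable[measurable]: "lin_stat n m \<in> borel_measurable (PiM (entries n m) (\<lambda>_. borel))"
  unfolding lin_stat_def[abs_def] by (intro borel_measurable_sum borel_measurable_times) auto

lemma lin_stat_continuous: "continuous_on (\<Pi>\<^sub>E e\<in>entries n m. UNIV) (lin_stat n m)"
  unfolding lin_stat_def[abs_def]
  by (intro continuous_intros continuous_on_subset[OF continuous_on_product_coordinates]) auto

text \<open>The representation as a sum of squares shows \<open>quad_stat\<close> to be a polynomial
  in the entries, so no centering has to be unfolded.\<close>

lemma quad_stat_regular:
  assumes n: "4 \<le> n" and m: "4 \<le> m"
  shows quad_stat_measurable: "quad_stat n m \<in> borel_measurable (PiM (entries n m) (\<lambda>_. borel))"
    and quad_stat_continuous: "continuous_on (\<Pi>\<^sub>E e\<in>entries n m. UNIV) (quad_stat n m)"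
proof -
  obtain U where "centering_basis n m U" using centering_basis_exists[OF n m] ..
  then have U: "quad_stat n m = (\<lambda>w. ((\<Sum>i=1..(n-1)*(m-1). (\<Sum>e\<in>entries n m. U (1, i) e * w e)\<^sup>2)
       + (\<Sum>i=1..v n. (\<Sum>e\<in>entries n m. U (2, i) e * w e)\<^sup>2)
       + (\<Sum>i=1..v m. (\<Sum>e\<in>entries n m. U (3, i) e * w e)\<^sup>2)) / real ((n-1)*(m-1) + v n + v m))"
    by (auto simp: centering_basis_def)
  have [measurable]: "(\<lambda>w. \<Sum>e\<in>entries n m. U j e * w e) \<in> borel_measurable (PiM (entries n m) (\<lambda>_. borel))" for j
    by (intro borel_measurable_sum borel_measurable_times) auto
  show "quad_stat n m \<in> borel_measurable (PiM (entries n m) (\<lambda>_. borel))"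
    unfolding U by measurable
  show "continuous_on (\<Pi>\<^sub>E e\<in>entries n m. UNIV) (quad_stat n m)"
    unfolding U divide_inverse
    by (intro continuous_intros continuous_on_subset[OF continuous_on_product_coordinates]) auto
qed

text \<open>A global Lipschitz bound carries remainders that vanish in probability through the
  statistics without any tightness argument. It is available for the root of
  \<open>quad_stat\<close>, which is a Euclidean norm of linear forms, but not for the quadratic
  form itself.\<close>

lemma stat_lipschitz:
  assumes n: "4 \<le> n" and m: "4 \<le> m"
  obtains C where "C \<ge> 0" "\<And>w w' \<epsilon>. (\<And>e. e \<in> entries n m \<Longrightarrow> \<bar>w e - w' e\<bar> \<le> \<epsilon>) \<Longrightarrow>
      \<bar>lin_stat n m w - lin_stat n m w'\<bar> \<le> C * \<epsilon> \<and> \<bar>sqrt (quad_stat n m w) - sqrt (quad_stat n m w')\<bar> \<le> C * \<epsilon>"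
proof -
  let ?J = "basis_index n m"
  define D where "D = real ((n-1)*(m-1) + v n + v m)"
  obtain U where "centering_basis n m U" using centering_basis_exists[OF n m] ..
  then have U: "quad_stat n m w = ((\<Sum>i=1..(n-1)*(m-1). (\<Sum>e\<in>entries n m. U (1, i) e * w e)\<^sup>2)
       + (\<Sum>i=1..v n. (\<Sum>e\<in>entries n m. U (2, i) e * w e)\<^sup>2)
       + (\<Sum>i=1..v m. (\<Sum>e\<in>entries n m. U (3, i) e * w e)\<^sup>2)) / D" for w
    by (auto simp: centering_basis_def D_def)
  define \<Lambda> where "\<Lambda> w j = (\<Sum>e\<in>entries n m. U j e * w e)" for w j
  have block: "(\<Sum>j\<in>{b} \<times> {1..r}. f j) = (\<Sum>i=1..r. f (b, i))" for f :: "nat \<times> nat \<Rightarrow> real" and b r :: nat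
  proof -
    have "(\<Sum>j\<in>{b} \<times> {1..r}. f j) = (\<Sum>x\<in>{b}. \<Sum>i\<in>{1..r}. f (x, i))"
      by (simp only: sum.cartesian_product) (simp add: case_prod_unfold)
    then show ?thesis by simp
  qed
  have sumJ: "(\<Sum>j\<in>?J. f j) = (\<Sum>i=1..(n-1)*(m-1). f (1, i)) + (\<Sum>i=1..v n. f (2, i)) + (\<Sum>i=1..v m. f (3, i))"
    for f :: "nat \<times> nat \<Rightarrow> real"
    unfolding basis_index_def
    by (subst sum.union_disjoint; (subst sum.union_disjoint)?) (auto simp: block)
  have sqrt_quad: "sqrt (quad_stat n m w) = L2_set (\<Lambda> w) ?J / sqrt D" for w
    unfolding U L2_set_def sumJ \<Lambda>_def real_sqrt_divide ..
  define B where "B = by_block (1 / (real n * real m)) (- 1 / (real n * (real n - 1))) (- 1 / (real m * (real m - 1)))"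
  define C where "C = max (\<Sum>e\<in>entries n m. \<bar>B e\<bar>) ((\<Sum>j\<in>?J. \<Sum>e\<in>entries n m. \<bar>U j e\<bar>) / sqrt D)"
  have D: "D \<ge> 0" by (simp add: D_def)
  have lin: "\<bar>\<Sum>e\<in>entries n m. c e * d e\<bar> \<le> (\<Sum>e\<in>entries n m. \<bar>c e\<bar>) * \<epsilon>"
    if "\<And>e. e \<in> entries n m \<Longrightarrow> \<bar>d e\<bar> \<le> \<epsilon>" for c d :: "entry \<Rightarrow> real" and \<epsilon>
    unfolding sum_distrib_right
    by (rule order_trans[OF sum_abs sum_mono]) (auto simp: abs_mult intro: mult_left_mono that)
  have tri: "L2_set (\<Lambda> w) ?J \<le> L2_set (\<Lambda> w') ?J + (\<Sum>j\<in>?J. \<Sum>e\<in>entries n m. \<bar>U j e\<bar>) * \<epsilon>"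
    if "\<And>e. e \<in> entries n m \<Longrightarrow> \<bar>w e - w' e\<bar> \<le> \<epsilon>" for w w' \<epsilon>
  proof -
    have "\<Lambda> w j = \<Lambda> w' j + \<Lambda> (\<lambda>e. w e - w' e) j" for j
      by (simp add: \<Lambda>_def sum.distrib[symmetric] algebra_simps)
    then have "\<Lambda> w = (\<lambda>j. \<Lambda> w' j + \<Lambda> (\<lambda>e. w e - w' e) j)" by blast
    then have "L2_set (\<Lambda> w) ?J \<le> L2_set (\<Lambda> w') ?J + L2_set (\<Lambda> (\<lambda>e. w e - w' e)) ?J"
      using L2_set_triangle_ineq[of "\<Lambda> w'" "\<Lambda> (\<lambda>e. w e - w' e)" ?J] by simp
    also have "L2_set (\<Lambda> (\<lambda>e. w e - w' e)) ?J \<le> (\<Sum>j\<in>?J. \<bar>\<Lambda> (\<lambda>e. w e - w' e) j\<bar>)"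
      by (rule L2_set_le_sum_abs)
    also have "\<dots> \<le> (\<Sum>j\<in>?J. (\<Sum>e\<in>entries n m. \<bar>U j e\<bar>) * \<epsilon>)"
      unfolding \<Lambda>_def by (intro sum_mono lin that)
    finally show ?thesis by (simp only: sum_distrib_right)
  qed
  show thesis
  proof (rule that[of C])
    show "C \<ge> 0" unfolding C_def by (rule max.coboundedI1) (auto intro: sum_nonneg)
    fix w w' :: "entry \<Rightarrow> real" and \<epsilon> :: real
    assume close: "\<And>e. e \<in> entries n m \<Longrightarrow> \<bar>w e - w' e\<bar> \<le> \<epsilon>"
    \<comment> \<open>There is at least one entry, so the assumed closeness already forces
      \<open>\<epsilon>\<close> to be nonnegative.\<close>
    have \<epsilon>: "\<epsilon> \<ge> 0"
    proof -
      have "XY 1 1 \<in> entries n m" using n m by (simp add: entries_def)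
      then show ?thesis using close[of "XY 1 1"] by simp
    qed
    have "lin_stat n m w - lin_stat n m w' = (\<Sum>e\<in>entries n m. B e * (w e - w' e))"
      by (simp add: lin_stat_def B_def sum_subtractf[symmetric] algebra_simps)
    then have "\<bar>lin_stat n m w - lin_stat n m w'\<bar> \<le> (\<Sum>e\<in>entries n m. \<bar>B e\<bar>) * \<epsilon>"
      using lin[OF close] by simp
    also have "\<dots> \<le> C * \<epsilon>" by (rule mult_right_mono) (auto simp: C_def \<epsilon>)
    finally have l: "\<bar>lin_stat n m w - lin_stat n m w'\<bar> \<le> C * \<epsilon>" .
    have swapped: "\<And>e. e \<in> entries n m \<Longrightarrow> \<bar>w' e - w e\<bar> \<le> \<epsilon>" using close by (simp add: abs_minus_commute)
    have "\<bar>L2_set (\<Lambda> w) ?J - L2_set (\<Lambda> w') ?J\<bar> \<le> (\<Sum>j\<in>?J. \<Sum>e\<in>entries n m. \<bar>U j e\<bar>) * \<epsilon>"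
      using tri[of w w' \<epsilon>, OF close] tri[of w' w \<epsilon>, OF swapped] by linarith
    then have "\<bar>sqrt (quad_stat n m w) - sqrt (quad_stat n m w')\<bar> \<le> (\<Sum>j\<in>?J. \<Sum>e\<in>entries n m. \<bar>U j e\<bar>) * \<epsilon> / sqrt D"
      unfolding sqrt_quad diff_divide_distrib[symmetric] abs_divide using D by (simp add: divide_right_mono)
    also have "\<dots> \<le> C * \<epsilon>"
      unfolding times_divide_eq_left[symmetric] by (rule mult_right_mono) (auto simp: C_def \<epsilon>)
    finally show "\<bar>lin_stat n m w - lin_stat n m w'\<bar> \<le> C * \<epsilon> \<and> \<bar>sqrt (quad_stat n m w) - sqrt (quad_stat n m w')\<bar> \<le> C * \<epsilon>"
      using l by simp
  qed
qed

section \<open>Joint law of the linear and the quadratic form in the Gaussian limit\<close>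

lemma sets_normal_law[simp, measurable_cong]: "sets (normal_law \<mu> s) = sets borel"
  by (simp add: normal_law_def)

lemma prob_space_normal_law: "prob_space (normal_law \<mu> s)"
  unfolding normal_law_def by (intro prob_space.prob_space_distr prob_space_std_normal) auto

lemma prob_space_chi_square: "prob_space (chi_square k)"
  unfolding chi_square_def by (intro prob_space.prob_space_distr prob_space_PiM prob_space_normal_law) auto

lemma sets_M_law[simp, measurable_cong]: "sets (M_law n m a b c) = sets borel"
  by (simp add: M_law_def)

lemma prob_space_chi3: "prob_space (chi_square r1 \<Otimes>\<^sub>M chi_square r2 \<Otimes>\<^sub>M chi_square r3)"
  by (intro prob_space_pair prob_space_chi_square)

lemma prob_space_M_law: "prob_space (M_law n m a b c)"
  unfolding M_law_def by (intro prob_space.prob_space_distr prob_space_chi3) measurable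

text \<open>Represents the limit as the image of a standard Gaussian product, to which the
  orthonormality results apply. A block of variance 0 is covered by the scale factor 0.\<close>

lemma entries_limit_eq_distr:
  assumes nonempty: "entries n m \<noteq> {}" and "0 \<le> \<sigma>2" "0 \<le> \<sigma>X2" "0 \<le> \<sigma>Y2"
  shows "entries_limit n m \<sigma>2 \<sigma>X2 \<sigma>Y2
    = distr (PiM (entries n m) (\<lambda>_. std_normal_distribution)) (PiM (entries n m) (\<lambda>_. borel))
        (\<lambda>z. \<lambda>e\<in>entries n m. by_block (sqrt \<sigma>2) (sqrt \<sigma>X2) (sqrt \<sigma>Y2) e * z e)"
proof -
  let ?G = "PiM (entries n m) (\<lambda>_. std_normal_distribution)"
  let ?s = "by_block (sqrt \<sigma>2) (sqrt \<sigma>X2) (sqrt \<sigma>Y2)"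
  interpret prob_space ?G by (intro prob_space_PiM prob_space_std_normal)
  have comp: "random_variable borel (\<lambda>z. z e)" if "e \<in> entries n m" for e
    using measurable_component_singleton[OF that, of "\<lambda>_. std_normal_distribution"]
    by (simp cong: measurable_cong_sets)
  have indep: "indep_vars (\<lambda>_. borel) (\<lambda>e z. ?s e * z e) (entries n m)"
    by (rule indep_vars_compose2[OF indep_vars_PiM_components]) (auto intro: prob_space_std_normal)
  have law: "distr ?G borel (\<lambda>z. ?s e * z e) = normal_law 0 (case e of XY _ _ \<Rightarrow> \<sigma>2 | XX _ _ \<Rightarrow> \<sigma>X2 | YY _ _ \<Rightarrow> \<sigma>Y2)"
    if e: "e \<in> entries n m" for e
  proof -
    have "distr ?G borel (\<lambda>z. ?s e * z e) = distr (distr ?G borel (\<lambda>z. z e)) borel (\<lambda>x. ?s e * x)"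
      using comp[OF e] by (simp add: distr_distr comp_def)
    then show ?thesis
      using distr_PiM_std_normal_component[OF e] by (simp add: normal_law_def by_block_def split: entry.split)
  qed
  have "distr ?G (PiM (entries n m) (\<lambda>_. borel)) (\<lambda>z. \<lambda>e\<in>entries n m. ?s e * z e)
    = PiM (entries n m) (\<lambda>e. distr ?G borel (\<lambda>z. ?s e * z e))"
    using indep comp by (subst (asm) indep_vars_iff_distr_eq_PiM'[OF nonempty]) auto
  also have "\<dots> = entries_limit n m \<sigma>2 \<sigma>X2 \<sigma>Y2"
    unfolding entries_limit_def by (intro PiM_cong refl law)
  finally show ?thesis ..
qed

lemma sigma_nm_pos:
  assumes n: "4 \<le> n" and m: "4 \<le> m"
    and nonneg: "0 \<le> \<sigma>2" "0 \<le> \<sigma>X2" "0 \<le> \<sigma>Y2" and nondeg: "\<sigma>2 \<noteq> 0 \<or> \<sigma>X2 \<noteq> 0 \<or> \<sigma>Y2 \<noteq> 0"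
  shows "0 < sigma_nm n m \<sigma>2 \<sigma>X2 \<sigma>Y2"
proof -
  have "0 < \<sigma>2 / (real n * real m) + \<sigma>X2 / (2 * real n * (real n - 1)) + \<sigma>Y2 / (2 * real m * (real m - 1))"
  proof -
    have "0 \<le> \<sigma>2 / (real n * real m)" "0 \<le> \<sigma>X2 / (2 * real n * (real n - 1))" "0 \<le> \<sigma>Y2 / (2 * real m * (real m - 1))"
      using n m nonneg by auto
    moreover have "0 < \<sigma>2 / (real n * real m) \<or> 0 < \<sigma>X2 / (2 * real n * (real n - 1)) \<or> 0 < \<sigma>Y2 / (2 * real m * (real m - 1))"
      using nondeg nonneg n m by (auto simp: less_le)
    ultimately show ?thesis by linarith
  qed
  then show ?thesis unfolding sigma_nm_def by simp
qed

text \<open>After scaling the entries by their standard deviations the linear form still has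
  coefficients that are constant on each block. It is thus orthogonal to all vectors of the
  centering basis, and together with its normalisation, at index \<open>(0, 1)\<close>, they form
  one orthonormal system.\<close>

lemma limit_statistics_law:
  assumes n: "4 \<le> n" and m: "4 \<le> m"
    and nonneg: "0 \<le> \<sigma>2" "0 \<le> \<sigma>X2" "0 \<le> \<sigma>Y2" and nondeg: "\<sigma>2 \<noteq> 0 \<or> \<sigma>X2 \<noteq> 0 \<or> \<sigma>Y2 \<noteq> 0"
  defines "\<mu> \<equiv> entries_limit n m \<sigma>2 \<sigma>X2 \<sigma>Y2"
    and "\<sigma> \<equiv> sigma_nm n m \<sigma>2 \<sigma>X2 \<sigma>Y2"
    and "D \<equiv> (n - 1) * (m - 1) + v n + v m"
  shows "distr \<mu> (borel \<Otimes>\<^sub>M borel) (\<lambda>w. (lin_stat n m w, quad_stat n m w))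
       = distr (normal_law 0 1 \<Otimes>\<^sub>M M_law n m \<sigma>2 \<sigma>X2 \<sigma>Y2) (borel \<Otimes>\<^sub>M borel) (\<lambda>(z, q). (\<sigma> * z, q))"
    and "\<sigma>X2 = \<sigma>2 \<Longrightarrow> \<sigma>Y2 = \<sigma>2 \<Longrightarrow>
       distr \<mu> (borel \<Otimes>\<^sub>M borel) (\<lambda>w. (lin_stat n m w, quad_stat n m w))
       = distr (normal_law 0 1 \<Otimes>\<^sub>M chi_square D) (borel \<Otimes>\<^sub>M borel) (\<lambda>(z, q). (\<sigma> * z, \<sigma>2 * (q / real D)))"
    and "AE w in \<mu>. 0 < quad_stat n m w"
proof -
  let ?I = "entries n m"
  define G where "G = PiM ?I (\<lambda>_. std_normal_distribution)"
  have nonempty: "?I \<noteq> {}"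
  proof -
    have "XY 1 1 \<in> ?I" using n m by (simp add: entries_def)
    then show ?thesis by blast
  qed
  interpret G: prob_space G unfolding G_def by (intro prob_space_PiM prob_space_std_normal)
  define r1 r2 r3 where r: "r1 = (n - 1) * (m - 1)" "r2 = v n" "r3 = v m"
  define J where "J = basis_index n m"
  have J: "J = {1} \<times> {1..r1} \<union> {2} \<times> {1..r2} \<union> {3} \<times> {1..r3}"
    by (simp add: J_def basis_index_def r)
  obtain U where U: "centering_basis n m U" using centering_basis_exists[OF n m] ..
  note U = U[unfolded centering_basis_def, folded J_def r]
  have U_ortho: "\<And>i j. i \<in> J \<Longrightarrow> j \<in> J \<Longrightarrow> (\<Sum>e\<in>entries n m. U i e * U j e) = (if i = j then 1 else 0)"
    using conjunct1[OF U] by simp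
  have U_zero: "\<And>j a b c. j \<in> J \<Longrightarrow> (\<Sum>e\<in>entries n m. U j e * by_block a b c e) = 0"
    using U by blast
  have U_block: "\<And>i a b c e. U (1, i) e * by_block a b c e = a * U (1, i) e"
    "\<And>i a b c e. U (2, i) e * by_block a b c e = b * U (2, i) e"
    "\<And>i a b c e. U (3, i) e * by_block a b c e = c * U (3, i) e"
    using U by simp_all
  have U_quad: "\<And>w. quad_stat n m w = ((\<Sum>i=1..r1. (\<Sum>e\<in>entries n m. U (1, i) e * w e)\<^sup>2)
       + (\<Sum>i=1..r2. (\<Sum>e\<in>entries n m. U (2, i) e * w e)\<^sup>2)
       + (\<Sum>i=1..r3. (\<Sum>e\<in>entries n m. U (3, i) e * w e)\<^sup>2)) / real (r1 + r2 + r3)"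
    using U by blast
  have \<sigma>_pos: "0 < \<sigma>" unfolding \<sigma>_def by (rule sigma_nm_pos) fact+
  define s where "s = by_block (sqrt \<sigma>2) (sqrt \<sigma>X2) (sqrt \<sigma>Y2)"
  define b1 b2 b3 where b: "b1 = 1 / (real n * real m)" "b2 = - 1 / (real n * (real n - 1))" "b3 = - 1 / (real m * (real m - 1))"
  \<comment> \<open>These are the coefficients of the linear form times the block standard
    deviations. The norm of that vector is exactly \<open>\<sigma>\<close>, which is where the
    weights in \<open>sigma_nm\<close> come from.\<close>
  define W where "W j = (if j = (0, 1) then by_block (b1 * sqrt \<sigma>2 / \<sigma>) (b2 * sqrt \<sigma>X2 / \<sigma>) (b3 * sqrt \<sigma>Y2 / \<sigma>) else U j)" for j
  define X where "X j z = (\<Sum>e\<in>?I. W j e * z e)" for j z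
  let ?J = "{(0, 1)} \<union> {1} \<times> {1..r1} \<union> {2} \<times> {1..r2} \<union> ({3} \<times> {1..r3} :: (nat \<times> nat) set)"
  have WJ: "W j = U j" if "j \<in> J" for j using that by (auto simp: W_def J)
  have W_norm: "(\<Sum>e\<in>?I. W (0, 1) e * W (0, 1) e) = 1"
  proof -
    have \<sigma>_sq: "\<sigma>\<^sup>2 = \<sigma>2 / (real n * real m) + \<sigma>X2 / (2 * real n * (real n - 1)) + \<sigma>Y2 / (2 * real m * (real m - 1))"
      using \<sigma>_pos unfolding \<sigma>_def sigma_nm_def by simp
    have "(\<Sum>e\<in>?I. W (0, 1) e * W (0, 1) e) = (real n * real m * (b1\<^sup>2 * \<sigma>2) + real n * (real n - 1) / 2 * (b2\<^sup>2 * \<sigma>X2)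
       + real m * (real m - 1) / 2 * (b3\<^sup>2 * \<sigma>Y2)) / \<sigma>\<^sup>2"
      unfolding sum_entries
      by (simp add: W_def by_block_def card_upper_pairs card_cartesian_product power2_eq_square nonneg add_divide_distrib mult_ac)
    also have "real n * real m * (b1\<^sup>2 * \<sigma>2) = \<sigma>2 / (real n * real m)"
      using n m by (simp add: b power2_eq_square field_simps)
    also have "real n * (real n - 1) / 2 * (b2\<^sup>2 * \<sigma>X2) = \<sigma>X2 / (2 * real n * (real n - 1))"
      using n by (simp add: b power2_eq_square divide_simps)
    also have "real m * (real m - 1) / 2 * (b3\<^sup>2 * \<sigma>Y2) = \<sigma>Y2 / (2 * real m * (real m - 1))"
      using m by (simp add: b power2_eq_square divide_simps)
    finally show ?thesis unfolding \<sigma>_sq[symmetric] using \<sigma>_pos by simp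
  qed
  have ortho: "(\<Sum>e\<in>?I. W i e * W j e) = (if i = j then 1 else 0)" if ij: "i \<in> ?J" "j \<in> ?J" for i j
  proof -
    have 01: "(0, 1) \<notin> J" by (auto simp: J)
    consider "i = (0, 1)" "j = (0, 1)" | "i = (0, 1)" "j \<in> J" | "i \<in> J" "j = (0, 1)" | "i \<in> J" "j \<in> J"
      using ij unfolding J by blast
    then show ?thesis
    proof cases
      case 1 then show ?thesis using W_norm by simp
    next
      case 2 then show ?thesis using 01 U_zero[OF 2(2)] by (auto simp: WJ) (simp add: W_def mult.commute)
    next
      case 3 then show ?thesis using 01 U_zero[OF 3(1)] by (auto simp: WJ) (simp add: W_def)
    next
      case 4 then show ?thesis using U_ortho by (simp add: WJ)
    qed
  qed
  have indep: "G.indep_vars (\<lambda>_. borel) X ?J" and std: "\<And>j. j \<in> ?J \<Longrightarrow> distr G borel (X j) = std_normal_distribution"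
  proof -
    have fin: "finite ?J" by simp
    note * = orthonormal_gaussian_indep[OF finite_entries fin ortho]
    show "G.indep_vars (\<lambda>_. borel) X ?J" unfolding X_def[abs_def] G_def by (rule *(1))
    show "distr G borel (X j) = std_normal_distribution" if "j \<in> ?J" for j
      unfolding X_def[abs_def] G_def by (rule *(2)[OF _ _ that])
  qed
  define Q where "Q = (\<lambda>b r z. \<Sum>i=1..r. (X (b, i) z)\<^sup>2)"
  have law: "distr G (borel \<Otimes>\<^sub>M borel \<Otimes>\<^sub>M borel \<Otimes>\<^sub>M borel) (\<lambda>z. (X (0, 1) z, Q 1 r1 z, Q 2 r2 z, Q 3 r3 z))
      = normal_law 0 1 \<Otimes>\<^sub>M chi_square r1 \<Otimes>\<^sub>M chi_square r2 \<Otimes>\<^sub>M chi_square r3"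
    "distr G (borel \<Otimes>\<^sub>M borel) (\<lambda>z. (X (0, 1) z, Q 1 r1 z + Q 2 r2 z + Q 3 r3 z))
      = normal_law 0 1 \<Otimes>\<^sub>M chi_square (r1 + r2 + r3)"
    unfolding Q_def by (rule G.gaussian_block_law[OF indep refl std]; assumption)+
  have comp[measurable]: "(\<lambda>z. z e) \<in> borel_measurable G" if "e \<in> ?I" for e
    using measurable_component_singleton[OF that, of "\<lambda>_. std_normal_distribution"]
    unfolding G_def by (simp cong: measurable_cong_sets)
  have X_m[measurable]: "X j \<in> borel_measurable G" for j
    unfolding X_def[abs_def] by (intro borel_measurable_sum borel_measurable_times) auto
  have Q_m[measurable]: "Q b r \<in> borel_measurable G" for b r
    unfolding Q_def by measurable
  have S_m[measurable]: "(\<lambda>z. \<lambda>e\<in>?I. s e * z e) \<in> measurable G (PiM ?I (\<lambda>_. borel))"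
    by (intro measurable_restrict borel_measurable_times) auto
  have \<mu>: "\<mu> = distr G (PiM ?I (\<lambda>_. borel)) (\<lambda>z. \<lambda>e\<in>?I. s e * z e)"
    unfolding \<mu>_def G_def s_def by (rule entries_limit_eq_distr) (fact nonneg nonempty)+
  have lin: "lin_stat n m (\<lambda>e\<in>?I. s e * z e) = \<sigma> * X (0, 1) z" for z
    unfolding lin_stat_def X_def sum_distrib_left
    using \<sigma>_pos by (intro sum.cong refl) (auto simp: W_def s_def by_block_def b split: entry.split)
  have sU: "(\<Sum>e\<in>?I. U (1, i) e * (s e * z e)) = sqrt \<sigma>2 * (\<Sum>e\<in>?I. U (1, i) e * z e)"
    "(\<Sum>e\<in>?I. U (2, i) e * (s e * z e)) = sqrt \<sigma>X2 * (\<Sum>e\<in>?I. U (2, i) e * z e)"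
    "(\<Sum>e\<in>?I. U (3, i) e * (s e * z e)) = sqrt \<sigma>Y2 * (\<Sum>e\<in>?I. U (3, i) e * z e)" for i z
    unfolding s_def mult.assoc[symmetric] U_block by (simp_all add: sum_distrib_left mult.assoc)
  have XU: "X (b, i) z = (\<Sum>e\<in>?I. U (b, i) e * z e)" if "b \<noteq> 0" for b i z
    using that by (simp add: X_def W_def)
  have quad: "quad_stat n m (\<lambda>e\<in>?I. s e * z e) = (\<sigma>2 * Q 1 r1 z + \<sigma>X2 * Q 2 r2 z + \<sigma>Y2 * Q 3 r3 z) / real (r1 + r2 + r3)" for z
  proof -
    have "(\<Sum>e\<in>?I. U j e * (\<lambda>e\<in>?I. s e * z e) e) = (\<Sum>e\<in>?I. U j e * (s e * z e))" for j
      by (intro sum.cong) auto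
    moreover have "(\<Sum>i=1..r. (sqrt a * x i)\<^sup>2) = a * (\<Sum>i=1..r. (x i)\<^sup>2)" if "0 \<le> a" for a r and x :: "nat \<Rightarrow> real"
      using that by (simp add: power_mult_distrib sum_distrib_left)
    moreover have "Q 1 r1 z = (\<Sum>i=1..r1. (\<Sum>e\<in>?I. U (1, i) e * z e)\<^sup>2)" "Q 2 r2 z = (\<Sum>i=1..r2. (\<Sum>e\<in>?I. U (2, i) e * z e)\<^sup>2)"
      "Q 3 r3 z = (\<Sum>i=1..r3. (\<Sum>e\<in>?I. U (3, i) e * z e)\<^sup>2)"
      unfolding Q_def by (subst XU; simp)+
    ultimately show ?thesis
      unfolding U_quad by (simp only: sU nonneg)
  qed
  have D: "D = r1 + r2 + r3" by (simp add: D_def r)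
  note [measurable] = quad_stat_measurable[OF n m]
  have joint: "distr \<mu> (borel \<Otimes>\<^sub>M borel) (\<lambda>w. (lin_stat n m w, quad_stat n m w))
    = distr G (borel \<Otimes>\<^sub>M borel) (\<lambda>z. (\<sigma> * X (0, 1) z, (\<sigma>2 * Q 1 r1 z + \<sigma>X2 * Q 2 r2 z + \<sigma>Y2 * Q 3 r3 z) / real D))"
    unfolding \<mu> by (subst distr_distr) (simp_all add: comp_def lin quad D)
  also have "\<dots> = distr (distr G (borel \<Otimes>\<^sub>M borel \<Otimes>\<^sub>M borel \<Otimes>\<^sub>M borel) (\<lambda>z. (X (0, 1) z, Q 1 r1 z, Q 2 r2 z, Q 3 r3 z)))
      (borel \<Otimes>\<^sub>M borel) (\<lambda>(z, q1, q2, q3). (\<sigma> * z, (\<sigma>2 * q1 + \<sigma>X2 * q2 + \<sigma>Y2 * q3) / real D))"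
    by (subst distr_distr) (simp_all add: comp_def)
  also have "\<dots> = distr (distr (normal_law 0 1 \<Otimes>\<^sub>M (chi_square r1 \<Otimes>\<^sub>M chi_square r2 \<Otimes>\<^sub>M chi_square r3)) (borel \<Otimes>\<^sub>M borel)
      (\<lambda>(z, q). (z, (\<lambda>(q, qX, qY). (\<sigma>2 * q + \<sigma>X2 * qX + \<sigma>Y2 * qY) / real D) q))) (borel \<Otimes>\<^sub>M borel) (\<lambda>(z, q). (\<sigma> * z, q))"
    unfolding law(1) by (subst distr_distr) (simp_all add: comp_def case_prod_unfold)
  also have "distr (normal_law 0 1 \<Otimes>\<^sub>M (chi_square r1 \<Otimes>\<^sub>M chi_square r2 \<Otimes>\<^sub>M chi_square r3)) (borel \<Otimes>\<^sub>M borel)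
      (\<lambda>(z, q). (z, (\<lambda>(q, qX, qY). (\<sigma>2 * q + \<sigma>X2 * qX + \<sigma>Y2 * qY) / real D) q))
     = normal_law 0 1 \<Otimes>\<^sub>M M_law n m \<sigma>2 \<sigma>X2 \<sigma>Y2"
  proof -
    interpret M: prob_space "M_law n m \<sigma>2 \<sigma>X2 \<sigma>Y2" by (rule prob_space_M_law)
    have "normal_law 0 1 \<Otimes>\<^sub>M M_law n m \<sigma>2 \<sigma>X2 \<sigma>Y2
      = distr (normal_law 0 1) borel (\<lambda>z. z) \<Otimes>\<^sub>M distr (chi_square r1 \<Otimes>\<^sub>M chi_square r2 \<Otimes>\<^sub>M chi_square r3) borel
          (\<lambda>(q, qX, qY). (\<sigma>2 * q + \<sigma>X2 * qX + \<sigma>Y2 * qY) / real D)"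
      by (simp add: M_law_def r D_def distr_id2)
    also have "\<dots> = distr (normal_law 0 1 \<Otimes>\<^sub>M (chi_square r1 \<Otimes>\<^sub>M chi_square r2 \<Otimes>\<^sub>M chi_square r3)) (borel \<Otimes>\<^sub>M borel)
      (\<lambda>(z, q). (z, (\<lambda>(q, qX, qY). (\<sigma>2 * q + \<sigma>X2 * qX + \<sigma>Y2 * qY) / real D) q))"
      by (rule pair_measure_distr) (use M.sigma_finite_measure_axioms in
          \<open>auto simp: M_law_def r D_def cong: measurable_cong_sets\<close>)
    finally show ?thesis ..
  qed
  finally show "distr \<mu> (borel \<Otimes>\<^sub>M borel) (\<lambda>w. (lin_stat n m w, quad_stat n m w))
       = distr (normal_law 0 1 \<Otimes>\<^sub>M M_law n m \<sigma>2 \<sigma>X2 \<sigma>Y2) (borel \<Otimes>\<^sub>M borel) (\<lambda>(z, q). (\<sigma> * z, q))" .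
  show "distr \<mu> (borel \<Otimes>\<^sub>M borel) (\<lambda>w. (lin_stat n m w, quad_stat n m w))
       = distr (normal_law 0 1 \<Otimes>\<^sub>M chi_square D) (borel \<Otimes>\<^sub>M borel) (\<lambda>(z, q). (\<sigma> * z, \<sigma>2 * (q / real D)))"
    if eq: "\<sigma>X2 = \<sigma>2" "\<sigma>Y2 = \<sigma>2"
  proof -
    have "distr \<mu> (borel \<Otimes>\<^sub>M borel) (\<lambda>w. (lin_stat n m w, quad_stat n m w))
      = distr (distr G (borel \<Otimes>\<^sub>M borel) (\<lambda>z. (X (0, 1) z, Q 1 r1 z + Q 2 r2 z + Q 3 r3 z)))
      (borel \<Otimes>\<^sub>M borel) (\<lambda>(z, q). (\<sigma> * z, \<sigma>2 * (q / real D)))"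
      unfolding joint by (subst distr_distr) (simp_all add: comp_def eq algebra_simps)
    then show ?thesis unfolding law(2) D .
  qed
  show "AE w in \<mu>. 0 < quad_stat n m w"
  proof -
    \<comment> \<open>Sample sizes of at least 4 are essential here, as \<open>v 3\<close> is 0. All
      three ranks being at least 1, whichever variance is positive multiplies a sum of squares that
      is nonzero almost surely.\<close>
    have r_pos: "1 \<le> r1" "1 \<le> r2" "1 \<le> r3"
    proof -
      have "1 \<le> v k" if "4 \<le> k" for k
        using two_v[of k] that mult_pos_pos[of "real k" "real k - 3"] by (cases "v k") auto
      then show "1 \<le> r2" "1 \<le> r3" using n m by (auto simp: r)
      show "1 \<le> r1" using n m mult_le_mono[of 1 "n - 1" 1 "m - 1"] by (simp add: r)
    qed
    have nz: "AE z in G. X j z \<noteq> 0" if "j \<in> ?J" for j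
    proof -
      have "AE x in std_normal_distribution. x \<noteq> 0"
        by (subst AE_density) (use AE_lborel_singleton[of 0] in auto)
      then have "AE x in distr G borel (X j). x \<noteq> 0" by (simp only: std[OF that])
      then show ?thesis by (subst (asm) AE_distr_iff) auto
    qed
    have "AE z in G. X (1, 1) z \<noteq> 0 \<and> X (2, 1) z \<noteq> 0 \<and> X (3, 1) z \<noteq> 0"
      using nz[of "(1, 1)"] nz[of "(2, 1)"] nz[of "(3, 1)"] r_pos by auto
    then have "AE z in G. 0 < quad_stat n m (\<lambda>e\<in>?I. s e * z e)"
    proof (rule AE_mp, intro AE_I2 impI)
      fix z assume *: "X (1, 1) z \<noteq> 0 \<and> X (2, 1) z \<noteq> 0 \<and> X (3, 1) z \<noteq> 0"
      have pos: "0 < Q b r z" if "X (b, 1) z \<noteq> 0" "1 \<le> r" for b r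
        unfolding Q_def using that by (intro sum_pos2[of _ 1]) auto
      have "0 < Q 1 r1 z" "0 < Q 2 r2 z" "0 < Q 3 r3 z" using * r_pos by (auto intro: pos)
      then have "0 < \<sigma>2 * Q 1 r1 z + \<sigma>X2 * Q 2 r2 z + \<sigma>Y2 * Q 3 r3 z"
        using nonneg nondeg by (metis add_nonneg_nonneg add_nonneg_pos add_pos_nonneg less_eq_real_def mult_nonneg_nonneg mult_pos_pos)
      then show "0 < quad_stat n m (\<lambda>e\<in>?I. s e * z e)"
        unfolding quad using r_pos by simp
    qed
    then show ?thesis unfolding \<mu> by (subst AE_distr_iff) auto
  qed
qed

section \<open>Vanishing in probability and weak convergence of ratios\<close>

text \<open>The exceptional sets \<open>A p\<close> avoid any measurability requirement on \<open>Z\<close>.\<close>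

definition vanishes :: "(nat \<Rightarrow> 'w measure) \<Rightarrow> (nat \<Rightarrow> 'w \<Rightarrow> real) \<Rightarrow> bool" where
  "vanishes P Z \<longleftrightarrow> (\<forall>\<epsilon>>0. \<exists>A. (\<forall>p. A p \<in> sets (P p)) \<and> (\<lambda>p. measure (P p) (A p)) \<longlonglongrightarrow> 0 \<and>
     (\<forall>\<^sub>F p in sequentially. \<forall>\<omega>\<in>space (P p) - A p. \<bar>Z p \<omega>\<bar> \<le> \<epsilon>))"

lemma vanishes_const:
  assumes "c \<longlonglongrightarrow> 0"
  shows "vanishes P (\<lambda>p \<omega>. c p)"
  unfolding vanishes_def
proof (intro allI impI exI[of _ "\<lambda>p. {}"] conjI)
  fix \<epsilon> :: real assume "\<epsilon> > 0"
  with assms show "\<forall>\<^sub>F p in sequentially. \<forall>\<omega>\<in>space (P p) - {}. \<bar>c p\<bar> \<le> \<epsilon>"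
    by (auto dest!: tendstoD[of c 0 _ \<epsilon>] elim: eventually_mono)
qed auto

lemma vanishes_smallop1:
  assumes meas: "\<And>p. Z p \<in> borel_measurable (P p)" and "smallop1 P Z"
  shows "vanishes P Z"
  unfolding vanishes_def
proof (intro allI impI)
  fix \<epsilon> :: real assume \<epsilon>: "\<epsilon> > 0"
  note [measurable] = meas
  show "\<exists>A. (\<forall>p. A p \<in> sets (P p)) \<and> (\<lambda>p. measure (P p) (A p)) \<longlonglongrightarrow> 0 \<and>
     (\<forall>\<^sub>F p in sequentially. \<forall>\<omega>\<in>space (P p) - A p. \<bar>Z p \<omega>\<bar> \<le> \<epsilon>)"
    using assms(2) \<epsilon> by (intro exI[of _ "\<lambda>p. {\<omega> \<in> space (P p). \<bar>Z p \<omega>\<bar> > \<epsilon>}"]) (auto simp: smallop1_def not_less)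
qed

context
  fixes P :: "nat \<Rightarrow> 'w measure"
  assumes prob: "\<And>p. prob_space (P p)"
begin

lemma tendsto_measure_Un:
  assumes "\<And>p. A p \<in> sets (P p)" "\<And>p. B p \<in> sets (P p)"
    and "(\<lambda>p. measure (P p) (A p)) \<longlonglongrightarrow> 0" "(\<lambda>p. measure (P p) (B p)) \<longlonglongrightarrow> 0"
  shows "(\<lambda>p. measure (P p) (A p \<union> B p)) \<longlonglongrightarrow> 0"
proof (rule tendsto_sandwich[of "\<lambda>_. 0" _ _ "\<lambda>p. measure (P p) (A p) + measure (P p) (B p)"])
  show "\<forall>\<^sub>F p in sequentially. measure (P p) (A p \<union> B p) \<le> measure (P p) (A p) + measure (P p) (B p)"
    using assms by (intro always_eventually allI measure_Un_le)
  show "(\<lambda>p. measure (P p) (A p) + measure (P p) (B p)) \<longlonglongrightarrow> 0"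
    using tendsto_add[OF assms(3,4)] by simp
qed auto

lemma vanishes_add:
  assumes "vanishes P Z" "vanishes P W"
  shows "vanishes P (\<lambda>p \<omega>. Z p \<omega> + W p \<omega>)"
  unfolding vanishes_def
proof (intro allI impI)
  fix \<epsilon> :: real assume "\<epsilon> > 0"
  then have half: "\<epsilon> / 2 > 0" by simp
  obtain A where A: "\<And>p. A p \<in> sets (P p)" "(\<lambda>p. measure (P p) (A p)) \<longlonglongrightarrow> 0"
    "\<forall>\<^sub>F p in sequentially. \<forall>\<omega>\<in>space (P p) - A p. \<bar>Z p \<omega>\<bar> \<le> \<epsilon> / 2"
    using assms(1) half unfolding vanishes_def by blast
  obtain B where B: "\<And>p. B p \<in> sets (P p)" "(\<lambda>p. measure (P p) (B p)) \<longlonglongrightarrow> 0"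
    "\<forall>\<^sub>F p in sequentially. \<forall>\<omega>\<in>space (P p) - B p. \<bar>W p \<omega>\<bar> \<le> \<epsilon> / 2"
    using assms(2) half unfolding vanishes_def by blast
  have "\<forall>\<^sub>F p in sequentially. \<forall>\<omega>\<in>space (P p) - (A p \<union> B p). \<bar>Z p \<omega> + W p \<omega>\<bar> \<le> \<epsilon>"
    using A(3) B(3)
  proof eventually_elim
    case (elim p)
    show ?case
    proof
      fix \<omega> assume "\<omega> \<in> space (P p) - (A p \<union> B p)"
      then have "\<bar>Z p \<omega>\<bar> \<le> \<epsilon> / 2" "\<bar>W p \<omega>\<bar> \<le> \<epsilon> / 2" using elim by auto
      then show "\<bar>Z p \<omega> + W p \<omega>\<bar> \<le> \<epsilon>" by linarith
    qed
  qed
  then show "\<exists>A. (\<forall>p. A p \<in> sets (P p)) \<and> (\<lambda>p. measure (P p) (A p)) \<longlonglongrightarrow> 0 \<and>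
     (\<forall>\<^sub>F p in sequentially. \<forall>\<omega>\<in>space (P p) - A p. \<bar>Z p \<omega> + W p \<omega>\<bar> \<le> \<epsilon>)"
    using A B by (intro exI[of _ "\<lambda>p. A p \<union> B p"] conjI tendsto_measure_Un) auto
qed

lemma vanishes_sum:
  assumes "\<And>i. i \<in> I \<Longrightarrow> vanishes P (Z i)"
  shows "vanishes P (\<lambda>p \<omega>. \<Sum>i\<in>I. Z i p \<omega>)"
  using assms by (induction I rule: infinite_finite_induct) (auto intro: vanishes_add vanishes_const)

text \<open>Conditional expectations, and hence \<open>H\<close>, are determined only up to null
  sets, so bounds hold almost everywhere. The null sets are merged into the exceptional
  sets.\<close>

lemma vanishes_AE_bound:
  assumes W: "vanishes P W"
    and bound: "\<forall>\<^sub>F p in sequentially. AE \<omega> in P p. \<bar>Z p \<omega>\<bar> \<le> C * \<bar>W p \<omega>\<bar>"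
  shows "vanishes P Z"
  unfolding vanishes_def
proof (intro allI impI)
  fix \<epsilon> :: real assume \<epsilon>: "\<epsilon> > 0"
  \<comment> \<open>Dominates \<open>C\<close> and stays positive when \<open>C\<close> is zero or
    negative, so that \<open>\<epsilon> / D\<close> is an admissible tolerance.\<close>
  define D where "D = \<bar>C\<bar> + 1"
  have D: "D > 0" by (simp add: D_def add_nonneg_pos)
  then have \<epsilon>': "\<epsilon> / D > 0" using \<epsilon> by simp
  obtain A where A: "\<And>p. A p \<in> sets (P p)" "(\<lambda>p. measure (P p) (A p)) \<longlonglongrightarrow> 0"
    "\<forall>\<^sub>F p in sequentially. \<forall>\<omega>\<in>space (P p) - A p. \<bar>W p \<omega>\<bar> \<le> \<epsilon> / D"
    using W \<epsilon>' unfolding vanishes_def by blast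
  \<comment> \<open>A null set is chosen for every \<open>p\<close>, also for those where the bound
    fails, since the exceptional sets must be measurable for all \<open>p\<close>.\<close>
  have "\<exists>N. N \<in> null_sets (P p) \<and> ((AE \<omega> in P p. \<bar>Z p \<omega>\<bar> \<le> C * \<bar>W p \<omega>\<bar>) \<longrightarrow>
     (\<forall>\<omega>\<in>space (P p) - N. \<bar>Z p \<omega>\<bar> \<le> C * \<bar>W p \<omega>\<bar>))" for p
  proof (cases "AE \<omega> in P p. \<bar>Z p \<omega>\<bar> \<le> C * \<bar>W p \<omega>\<bar>")
    case True
    then obtain N where "{\<omega> \<in> space (P p). \<not> \<bar>Z p \<omega>\<bar> \<le> C * \<bar>W p \<omega>\<bar>} \<subseteq> N" "N \<in> null_sets (P p)"
      by (auto simp: eventually_ae_filter)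
    then show ?thesis by (intro exI[of _ N]) auto
  qed auto
  then obtain N where N: "\<And>p. N p \<in> null_sets (P p)"
    "\<And>p. (AE \<omega> in P p. \<bar>Z p \<omega>\<bar> \<le> C * \<bar>W p \<omega>\<bar>) \<Longrightarrow> \<forall>\<omega>\<in>space (P p) - N p. \<bar>Z p \<omega>\<bar> \<le> C * \<bar>W p \<omega>\<bar>"
    by metis
  have "\<forall>\<^sub>F p in sequentially. \<forall>\<omega>\<in>space (P p) - (A p \<union> N p). \<bar>Z p \<omega>\<bar> \<le> \<epsilon>"
    using A(3) bound
  proof eventually_elim
    case (elim p)
    show ?case
    proof
      fix \<omega> assume \<omega>: "\<omega> \<in> space (P p) - (A p \<union> N p)"
      then have "\<bar>Z p \<omega>\<bar> \<le> C * \<bar>W p \<omega>\<bar>" using N(2)[OF elim(2)] by auto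
      also have "\<dots> \<le> D * (\<epsilon> / D)" using \<omega> elim(1) D by (intro mult_mono) (auto simp: D_def)
      finally show "\<bar>Z p \<omega>\<bar> \<le> \<epsilon>" using D by simp
    qed
  qed
  moreover have "(\<lambda>p. measure (P p) (N p)) \<longlonglongrightarrow> 0"
    using N(1) by (simp add: measure_eq_0_null_sets)
  ultimately show "\<exists>A. (\<forall>p. A p \<in> sets (P p)) \<and> (\<lambda>p. measure (P p) (A p)) \<longlonglongrightarrow> 0 \<and>
     (\<forall>\<^sub>F p in sequentially. \<forall>\<omega>\<in>space (P p) - A p. \<bar>Z p \<omega>\<bar> \<le> \<epsilon>)"
    using A N(1) by (intro exI[of _ "\<lambda>p. A p \<union> N p"] conjI tendsto_measure_Un) auto
qed

lemma vanishes_cmult: "vanishes P Z \<Longrightarrow> vanishes P (\<lambda>p \<omega>. c * Z p \<omega>)"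
  by (rule vanishes_AE_bound[where C="\<bar>c\<bar>"]) (auto simp: abs_mult)

text \<open>The functions \<open>cts_step\<close> determine weak convergence on the line and are
  uniformly continuous with values between 0 and 1. A difference that vanishes in probability thus
  changes their integrals by at most \<epsilon>/2 plus the mass of an exceptional set.\<close>

lemma slutsky_weak_conv:
  assumes U[measurable]: "\<And>p. U p \<in> borel_measurable (P p)" and V[measurable]: "\<And>p. V p \<in> borel_measurable (P p)"
    and N: "real_distribution N"
    and diff: "vanishes P (\<lambda>p \<omega>. U p \<omega> - V p \<omega>)"
    and conv: "\<And>x y. x < y \<Longrightarrow> (\<lambda>p. \<integral>\<omega>. cts_step x y (V p \<omega>) \<partial>P p) \<longlonglongrightarrow> integral\<^sup>L N (cts_step x y)"
  shows "weak_conv_m (\<lambda>p. distr (P p) borel (U p)) N"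
proof (rule integral_cts_step_conv_imp_weak_conv)
  show "real_distribution (distr (P p) borel (U p))" for p
    by (rule prob_space.real_distribution_distr[OF prob]) simp
  fix x y :: real assume xy: "x < y"
  have step01: "0 \<le> cts_step x y z" "cts_step x y z \<le> 1" for z
    using xy by (auto simp: cts_step_def)
  have step_m[measurable]: "cts_step x y \<in> borel_measurable borel"
    unfolding cts_step_def[abs_def] by measurable
  have "(\<lambda>p. (\<integral>\<omega>. cts_step x y (U p \<omega>) \<partial>P p) - (\<integral>\<omega>. cts_step x y (V p \<omega>) \<partial>P p)) \<longlonglongrightarrow> 0"
  proof (rule tendstoI)
    fix \<epsilon> :: real assume \<epsilon>: "\<epsilon> > 0"
    then obtain \<eta> where \<eta>: "\<eta> > 0" "\<And>u w. dist u w < \<eta> \<Longrightarrow> dist (cts_step x y u) (cts_step x y w) < \<epsilon> / 2"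
      using cts_step_uniformly_continuous[OF xy] unfolding uniformly_continuous_on_def
      by (metis UNIV_I half_gt_zero)
    obtain A where A: "\<And>p. A p \<in> sets (P p)" "(\<lambda>p. measure (P p) (A p)) \<longlonglongrightarrow> 0"
      "\<forall>\<^sub>F p in sequentially. \<forall>\<omega>\<in>space (P p) - A p. \<bar>U p \<omega> - V p \<omega>\<bar> \<le> \<eta> / 2"
      using diff \<eta>(1) unfolding vanishes_def by (meson half_gt_zero)
    have "\<forall>\<^sub>F p in sequentially. measure (P p) (A p) < \<epsilon> / 2"
      using A(2) \<epsilon> by (intro order_tendstoD(2)[OF A(2)]) simp
    with A(3) show "\<forall>\<^sub>F p in sequentially. dist ((\<integral>\<omega>. cts_step x y (U p \<omega>) \<partial>P p) - (\<integral>\<omega>. cts_step x y (V p \<omega>) \<partial>P p)) 0 < \<epsilon>"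
    proof eventually_elim
      case (elim p)
      interpret prob_space "P p" by (rule prob)
      note [measurable] = A(1)
      have int: "integrable (P p) (\<lambda>\<omega>. cts_step x y (f \<omega>))" if "f \<in> borel_measurable (P p)" for f
        using that by (intro integrable_const_bound[where B=1]) (use step01 in auto)
      have int_A: "integrable (P p) (indicator (A p) :: 'w \<Rightarrow> real)"
        using A(1)[of p] by (intro integrable_real_indicator) (auto simp: less_top[symmetric])
      have "\<bar>(\<integral>\<omega>. cts_step x y (U p \<omega>) \<partial>P p) - (\<integral>\<omega>. cts_step x y (V p \<omega>) \<partial>P p)\<bar>
        = \<bar>\<integral>\<omega>. cts_step x y (U p \<omega>) - cts_step x y (V p \<omega>) \<partial>P p\<bar>"
        by (subst Bochner_Integration.integral_diff) (auto intro: int)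
      also have "\<dots> \<le> (\<integral>\<omega>. \<bar>cts_step x y (U p \<omega>) - cts_step x y (V p \<omega>)\<bar> \<partial>P p)"
        by (rule integral_abs_bound)
      also have "\<dots> \<le> (\<integral>\<omega>. \<epsilon> / 2 + indicator (A p) \<omega> \<partial>P p)"
      proof (rule integral_mono)
        show "integrable (P p) (\<lambda>\<omega>. \<bar>cts_step x y (U p \<omega>) - cts_step x y (V p \<omega>)\<bar>)"
          by (intro integrable_abs Bochner_Integration.integrable_diff int) auto
        show "integrable (P p) (\<lambda>\<omega>. \<epsilon> / 2 + indicator (A p) \<omega>)" by (simp add: int_A)
        fix \<omega> assume \<omega>: "\<omega> \<in> space (P p)"
        show "\<bar>cts_step x y (U p \<omega>) - cts_step x y (V p \<omega>)\<bar> \<le> \<epsilon> / 2 + indicator (A p) \<omega>"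
        proof (cases "\<omega> \<in> A p")
          case True
          have "\<bar>cts_step x y (U p \<omega>) - cts_step x y (V p \<omega>)\<bar> \<le> 1"
            using step01[of "U p \<omega>"] step01[of "V p \<omega>"] by linarith
          then show ?thesis using True \<epsilon> by simp
        next
          case False
          then have "\<bar>U p \<omega> - V p \<omega>\<bar> \<le> \<eta> / 2" using elim(1) \<omega> by blast
          then have "dist (U p \<omega>) (V p \<omega>) < \<eta>" using \<eta>(1) by (simp add: dist_real_def)
          then show ?thesis using \<eta>(2) False by (fastforce simp: dist_real_def)
        qed
      qed
      also have "\<dots> = \<epsilon> / 2 + measure (P p) (A p)"
        using A(1)[of p] by (simp add: prob_space int_A)
      finally show ?case using elim by (simp add: dist_real_def)
    qed
  qed
  from tendsto_add[OF this conv[OF xy]]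
  show "(\<lambda>p. integral\<^sup>L (distr (P p) borel (U p)) (cts_step x y)) \<longlonglongrightarrow> integral\<^sup>L N (cts_step x y)"
    by (simp add: integral_distr)
qed (rule N)

text \<open>Clearing the denominator is legitimate only where \<open>R\<close> is positive. That the
  complement is asymptotically negligible is itself a consequence of the one-dimensional
  convergence, because \<open>g\<close> is almost surely positive in the limit.\<close>

lemma ratio_weak_conv:
  fixes V :: "nat \<Rightarrow> 'i \<Rightarrow> 'w \<Rightarrow> real" and f g :: "('i \<Rightarrow> real) \<Rightarrow> real" and E R :: "nat \<Rightarrow> 'w \<Rightarrow> real"
  assumes conv: "joint_conv P I V \<mu>" and \<mu>: "prob_space \<mu>" "sets \<mu> = sets (PiM I (\<lambda>_. borel))"
    and V[measurable]: "\<And>p i. i \<in> I \<Longrightarrow> V p i \<in> borel_measurable (P p)"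
    and E[measurable]: "\<And>p. E p \<in> borel_measurable (P p)" and R[measurable]: "\<And>p. R p \<in> borel_measurable (P p)"
    and f: "f \<in> borel_measurable (PiM I (\<lambda>_. borel))" "continuous_on (\<Pi>\<^sub>E i\<in>I. UNIV) f"
    and g: "g \<in> borel_measurable (PiM I (\<lambda>_. borel))" "continuous_on (\<Pi>\<^sub>E i\<in>I. UNIV) g"
    and E_f: "vanishes P (\<lambda>p \<omega>. E p \<omega> - f (\<lambda>i\<in>I. V p i \<omega>))"
    and R_g: "vanishes P (\<lambda>p \<omega>. R p \<omega> - g (\<lambda>i\<in>I. V p i \<omega>))"
    and g_pos: "AE w in \<mu>. 0 < g w"
    and no_atom: "\<And>t. AE w in \<mu>. f w - t * g w \<noteq> 0"
  shows "weak_conv_m (\<lambda>p. distr (P p) borel (\<lambda>\<omega>. E p \<omega> / R p \<omega>)) (distr \<mu> borel (\<lambda>w. f w / g w))"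
proof -
  interpret \<mu>: prob_space \<mu> by (rule \<mu>)
  note [measurable_cong] = \<mu>(2)
  note [measurable] = f(1) g(1)
  \<comment> \<open>Needed for two choices of coefficients: \<open>1\<close> and \<open>- t\<close>
    give the event of interest, \<open>0\<close> and \<open>1\<close> show that \<open>R\<close> is
    positive with probability tending to 1.\<close>
  have lin_conv: "(\<lambda>p. measure (P p) {\<omega> \<in> space (P p). \<alpha> * E p \<omega> + \<beta> * R p \<omega> \<le> 0}) \<longlonglongrightarrow> measure \<mu> {w \<in> space \<mu>. \<alpha> * f w + \<beta> * g w \<le> 0}"
    if null: "AE w in \<mu>. \<alpha> * f w + \<beta> * g w \<noteq> 0" for \<alpha> \<beta>
  proof -
    let ?N = "distr \<mu> borel (\<lambda>w. \<alpha> * f w + \<beta> * g w)"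
    interpret N: real_distribution ?N by (rule \<mu>.real_distribution_distr) measurable
    have "weak_conv_m (\<lambda>p. distr (P p) borel (\<lambda>\<omega>. \<alpha> * E p \<omega> + \<beta> * R p \<omega>)) ?N"
    proof (rule slutsky_weak_conv[where V="\<lambda>p \<omega>. \<alpha> * f (\<lambda>i\<in>I. V p i \<omega>) + \<beta> * g (\<lambda>i\<in>I. V p i \<omega>)"])
      have [measurable]: "(\<lambda>\<omega>. \<lambda>i\<in>I. V p i \<omega>) \<in> measurable (P p) (PiM I (\<lambda>_. borel))" for p
        by (rule measurable_restrict) simp
      show "(\<lambda>\<omega>. \<alpha> * f (\<lambda>i\<in>I. V p i \<omega>) + \<beta> * g (\<lambda>i\<in>I. V p i \<omega>)) \<in> borel_measurable (P p)" for p
        by measurable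
      show "(\<lambda>\<omega>. \<alpha> * E p \<omega> + \<beta> * R p \<omega>) \<in> borel_measurable (P p)" for p by measurable
      show "real_distribution ?N" by (rule N.real_distribution_axioms)
      show "vanishes P (\<lambda>p \<omega>. \<alpha> * E p \<omega> + \<beta> * R p \<omega> - (\<alpha> * f (\<lambda>i\<in>I. V p i \<omega>) + \<beta> * g (\<lambda>i\<in>I. V p i \<omega>)))"
        using vanishes_add[OF vanishes_cmult[OF E_f, of \<alpha>] vanishes_cmult[OF R_g, of \<beta>]]
        by (simp add: algebra_simps)
      fix x y :: real assume xy: "x < y"
      have cont_step: "continuous_on UNIV (cts_step x y)"
        by (rule uniformly_continuous_imp_continuous[OF cts_step_uniformly_continuous[OF xy]])
      have step_m[measurable]: "cts_step x y \<in> borel_measurable borel"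
        unfolding cts_step_def[abs_def] by measurable
      define h where "h w = cts_step x y (\<alpha> * f w + \<beta> * g w)" for w
      have "continuous_on (\<Pi>\<^sub>E i\<in>I. UNIV) h"
        unfolding h_def
        by (rule continuous_on_compose2[OF cont_step]) (auto intro!: continuous_intros f g)
      moreover have "bounded (h ` (\<Pi>\<^sub>E i\<in>I. UNIV))"
        by (rule boundedI[of _ 1]) (use xy in \<open>auto simp: h_def cts_step_def\<close>)
      ultimately have "(\<lambda>p. \<integral>\<omega>. h (\<lambda>i\<in>I. V p i \<omega>) \<partial>P p) \<longlonglongrightarrow> (\<integral>w. h w \<partial>\<mu>)"
        using conv unfolding joint_conv_def by blast
      then show "(\<lambda>p. \<integral>\<omega>. cts_step x y (\<alpha> * f (\<lambda>i\<in>I. V p i \<omega>) + \<beta> * g (\<lambda>i\<in>I. V p i \<omega>)) \<partial>P p)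
         \<longlonglongrightarrow> integral\<^sup>L ?N (cts_step x y)"
        by (simp add: h_def integral_distr)
    qed
    moreover have "isCont (cdf ?N) 0"
    proof -
      have "measure ?N {0} = measure \<mu> {w \<in> space \<mu>. \<alpha> * f w + \<beta> * g w = 0}"
        by (subst measure_distr) (auto simp: vimage_def Int_def conj_commute intro: arg_cong[where f="measure \<mu>"])
      also have "\<dots> = 0"
        using null by (intro \<mu>.prob_eq_0[THEN iffD2]) auto
      finally show ?thesis by (simp add: N.isCont_cdf)
    qed
    ultimately have "(\<lambda>p. cdf (distr (P p) borel (\<lambda>\<omega>. \<alpha> * E p \<omega> + \<beta> * R p \<omega>)) 0) \<longlonglongrightarrow> cdf ?N 0"
      unfolding weak_conv_m_def weak_conv_def by blast
    then show ?thesis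
      by (simp add: cdf_def measure_distr vimage_def Int_def conj_commute)
  qed
  have R0: "(\<lambda>p. measure (P p) {\<omega> \<in> space (P p). R p \<omega> \<le> 0}) \<longlonglongrightarrow> 0"
  proof -
    have "measure \<mu> {w \<in> space \<mu>. g w \<le> 0} = 0"
      using g_pos by (intro \<mu>.prob_eq_0[THEN iffD2]) (auto simp: not_le)
    moreover have "AE w in \<mu>. g w \<noteq> 0" using g_pos by eventually_elim simp
    ultimately show ?thesis using lin_conv[of 0 1] by simp
  qed
  show ?thesis
    unfolding weak_conv_m_def weak_conv_def
  proof (intro allI impI)
    fix t
    have U: "(\<lambda>p. measure (P p) {\<omega> \<in> space (P p). E p \<omega> - t * R p \<omega> \<le> 0}) \<longlonglongrightarrow> measure \<mu> {w \<in> space \<mu>. f w - t * g w \<le> 0}"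
      using lin_conv[of 1 "- t"] no_atom[of t] by simp
    \<comment> \<open>The two events agree where \<open>R\<close> is positive, so their
      probabilities differ by at most the probability that \<open>R\<close> is not.\<close>
    have "(\<lambda>p. measure (P p) {\<omega> \<in> space (P p). E p \<omega> / R p \<omega> \<le> t} - measure (P p) {\<omega> \<in> space (P p). E p \<omega> - t * R p \<omega> \<le> 0}) \<longlonglongrightarrow> 0"
    proof (rule Lim_null_comparison[OF _ R0], intro always_eventually allI)
      fix p
      interpret prob_space "P p" by (rule prob)
      let ?A = "{\<omega> \<in> space (P p). E p \<omega> / R p \<omega> \<le> t}" and ?B = "{\<omega> \<in> space (P p). E p \<omega> - t * R p \<omega> \<le> 0}"
        and ?C = "{\<omega> \<in> space (P p). R p \<omega> \<le> 0}"
      have eq: "E p \<omega> / R p \<omega> \<le> t \<longleftrightarrow> E p \<omega> - t * R p \<omega> \<le> 0" if "\<not> R p \<omega> \<le> 0" for \<omega>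
        using that by (simp add: divide_le_eq)
      have "prob ?A \<le> prob (?B \<union> ?C)" by (rule finite_measure_mono) (use eq in auto)
      also have "\<dots> \<le> prob ?B + prob ?C" by (rule measure_Un_le) auto
      finally have 1: "prob ?A \<le> prob ?B + prob ?C" .
      have "prob ?B \<le> prob (?A \<union> ?C)" by (rule finite_measure_mono) (use eq in auto)
      also have "\<dots> \<le> prob ?A + prob ?C" by (rule measure_Un_le) auto
      finally show "norm (prob ?A - prob ?B) \<le> prob ?C" using 1 by simp
    qed
    from tendsto_add[OF this U]
    have "(\<lambda>p. measure (P p) {\<omega> \<in> space (P p). E p \<omega> / R p \<omega> \<le> t}) \<longlonglongrightarrow> measure \<mu> {w \<in> space \<mu>. f w - t * g w \<le> 0}"
      by simp
    also have "measure \<mu> {w \<in> space \<mu>. f w - t * g w \<le> 0} = measure \<mu> {w \<in> space \<mu>. f w / g w \<le> t}"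
    proof (rule \<mu>.finite_measure_eq_AE)
      show "AE w in \<mu>. (w \<in> {w \<in> space \<mu>. f w - t * g w \<le> 0}) = (w \<in> {w \<in> space \<mu>. f w / g w \<le> t})"
        using g_pos by eventually_elim (auto simp: divide_le_eq)
    qed measurable
    finally show "(\<lambda>p. cdf (distr (P p) borel (\<lambda>\<omega>. E p \<omega> / R p \<omega>)) t) \<longlonglongrightarrow> cdf (distr \<mu> borel (\<lambda>w. f w / g w)) t"
      by (simp add: cdf_def measure_distr vimage_def Int_def conj_commute)
  qed
qed

end

section \<open>Effect of functions of a single observation\<close>

lemma K_hat_additive:
  assumes n: "1 \<le> n" and m: "1 \<le> m" and kl: "k \<in> {1..n}" "l \<in> {1..m}"
    and K: "\<And>i j. i \<in> {1..n} \<Longrightarrow> j \<in> {1..m} \<Longrightarrow> 2 * K (x i) (y j) = w i j + g i + h j"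
  shows "2 * K_hat K n m x y k l = K_hat w n m (\<lambda>i. i) (\<lambda>j. j) k l"
proof -
  define G Hs where "G = (\<Sum>i=1..n. g i)" "Hs = (\<Sum>j=1..m. h j)"
  have nm: "real n \<noteq> 0" "real m \<noteq> 0" using n m by auto
  have row: "2 * (\<Sum>j=1..m. K (x i) (y j)) = (\<Sum>j=1..m. w i j) + real m * g i + Hs" if "i \<in> {1..n}" for i
  proof -
    have "2 * (\<Sum>j=1..m. K (x i) (y j)) = (\<Sum>j=1..m. w i j + g i + h j)"
      unfolding sum_distrib_left by (intro sum.cong refl K that)
    then show ?thesis by (simp add: sum.distrib G_Hs_def)
  qed
  have col: "2 * (\<Sum>i=1..n. K (x i) (y l)) = (\<Sum>i=1..n. w i l) + G + real n * h l"
  proof -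
    have "2 * (\<Sum>i=1..n. K (x i) (y l)) = (\<Sum>i=1..n. w i l + g i + h l)"
      unfolding sum_distrib_left by (intro sum.cong refl K kl)
    then show ?thesis by (simp add: sum.distrib G_Hs_def)
  qed
  have tot: "2 * (\<Sum>i=1..n. \<Sum>j=1..m. K (x i) (y j)) = (\<Sum>i=1..n. \<Sum>j=1..m. w i j) + real m * G + real n * Hs"
  proof -
    have "2 * (\<Sum>i=1..n. \<Sum>j=1..m. K (x i) (y j)) = (\<Sum>i=1..n. (\<Sum>j=1..m. w i j) + real m * g i + Hs)"
      unfolding sum_distrib_left[of 2] by (intro sum.cong refl) (simp only: sum_distrib_left[symmetric] row)
    then show ?thesis by (simp add: sum.distrib G_Hs_def sum_distrib_left)
  qed
  have "2 * K_hat K n m x y k l = 2 * K (x k) (y l) - 1 / real n * (2 * (\<Sum>i=1..n. K (x i) (y l)))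
     - 1 / real m * (2 * (\<Sum>j=1..m. K (x k) (y j))) + 1 / (real n * real m) * (2 * (\<Sum>i=1..n. \<Sum>j=1..m. K (x i) (y j)))"
    by (simp add: K_hat_def algebra_simps)
  also have "\<dots> = K_hat w n m (\<lambda>i. i) (\<lambda>j. j) k l"
    unfolding K[OF kl] row[OF kl(1)] col tot K_hat_def using nm by (simp add: field_simps)
  finally show ?thesis .
qed

text \<open>The matrix is zero on the diagonal, so the additive part \<open>g i + g j\<close> is
  present only off it. A row of this part sums to (n - 2) times \<open>g i\<close> plus the sum of
  all \<open>g j\<close>, and the denominators n - 2 of U-centering are adjusted to precisely
  this.\<close>

lemma U_centered_additive:
  assumes n: "4 \<le> n" and kl: "k \<in> {1..n}" "l \<in> {1..n}" "k \<noteq> l"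
    and A: "\<And>i j. i \<in> {1..n} \<Longrightarrow> j \<in> {1..n} \<Longrightarrow> 2 * A i j = (if i = j then 0 else B i j + g i + g j)"
    and B: "\<And>i. i \<in> {1..n} \<Longrightarrow> B i i = 0"
  shows "2 * U_centered n A k l = U_centered n B k l"
proof -
  define G where "G = (\<Sum>i=1..n. g i)"
  have A': "2 * A i j = B i j + g i + g j - (if i = j then 2 * g i else 0)" if "i \<in> {1..n}" "j \<in> {1..n}" for i j
    using A[OF that] B that by auto
  have row: "2 * (\<Sum>j=1..n. A i j) = (\<Sum>j=1..n. B i j) + (real n - 2) * g i + G" if i: "i \<in> {1..n}" for i
  proof -
    have "2 * (\<Sum>j=1..n. A i j) = (\<Sum>j=1..n. B i j + g i + g j - (if i = j then 2 * g i else 0))"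
      unfolding sum_distrib_left by (intro sum.cong refl A' i)
    then show ?thesis using i by (simp add: sum.distrib sum_subtractf G_def left_diff_distrib)
  qed
  have col: "2 * (\<Sum>i=1..n. A i l) = (\<Sum>i=1..n. B i l) + (real n - 2) * g l + G"
  proof -
    have "2 * (\<Sum>i=1..n. A i l) = (\<Sum>i=1..n. B i l + g i + g l - (if i = l then 2 * g i else 0))"
      unfolding sum_distrib_left by (intro sum.cong refl A' kl)
    then show ?thesis using kl by (simp add: sum.distrib sum_subtractf G_def left_diff_distrib)
  qed
  have tot: "2 * (\<Sum>i=1..n. \<Sum>j=1..n. A i j) = (\<Sum>i=1..n. \<Sum>j=1..n. B i j) + 2 * (real n - 1) * G"
  proof -
    have "2 * (\<Sum>i=1..n. \<Sum>j=1..n. A i j) = (\<Sum>i=1..n. (\<Sum>j=1..n. B i j) + (real n - 2) * g i + G)"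
      unfolding sum_distrib_left[of 2] by (intro sum.cong refl) (simp only: sum_distrib_left[symmetric] row)
    also have "\<dots> = (\<Sum>i=1..n. \<Sum>j=1..n. B i j) + (real n - 2) * G + real n * G"
      by (simp add: sum.distrib G_def sum_distrib_left)
    finally show ?thesis by (simp add: algebra_simps)
  qed
  define y where "y = real n - 2"
  have y: "real n = y + 2" "y \<noteq> 0" "y + 1 \<noteq> 0" using n by (auto simp: y_def)
  have "2 * U_centered n A k l = 2 * A k l - 1 / (real n - 2) * (2 * (\<Sum>j=1..n. A k j)) - 1 / (real n - 2) * (2 * (\<Sum>i=1..n. A i l))
     + 1 / ((real n - 1) * (real n - 2)) * (2 * (\<Sum>i=1..n. \<Sum>j=1..n. A i j))"
    using kl(3) by (simp add: U_centered_def algebra_simps)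
  also have "\<dots> = U_centered n B k l"
  proof -
    have *: "b + gk + gl - 0 - 1 / y * (rk + y * gk + G) - 1 / y * (rl + y * gl + G) + 1 / ((y + 1) * y) * (T + 2 * (y + 1) * G)
      = b - 1 / y * rk - 1 / y * rl + 1 / ((y + 1) * y) * T" for b gk gl rk rl T :: real
      using y(2,3) by (simp add: divide_simps) (simp add: algebra_simps)
    have y': "real n - 2 = y" "real n - 1 = y + 1" by (simp_all add: y_def)
    show ?thesis
      unfolding A'[OF kl(1,2)] row[OF kl(1)] col tot U_centered_def y' by (simp only: kl(3) if_False *)
  qed
  finally show ?thesis .
qed

text \<open>An observation has one additive part against the other sample and another one within its
  own, as both the scale and the law of the partner change. Centering removes each of them
  separately, whereas the energy statistic retains the averaged differences.\<close>

lemma statistics_of_expansion: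
  fixes K :: "'a \<Rightarrow> 'a \<Rightarrow> real" and w :: "entry \<Rightarrow> real"
  assumes n: "4 \<le> n" and m: "4 \<le> m"
    and XY: "\<And>k l. k \<in> {1..n} \<Longrightarrow> l \<in> {1..m} \<Longrightarrow> 2 * K (x k) (y l) = w (XY k l) + g k + h l"
    and XX: "\<And>s t. (s, t) \<in> upper_pairs n \<Longrightarrow> 2 * K (x s) (x t) = w (XX s t) + gx s + gx t"
    and YY: "\<And>s t. (s, t) \<in> upper_pairs m \<Longrightarrow> 2 * K (y s) (y t) = w (YY s t) + hy s + hy t"
    and symX: "\<And>s t. s \<in> {1..n} \<Longrightarrow> t \<in> {1..n} \<Longrightarrow> K (x s) (x t) = K (x t) (x s)"
    and symY: "\<And>s t. s \<in> {1..m} \<Longrightarrow> t \<in> {1..m} \<Longrightarrow> K (y s) (y t) = K (y t) (y s)"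
    and diagX: "\<And>s. s \<in> {1..n} \<Longrightarrow> K (x s) (x s) = 0" and diagY: "\<And>s. s \<in> {1..m} \<Longrightarrow> K (y s) (y s) = 0"
  shows "S_stat K n m x y = quad_stat n m w"
    and "energy_stat K n m x y = lin_stat n m w
      + (\<Sum>k=1..n. g k - gx k) / real n + (\<Sum>l=1..m. h l - hy l) / real m"
proof -
  have full: "2 * A i j = (if i = j then 0 else sym_matrix B i j + \<gamma> i + \<gamma> j)"
    if up: "\<And>s t. (s, t) \<in> upper_pairs N \<Longrightarrow> 2 * A s t = B s t + \<gamma> s + \<gamma> t"
      and "\<And>s t. s \<in> {1..N} \<Longrightarrow> t \<in> {1..N} \<Longrightarrow> A s t = A t s" "\<And>s. s \<in> {1..N} \<Longrightarrow> A s s = 0"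
      and "i \<in> {1..N}" "j \<in> {1..N}" for A B :: "nat \<Rightarrow> nat \<Rightarrow> real" and \<gamma> N i j
  proof (cases i j rule: linorder_cases)
    case less
    then show ?thesis using up[of i j] that(4,5) by (simp add: sym_matrix_def upper_pairs_def)
  next
    case equal
    then show ?thesis using that(3)[of j] that(4,5) by simp
  next
    case greater
    then have "2 * A j i = B j i + \<gamma> j + \<gamma> i" using up[of j i] that(4,5) by (simp add: upper_pairs_def)
    then show ?thesis using greater that(2)[OF that(4,5)] by (simp add: sym_matrix_def)
  qed
  \<comment> \<open>Every index belongs to N - 1 pairs, which is the factor of the additive
    part.\<close>
  have offdiag: "(\<Sum>k=1..N. \<Sum>l\<in>{1..N} - {k}. A k l) = (\<Sum>(s, t)\<in>upper_pairs N. B s t) + (real N - 1) * (\<Sum>k=1..N. \<gamma> k)"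
    if up: "\<And>s t. (s, t) \<in> upper_pairs N \<Longrightarrow> 2 * A s t = B s t + \<gamma> s + \<gamma> t"
      and sym: "\<And>s t. s \<in> {1..N} \<Longrightarrow> t \<in> {1..N} \<Longrightarrow> A s t = A t s"
    for A B :: "nat \<Rightarrow> nat \<Rightarrow> real" and \<gamma> N
  proof -
    have "(\<Sum>k=1..N. \<Sum>l\<in>{1..N} - {k}. A k l) = (\<Sum>(s, t)\<in>upper_pairs N. 2 * A s t)"
      using sum_off_diagonal_symmetric[OF sym] by (simp add: sum_distrib_left case_prod_unfold)
    also have "\<dots> = (\<Sum>(s, t)\<in>upper_pairs N. B s t) + (\<Sum>(s, t)\<in>upper_pairs N. \<gamma> s + \<gamma> t)"
      by (subst sum.distrib[symmetric]) (auto intro!: sum.cong simp: up)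
    also have "(\<Sum>(s, t)\<in>upper_pairs N. \<gamma> s + \<gamma> t) = (\<Sum>k=1..N. \<Sum>l\<in>{1..N} - {k}. (\<gamma> k + \<gamma> l)) / 2"
      by (subst sum_off_diagonal_symmetric) auto
    also have "(\<Sum>k=1..N. \<Sum>l\<in>{1..N} - {k}. (\<gamma> k + \<gamma> l)) = (\<Sum>k=1..N. (\<Sum>l=1..N. \<gamma> k + \<gamma> l) - 2 * \<gamma> k)"
      by (intro sum.cong refl) (simp add: sum_diff1)
    also have "\<dots> = 2 * ((real N - 1) * (\<Sum>k=1..N. \<gamma> k))"
    proof -
      have "(\<Sum>k=1..N. (\<Sum>l=1..N. \<gamma> k + \<gamma> l) - 2 * \<gamma> k) = (\<Sum>k=1..N. (real N - 2) * \<gamma> k + (\<Sum>l=1..N. \<gamma> l))"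
        by (intro sum.cong refl) (simp add: sum.distrib algebra_simps)
      also have "\<dots> = (real N - 2) * (\<Sum>k=1..N. \<gamma> k) + real N * (\<Sum>l=1..N. \<gamma> l)"
        by (simp add: sum.distrib sum_distrib_left)
      finally show ?thesis by (simp add: algebra_simps)
    qed
    finally show ?thesis by simp
  qed
  have U: "(\<Sum>k=1..N. \<Sum>l\<in>{1..N} - {k}. (U_centered N A k l)\<^sup>2)
      = (\<Sum>k=1..N. \<Sum>l\<in>{1..N} - {k}. (U_centered N (sym_matrix B) k l)\<^sup>2) / 4"
    if N: "4 \<le> N" and A: "\<And>i j. i \<in> {1..N} \<Longrightarrow> j \<in> {1..N} \<Longrightarrow> 2 * A i j = (if i = j then 0 else sym_matrix B i j + \<gamma> i + \<gamma> j)"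
    for A B :: "nat \<Rightarrow> nat \<Rightarrow> real" and \<gamma> N
  proof -
    have sq: "(U_centered N A k l)\<^sup>2 = (U_centered N (sym_matrix B) k l)\<^sup>2 / 4"
      if "k \<in> {1..N}" "l \<in> {1..N} - {k}" for k l
    proof -
      have "2 * U_centered N A k l = U_centered N (sym_matrix B) k l"
        by (rule U_centered_additive[OF N _ _ _ A]) (use that in auto)
      then have "(2 * U_centered N A k l)\<^sup>2 = (U_centered N (sym_matrix B) k l)\<^sup>2" by (rule arg_cong)
      then show ?thesis by (simp add: power_mult_distrib)
    qed
    show ?thesis unfolding sum_divide_distrib by (intro sum.cong refl sq)
  qed
  have Kh: "(\<Sum>k=1..n. \<Sum>l=1..m. (K_hat K n m x y k l)\<^sup>2)
      = (\<Sum>k=1..n. \<Sum>l=1..m. (K_hat (\<lambda>i j. w (XY i j)) n m (\<lambda>i. i) (\<lambda>j. j) k l)\<^sup>2) / 4"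
  proof -
    have sq: "(K_hat K n m x y k l)\<^sup>2 = (K_hat (\<lambda>i j. w (XY i j)) n m (\<lambda>i. i) (\<lambda>j. j) k l)\<^sup>2 / 4"
      if "k \<in> {1..n}" "l \<in> {1..m}" for k l
    proof -
      have "2 * K_hat K n m x y k l = K_hat (\<lambda>i j. w (XY i j)) n m (\<lambda>i. i) (\<lambda>j. j) k l"
        by (rule K_hat_additive[where g=g and h=h]) (use n m that XY in auto)
      then have "(2 * K_hat K n m x y k l)\<^sup>2 = (K_hat (\<lambda>i j. w (XY i j)) n m (\<lambda>i. i) (\<lambda>j. j) k l)\<^sup>2" by (rule arg_cong)
      then show ?thesis by (simp add: power_mult_distrib)
    qed
    show ?thesis unfolding sum_divide_distrib by (intro sum.cong refl sq)
  qed
  have UX: "(\<Sum>k=1..n. \<Sum>l\<in>{1..n} - {k}. (U_centered n (\<lambda>i j. K (x i) (x j)) k l)\<^sup>2)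
      = (\<Sum>k=1..n. \<Sum>l\<in>{1..n} - {k}. (U_centered n (sym_matrix (\<lambda>i j. w (XX i j))) k l)\<^sup>2) / 4"
    by (rule U[OF n full[where A="\<lambda>i j. K (x i) (x j)" and B="\<lambda>i j. w (XX i j)" and \<gamma>=gx and N=n]])
      (use XX symX diagX in auto)
  have UY: "(\<Sum>k=1..m. \<Sum>l\<in>{1..m} - {k}. (U_centered m (\<lambda>i j. K (y i) (y j)) k l)\<^sup>2)
      = (\<Sum>k=1..m. \<Sum>l\<in>{1..m} - {k}. (U_centered m (sym_matrix (\<lambda>i j. w (YY i j))) k l)\<^sup>2) / 4"
    by (rule U[OF m full[where A="\<lambda>i j. K (y i) (y j)" and B="\<lambda>i j. w (YY i j)" and \<gamma>=hy and N=m]])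
      (use YY symY diagY in auto)
  have c: "4 * (real n - 1) * (real m - 1) * cdCov2 K n m x y = 4 * (\<Sum>k=1..n. \<Sum>l=1..m. (K_hat K n m x y k l)\<^sup>2)"
  proof -
    have "4 * a * b * (1 / (a * b) * S) = 4 * S" if "a \<noteq> 0" "b \<noteq> 0" for a b S :: real
      using that by simp
    moreover have "real n - 1 \<noteq> 0" "real m - 1 \<noteq> 0" using n m by auto
    ultimately show ?thesis unfolding cdCov2_def by (simp only: not_False_eq_True)
  qed
  \<comment> \<open>By \<open>two_v\<close> the quotient of \<open>4 * v N\<close> and
    \<open>N * (N - 3)\<close> is 2, and \<open>4 \<le> N\<close> keeps the denominator
    nonzero.\<close>
  have D: "4 * real (v N) * D2 K N z = 2 * (\<Sum>k=1..N. \<Sum>l\<in>{1..N} - {k}. (U_centered N (\<lambda>i j. K (z i) (z j)) k l)\<^sup>2)"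
    if "4 \<le> N" for N and z :: "nat \<Rightarrow> 'a"
  proof -
    have "4 * real (v N) = 2 * (real N * (real N - 3))" using two_v[of N] that by simp
    moreover have "2 * q * (1 / q * S) = 2 * S" if "q \<noteq> 0" for q S :: real
      using that by simp
    moreover have "real N * (real N - 3) \<noteq> 0" using that by simp
    ultimately show ?thesis unfolding D2_def by (simp only: not_False_eq_True)
  qed
  show "S_stat K n m x y = quad_stat n m w"
    unfolding S_stat_def c D[OF n] D[OF m] Kh UX UY quad_stat_def
    using n m by (simp add: of_nat_diff)
  have XYsum: "2 * (\<Sum>k=1..n. \<Sum>l=1..m. K (x k) (y l))
      = (\<Sum>k=1..n. \<Sum>l=1..m. w (XY k l)) + real m * (\<Sum>k=1..n. g k) + real n * (\<Sum>l=1..m. h l)"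
  proof -
    have "2 * (\<Sum>k=1..n. \<Sum>l=1..m. K (x k) (y l)) = (\<Sum>k=1..n. \<Sum>l=1..m. 2 * K (x k) (y l))"
      by (simp add: sum_distrib_left)
    also have "\<dots> = (\<Sum>k=1..n. \<Sum>l=1..m. w (XY k l) + g k + h l)"
      by (intro sum.cong refl) (simp add: XY)
    finally show ?thesis by (simp add: sum.distrib sum_distrib_left)
  qed
  have lin: "lin_stat n m w = (\<Sum>k=1..n. \<Sum>l=1..m. w (XY k l)) / (real n * real m)
     - (\<Sum>(s, t)\<in>upper_pairs n. w (XX s t)) / (real n * (real n - 1))
     - (\<Sum>(s, t)\<in>upper_pairs m. w (YY s t)) / (real m * (real m - 1))"
    unfolding lin_stat_def sum_entries
    by (simp add: by_block_def sum.cartesian_product case_prod_unfold sum_negf sum_divide_distrib)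
  have nz: "real n \<noteq> 0" "real m \<noteq> 0" "real n - 1 \<noteq> 0" "real m - 1 \<noteq> 0" using n m by auto
  have "energy_stat K n m x y = (2 * (\<Sum>k=1..n. \<Sum>l=1..m. K (x k) (y l))) / (real n * real m)
     - (\<Sum>k=1..n. \<Sum>l\<in>{1..n} - {k}. K (x k) (x l)) / (real n * (real n - 1))
     - (\<Sum>k=1..m. \<Sum>l\<in>{1..m} - {k}. K (y k) (y l)) / (real m * (real m - 1))"
    by (simp add: energy_stat_def)
  also have "(\<Sum>k=1..n. \<Sum>l\<in>{1..n} - {k}. K (x k) (x l)) = (\<Sum>(s, t)\<in>upper_pairs n. w (XX s t)) + (real n - 1) * (\<Sum>k=1..n. gx k)"
    by (rule offdiag[where B="\<lambda>i j. w (XX i j)" and \<gamma>=gx]) (use XX symX in auto)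
  also have "(\<Sum>k=1..m. \<Sum>l\<in>{1..m} - {k}. K (y k) (y l)) = (\<Sum>(s, t)\<in>upper_pairs m. w (YY s t)) + (real m - 1) * (\<Sum>k=1..m. hy k)"
    by (rule offdiag[where B="\<lambda>i j. w (YY i j)" and \<gamma>=hy]) (use YY symY in auto)
  finally show "energy_stat K n m x y = lin_stat n m w
      + (\<Sum>k=1..n. g k - gx k) / real n + (\<Sum>l=1..m. h l - hy l) / real m"
    unfolding XYsum lin using nz by (simp add: sum_subtractf add_divide_distrib diff_divide_distrib)
qed

section \<open>Double-centered distances of independent pairs\<close>

text \<open>Common ground of the two cases: the squared Euclidean distance is not a metric, but
  shares with one the symmetry, the nonnegativity and the zero diagonal.\<close>

lemma ground_distance_props:
  assumes "case_S1 k r \<or> case_S2 k r"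
  shows ground_distance_measurable: "(\<lambda>(x, y). r x y) \<in> borel_measurable (group_space k \<Otimes>\<^sub>M group_space k)"
    and ground_distance_nonneg: "x \<in> space (group_space k) \<Longrightarrow> y \<in> space (group_space k) \<Longrightarrow> 0 \<le> r x y"
    and ground_distance_sym: "x \<in> space (group_space k) \<Longrightarrow> y \<in> space (group_space k) \<Longrightarrow> r x y = r y x"
    and ground_distance_diag: "x \<in> space (group_space k) \<Longrightarrow> r x x = 0"
proof -
  have "(\<lambda>(x, y). r x y) \<in> borel_measurable (group_space k \<Otimes>\<^sub>M group_space k)
     \<and> (\<forall>x\<in>space (group_space k). \<forall>y\<in>space (group_space k). 0 \<le> r x y \<and> r x y = r y x)
     \<and> (\<forall>x\<in>space (group_space k). r x x = 0)"
    using assms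
  proof
    assume S1: "case_S1 k r"
    then interpret Metric_space "space (group_space k)" r by (simp add: case_S1_def)
    show ?thesis using S1 by (auto simp: case_S1_def commute)
  next
    assume S2: "case_S2 k r"
    have [measurable]: "(\<lambda>x. x j) \<in> borel_measurable (group_space k)" if "j \<in> {1..k}" for j
      using that by (simp add: group_space_def)
    have "(\<lambda>z. \<Sum>j=1..k. (fst z j - snd z j)\<^sup>2) \<in> borel_measurable (group_space k \<Otimes>\<^sub>M group_space k)"
      by (intro borel_measurable_sum borel_measurable_power borel_measurable_diff
          measurable_compose[OF measurable_fst] measurable_compose[OF measurable_snd]) auto
    also have "?this \<longleftrightarrow> (\<lambda>(x, y). r x y) \<in> borel_measurable (group_space k \<Otimes>\<^sub>M group_space k)"
      using S2 by (intro measurable_cong) (auto simp: case_S2_def space_pair_measure)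
    finally show ?thesis
      using S2 by (auto simp: case_S2_def power2_commute intro: sum_nonneg)
  qed
  then show "(\<lambda>(x, y). r x y) \<in> borel_measurable (group_space k \<Otimes>\<^sub>M group_space k)"
    "x \<in> space (group_space k) \<Longrightarrow> y \<in> space (group_space k) \<Longrightarrow> 0 \<le> r x y"
    "x \<in> space (group_space k) \<Longrightarrow> y \<in> space (group_space k) \<Longrightarrow> r x y = r y x"
    "x \<in> space (group_space k) \<Longrightarrow> r x x = 0"
    by blast+
qed

section \<open>Conditional expectations and double centering for independent vectors\<close>

context prob_space
begin

lemma vimage_subalgebra:
  assumes U: "U \<in> measurable M N"
  shows "finite_measure_subalgebra M (vimage_algebra (space M) U N)"
proof
  show "subalgebra M (vimage_algebra (space M) U N)"
    using measurable_space[OF U] measurable_sets[OF U]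
    by (auto simp: subalgebra_def sets_vimage_algebra2 Pi_iff)
qed

lemma cond_exp_given_measurable:
  assumes U: "U \<in> measurable M N"
  shows "cond_exp_given M N U f \<in> borel_measurable M"
  unfolding cond_exp_given_def by (rule borel_measurable_cond_exp2)

text \<open>Conditioning on one of two independent elements amounts to integrating out the other.
  Every event of the generated sigma-algebra is a preimage, so its indicator is a function of the
  conditioning element and Fubini's theorem applies.\<close>

lemma cond_exp_given_indep:
  fixes f :: "'b \<times> 'c \<Rightarrow> real"
  assumes U[measurable]: "U \<in> measurable M N1" and W[measurable]: "W \<in> measurable M N2"
    and law: "distr M (N1 \<Otimes>\<^sub>M N2) (\<lambda>\<omega>. (U \<omega>, W \<omega>)) = distr M N1 U \<Otimes>\<^sub>M distr M N2 W"
    and f[measurable]: "f \<in> borel_measurable (N1 \<Otimes>\<^sub>M N2)"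
    and int: "integrable M (\<lambda>\<omega>. f (U \<omega>, W \<omega>))"
  shows "AE \<omega> in M. cond_exp_given M N1 U (\<lambda>\<omega>. f (U \<omega>, W \<omega>)) \<omega> = (\<integral>y. f (U \<omega>, y) \<partial>distr M N2 W)"
    and "AE \<omega> in M. cond_exp_given M N2 W (\<lambda>\<omega>. f (U \<omega>, W \<omega>)) \<omega> = (\<integral>x. f (x, W \<omega>) \<partial>distr M N1 U)"
proof -
  let ?D1 = "distr M N1 U" and ?D2 = "distr M N2 W"
  interpret D1: prob_space ?D1 by (rule prob_space_distr) simp
  interpret D2: prob_space ?D2 by (rule prob_space_distr) simp
  interpret pair_sigma_finite ?D1 ?D2 ..
  have int_D: "integrable (?D1 \<Otimes>\<^sub>M ?D2) f"
    unfolding law[symmetric] using int by (subst integrable_distr_eq) auto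
  have joint: "(\<integral>\<omega>. g (U \<omega>, W \<omega>) \<partial>M) = (\<integral>z. g z \<partial>(?D1 \<Otimes>\<^sub>M ?D2))"
    if "g \<in> borel_measurable (N1 \<Otimes>\<^sub>M N2)" for g :: "'b \<times> 'c \<Rightarrow> real"
    unfolding law[symmetric] using that by (subst integral_distr) auto
  show "AE \<omega> in M. cond_exp_given M N1 U (\<lambda>\<omega>. f (U \<omega>, W \<omega>)) \<omega> = (\<integral>y. f (U \<omega>, y) \<partial>?D2)"
    unfolding cond_exp_given_def
  proof -
    let ?F = "vimage_algebra (space M) U N1"
    interpret F: finite_measure_subalgebra M ?F by (rule vimage_subalgebra[OF U])
    define g where "g x = (\<integral>y. f (x, y) \<partial>?D2)" for x
    have g[measurable]: "g \<in> borel_measurable N1"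
      unfolding g_def by (rule D2.borel_measurable_lebesgue_integral) simp
    have int_g: "integrable M (\<lambda>\<omega>. g (U \<omega>))"
      using integrable_fst'[OF int_D] by (simp add: integrable_distr_eq g_def)
    show "AE \<omega> in M. real_cond_exp M ?F (\<lambda>\<omega>. f (U \<omega>, W \<omega>)) \<omega> = (\<integral>y. f (U \<omega>, y) \<partial>?D2)"
      unfolding g_def[symmetric]
    proof (rule F.real_cond_exp_charact[OF _ int int_g])
      have "U \<in> measurable ?F N1"
        using measurable_space[OF U] by (intro measurable_vimage_algebra1) auto
      then show "(\<lambda>\<omega>. g (U \<omega>)) \<in> borel_measurable ?F" by (rule measurable_compose) simp
      fix A assume "A \<in> sets ?F"
      then obtain B where B[measurable]: "B \<in> sets N1" and A: "A = U -` B \<inter> space M"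
        using measurable_space[OF U] by (auto simp: sets_vimage_algebra2 Pi_iff)
      have ind: "indicator A \<omega> = (indicator B (U \<omega>) :: real)" if "\<omega> \<in> space M" for \<omega>
        using that by (auto simp: A indicator_def)
      have "(\<integral>\<omega>\<in>A. f (U \<omega>, W \<omega>) \<partial>M) = (\<integral>\<omega>. (\<lambda>z. indicator B (fst z) * f z) (U \<omega>, W \<omega>) \<partial>M)"
        unfolding set_lebesgue_integral_def by (intro Bochner_Integration.integral_cong) (auto simp: ind)
      also have "\<dots> = (\<integral>z. indicator B (fst z) * f z \<partial>(?D1 \<Otimes>\<^sub>M ?D2))"
        by (rule joint) measurable
      also have "\<dots> = (\<integral>x. \<integral>y. indicator B x * f (x, y) \<partial>?D2 \<partial>?D1)"
      proof (subst integral_fst'[symmetric])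
        show "integrable (?D1 \<Otimes>\<^sub>M ?D2) (\<lambda>z. indicator B (fst z) * f z)"
          by (rule Bochner_Integration.integrable_bound[OF int_D]) (auto simp: indicator_def)
      qed simp
      also have "\<dots> = (\<integral>x. indicator B x * g x \<partial>?D1)"
        by (simp add: g_def)
      also have "\<dots> = (\<integral>\<omega>. indicator B (U \<omega>) * g (U \<omega>) \<partial>M)"
        by (subst integral_distr) auto
      also have "\<dots> = (\<integral>\<omega>\<in>A. g (U \<omega>) \<partial>M)"
        unfolding set_lebesgue_integral_def by (intro Bochner_Integration.integral_cong) (auto simp: ind)
      finally show "(\<integral>\<omega>\<in>A. f (U \<omega>, W \<omega>) \<partial>M) = (\<integral>\<omega>\<in>A. g (U \<omega>) \<partial>M)" .
    qed
  qed
  show "AE \<omega> in M. cond_exp_given M N2 W (\<lambda>\<omega>. f (U \<omega>, W \<omega>)) \<omega> = (\<integral>x. f (x, W \<omega>) \<partial>?D1)"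
    unfolding cond_exp_given_def
  proof -
    let ?F = "vimage_algebra (space M) W N2"
    interpret F: finite_measure_subalgebra M ?F by (rule vimage_subalgebra[OF W])
    define g where "g y = (\<integral>x. f (x, y) \<partial>?D1)" for y
    have g[measurable]: "g \<in> borel_measurable N2"
      unfolding g_def by (rule D1.borel_measurable_lebesgue_integral) simp
    have int_g: "integrable M (\<lambda>\<omega>. g (W \<omega>))"
    proof -
      have "integrable (?D1 \<Otimes>\<^sub>M ?D2) (case_prod (\<lambda>x y. f (x, y)))" using int_D by simp
      from integrable_snd[OF this] show ?thesis by (simp add: integrable_distr_eq g_def)
    qed
    show "AE \<omega> in M. real_cond_exp M ?F (\<lambda>\<omega>. f (U \<omega>, W \<omega>)) \<omega> = (\<integral>x. f (x, W \<omega>) \<partial>?D1)"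
      unfolding g_def[symmetric]
    proof (rule F.real_cond_exp_charact[OF _ int int_g])
      have "W \<in> measurable ?F N2"
        using measurable_space[OF W] by (intro measurable_vimage_algebra1) auto
      then show "(\<lambda>\<omega>. g (W \<omega>)) \<in> borel_measurable ?F" by (rule measurable_compose) simp
      fix A assume "A \<in> sets ?F"
      then obtain B where B[measurable]: "B \<in> sets N2" and A: "A = W -` B \<inter> space M"
        using measurable_space[OF W] by (auto simp: sets_vimage_algebra2 Pi_iff)
      have ind: "indicator A \<omega> = (indicator B (W \<omega>) :: real)" if "\<omega> \<in> space M" for \<omega>
        using that by (auto simp: A indicator_def)
      have "(\<integral>\<omega>\<in>A. f (U \<omega>, W \<omega>) \<partial>M) = (\<integral>\<omega>. (\<lambda>z. indicator B (snd z) * f z) (U \<omega>, W \<omega>) \<partial>M)"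
        unfolding set_lebesgue_integral_def by (intro Bochner_Integration.integral_cong) (auto simp: ind)
      also have "\<dots> = (\<integral>z. indicator B (snd z) * f z \<partial>(?D1 \<Otimes>\<^sub>M ?D2))"
        by (rule joint) measurable
      also have "\<dots> = (\<integral>(x, y). indicator B y * f (x, y) \<partial>(?D1 \<Otimes>\<^sub>M ?D2))"
        by (simp add: case_prod_unfold)
      also have "\<dots> = (\<integral>y. \<integral>x. indicator B y * f (x, y) \<partial>?D1 \<partial>?D2)"
      proof (subst integral_snd[symmetric])
        show "integrable (?D1 \<Otimes>\<^sub>M ?D2) (\<lambda>(x, y). indicator B y * f (x, y))"
          by (rule Bochner_Integration.integrable_bound[OF int_D]) (auto simp: indicator_def)
      qed simp
      also have "\<dots> = (\<integral>y. indicator B y * g y \<partial>?D2)"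
        by (simp add: g_def)
      also have "\<dots> = (\<integral>\<omega>. indicator B (W \<omega>) * g (W \<omega>) \<partial>M)"
        by (subst integral_distr) auto
      also have "\<dots> = (\<integral>\<omega>\<in>A. g (W \<omega>) \<partial>M)"
        unfolding set_lebesgue_integral_def by (intro Bochner_Integration.integral_cong) (auto simp: ind)
      finally show "(\<integral>\<omega>\<in>A. f (U \<omega>, W \<omega>) \<partial>M) = (\<integral>\<omega>\<in>A. g (W \<omega>) \<partial>M)" .
    qed
  qed
qed

end

text \<open>Agrees with the square of \<open>dist_K\<close> on the data space, where the ground
  distances are nonnegative.\<close>

definition dist_K2 :: "nat \<Rightarrow> (nat \<Rightarrow> point \<Rightarrow> point \<Rightarrow> real) \<Rightarrow> data \<Rightarrow> data \<Rightarrow> real" where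
  "dist_K2 p \<rho> x y = (\<Sum>i=1..p. \<rho> i (x i) (y i))"

text \<open>The conditional expectation of the squared distance given one argument, if the other has
  law \<open>Q\<close>. The sum stands outside the integral, to match the group-wise double
  centering in \<open>H\<close>.\<close>

definition mean_dist :: "nat \<Rightarrow> (nat \<Rightarrow> point \<Rightarrow> point \<Rightarrow> real) \<Rightarrow> data measure \<Rightarrow> data \<Rightarrow> real" where
  "mean_dist p \<rho> Q x = (\<Sum>i=1..p. \<integral>y. \<rho> i (x i) (y i) \<partial>Q)"

locale ground_distances =
  fixes p :: nat and d :: "nat \<Rightarrow> nat" and \<rho> :: "nat \<Rightarrow> point \<Rightarrow> point \<Rightarrow> real"
  assumes ground: "\<And>i. i \<in> {1..p} \<Longrightarrow> case_S1 (d i) (\<rho> i) \<or> case_S2 (d i) (\<rho> i)"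
begin

abbreviation "N \<equiv> data_space p d"

lemma component_measurable[measurable]: "i \<in> {1..p} \<Longrightarrow> (\<lambda>x. x i) \<in> measurable N (group_space (d i))"
  by (simp add: data_space_def)

lemma \<rho>_measurable:
  assumes i: "i \<in> {1..p}"
  shows "(\<lambda>z. \<rho> i (fst z i) (snd z i)) \<in> borel_measurable (N \<Otimes>\<^sub>M N)"
proof -
  have "(\<lambda>z. (fst z i, snd z i)) \<in> measurable (N \<Otimes>\<^sub>M N) (group_space (d i) \<Otimes>\<^sub>M group_space (d i))"
    using component_measurable[OF i] by measurable
  from measurable_compose[OF this ground_distance_measurable[OF ground[OF i]]]
  show ?thesis by (simp add: case_prod_unfold)
qed

lemma dist_K2_measurable: "(\<lambda>z. dist_K2 p \<rho> (fst z) (snd z)) \<in> borel_measurable (N \<Otimes>\<^sub>M N)"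
  unfolding dist_K2_def by (intro borel_measurable_sum \<rho>_measurable)

lemma dist_K_eq: "dist_K p \<rho> x y = sqrt (dist_K2 p \<rho> x y)"
  by (simp add: dist_K_def dist_K2_def)

lemma dist_K_measurable: "(\<lambda>z. dist_K p \<rho> (fst z) (snd z)) \<in> borel_measurable (N \<Otimes>\<^sub>M N)"
  unfolding dist_K_eq using dist_K2_measurable by measurable

lemma space_component: "x \<in> space N \<Longrightarrow> i \<in> {1..p} \<Longrightarrow> x i \<in> space (group_space (d i))"
  using measurable_space[OF component_measurable] by auto

lemma dist_K2_nonneg: "x \<in> space N \<Longrightarrow> y \<in> space N \<Longrightarrow> 0 \<le> dist_K2 p \<rho> x y"
  unfolding dist_K2_def by (intro sum_nonneg ground_distance_nonneg[OF ground] space_component)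

lemma dist_K2_sym: "x \<in> space N \<Longrightarrow> y \<in> space N \<Longrightarrow> dist_K2 p \<rho> x y = dist_K2 p \<rho> y x"
  unfolding dist_K2_def by (intro sum.cong refl ground_distance_sym[OF ground] space_component)

lemma dist_K_diag: "x \<in> space N \<Longrightarrow> dist_K p \<rho> x x = 0"
  unfolding dist_K_def by (simp add: ground_distance_diag[OF ground] space_component)

lemma dist_K_square: "x \<in> space N \<Longrightarrow> y \<in> space N \<Longrightarrow> (dist_K p \<rho> x y)\<^sup>2 = dist_K2 p \<rho> x y"
  by (simp add: dist_K_eq dist_K2_nonneg)

lemma mean_dist_measurable:
  assumes "prob_space Q" "sets Q = sets N"
  shows "mean_dist p \<rho> Q \<in> borel_measurable N"
  unfolding mean_dist_def
proof (intro borel_measurable_sum)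
  fix i assume i: "i \<in> {1..p}"
  interpret Q: prob_space Q by fact
  note [measurable_cong] = assms(2)
  note [measurable] = \<rho>_measurable[OF i]
  have "(\<lambda>x. \<integral>y. (\<lambda>z. \<rho> i (fst z i) (snd z i)) (x, y) \<partial>Q) \<in> borel_measurable N"
    by (rule Q.borel_measurable_lebesgue_integral) simp
  then show "(\<lambda>x. \<integral>y. \<rho> i (x i) (y i) \<partial>Q) \<in> borel_measurable N" by simp
qed

text \<open>By symmetry of the ground distances one function serves for integrating out either
  argument.\<close>

lemma mean_dist_swap:
  assumes "y \<in> space N" "sets Q = sets N"
  shows "(\<Sum>i=1..p. \<integral>x. \<rho> i (x i) (y i) \<partial>Q) = mean_dist p \<rho> Q y"
  unfolding mean_dist_def using assms sets_eq_imp_space_eq[OF assms(2)]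
  by (intro sum.cong refl Bochner_Integration.integral_cong ground_distance_sym[OF ground] space_component) auto

end

text \<open>Independence is a product law here, so that the population pairs and all pairs of sample
  points are instances of the same notion.\<close>

locale indep_pair = ground_distances p d \<rho> + prob_space M
  for p d \<rho> and M :: "'w measure" +
  fixes U W :: "'w \<Rightarrow> data"
  assumes U[measurable]: "U \<in> measurable M (data_space p d)"
    and W[measurable]: "W \<in> measurable M (data_space p d)"
    and law: "distr M (N \<Otimes>\<^sub>M N) (\<lambda>\<omega>. (U \<omega>, W \<omega>)) = distr M N U \<Otimes>\<^sub>M distr M N W"
    and int_\<rho>: "\<And>i. i \<in> {1..p} \<Longrightarrow> integrable M (\<lambda>\<omega>. \<rho> i (U \<omega> i) (W \<omega> i))"
begin

lemma integrable_K2: "integrable M (\<lambda>\<omega>. dist_K2 p \<rho> (U \<omega>) (W \<omega>))"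
  unfolding dist_K2_def by (intro Bochner_Integration.integrable_sum int_\<rho>)

lemma integral_K2: "(\<integral>\<omega>. dist_K2 p \<rho> (U \<omega>) (W \<omega>) \<partial>M) = (\<Sum>i=1..p. \<integral>\<omega>. \<rho> i (U \<omega> i) (W \<omega> i) \<partial>M)"
  unfolding dist_K2_def by (intro Bochner_Integration.integral_sum int_\<rho>)

lemma integral_dist_K_square:
  "(\<integral>\<omega>. (dist_K p \<rho> (U \<omega>) (W \<omega>))\<^sup>2 \<partial>M) = (\<integral>\<omega>. dist_K2 p \<rho> (U \<omega>) (W \<omega>) \<partial>M)"
  using measurable_space[OF U] measurable_space[OF W]
  by (intro Bochner_Integration.integral_cong refl dist_K_square) auto

lemma tau_nonneg: "0 \<le> tau M (dist_K p \<rho>) U W"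
  unfolding tau_def by (intro real_sqrt_ge_zero Bochner_Integration.integral_nonneg) simp

lemma tau_square: "(tau M (dist_K p \<rho>) U W)\<^sup>2 = (\<integral>\<omega>. dist_K2 p \<rho> (U \<omega>) (W \<omega>) \<partial>M)"
  unfolding tau_def integral_dist_K_square
  by (rule real_sqrt_pow2) (use measurable_space[OF U] measurable_space[OF W] in \<open>auto intro!: integral_nonneg_AE dist_K2_nonneg\<close>)

lemma cond_exp_K2:
  shows "AE \<omega> in M. cond_exp_given M N U (\<lambda>\<omega>. dist_K2 p \<rho> (U \<omega>) (W \<omega>)) \<omega> = mean_dist p \<rho> (distr M N W) (U \<omega>)"
    and "AE \<omega> in M. cond_exp_given M N W (\<lambda>\<omega>. dist_K2 p \<rho> (U \<omega>) (W \<omega>)) \<omega> = mean_dist p \<rho> (distr M N U) (W \<omega>)"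
proof -
  \<comment> \<open>Extended by 0 outside \<open>{1..p}\<close>, because the rule for the
    conditional expectation of a sum asks for integrability at every index.\<close>
  define f where "f i \<omega> = (if i \<in> {1..p} then \<rho> i (U \<omega> i) (W \<omega> i) else 0)" for i \<omega>
  have int_f: "integrable M (f i)" for i
    unfolding f_def using int_\<rho> by (cases "i \<in> {1..p}") auto
  have K2: "(\<lambda>\<omega>. dist_K2 p \<rho> (U \<omega>) (W \<omega>)) = (\<lambda>\<omega>. \<Sum>i\<in>{1..p}. f i \<omega>)"
    unfolding dist_K2_def f_def by (intro ext sum.cong) auto
  have one: "AE \<omega> in M. cond_exp_given M N U (f i) \<omega> = (\<integral>y. \<rho> i (U \<omega> i) (y i) \<partial>distr M N W)"
    "AE \<omega> in M. cond_exp_given M N W (f i) \<omega> = (\<integral>x. \<rho> i (x i) (W \<omega> i) \<partial>distr M N U)" if i: "i \<in> {1..p}" for i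
    using cond_exp_given_indep[OF U W law \<rho>_measurable[OF i]] int_\<rho>[OF i] i by (simp_all add: f_def[abs_def])
  show "AE \<omega> in M. cond_exp_given M N U (\<lambda>\<omega>. dist_K2 p \<rho> (U \<omega>) (W \<omega>)) \<omega> = mean_dist p \<rho> (distr M N W) (U \<omega>)"
  proof -
    interpret F: finite_measure_subalgebra M "vimage_algebra (space M) U N" by (rule vimage_subalgebra[OF U])
    have "AE \<omega> in M. \<forall>i\<in>{1..p}. cond_exp_given M N U (f i) \<omega> = (\<integral>y. \<rho> i (U \<omega> i) (y i) \<partial>distr M N W)"
      using one(1) by (intro AE_finite_allI) auto
    moreover have "AE \<omega> in M. real_cond_exp M (vimage_algebra (space M) U N) (\<lambda>\<omega>. \<Sum>i\<in>{1..p}. f i \<omega>) \<omega>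
        = (\<Sum>i\<in>{1..p}. real_cond_exp M (vimage_algebra (space M) U N) (f i) \<omega>)"
      by (rule F.real_cond_exp_sum[OF int_f])
    ultimately show ?thesis
      unfolding K2 by eventually_elim (simp add: cond_exp_given_def mean_dist_def)
  qed
  show "AE \<omega> in M. cond_exp_given M N W (\<lambda>\<omega>. dist_K2 p \<rho> (U \<omega>) (W \<omega>)) \<omega> = mean_dist p \<rho> (distr M N U) (W \<omega>)"
  proof -
    interpret F: finite_measure_subalgebra M "vimage_algebra (space M) W N" by (rule vimage_subalgebra[OF W])
    have "AE \<omega> in M. \<forall>i\<in>{1..p}. cond_exp_given M N W (f i) \<omega> = (\<integral>x. \<rho> i (x i) (W \<omega> i) \<partial>distr M N U)"
      using one(2) by (intro AE_finite_allI) auto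
    moreover have "AE \<omega> in M. real_cond_exp M (vimage_algebra (space M) W N) (\<lambda>\<omega>. \<Sum>i\<in>{1..p}. f i \<omega>) \<omega>
        = (\<Sum>i\<in>{1..p}. real_cond_exp M (vimage_algebra (space M) W N) (f i) \<omega>)"
      by (rule F.real_cond_exp_sum[OF int_f])
    ultimately show ?thesis using AE_space
    proof eventually_elim
      case (elim \<omega>)
      from elim(1,2) have "cond_exp_given M N W (\<lambda>\<omega>. dist_K2 p \<rho> (U \<omega>) (W \<omega>)) \<omega> = (\<Sum>i=1..p. \<integral>x. \<rho> i (x i) (W \<omega> i) \<partial>distr M N U)"
        by (simp add: cond_exp_given_def K2)
      then show ?case using measurable_space[OF W elim(3)] by (simp add: mean_dist_swap)
    qed
  qed
qed

text \<open>\<open>double_centered\<close> conditions on a single group, whereas (iv) conditions on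
  the whole vector. Under independence both lead to the same partial integrals, and it is this that
  ties \<open>H\<close> to assumption (iv).\<close>

lemma sum_double_centered:
  "AE \<omega> in M. (\<Sum>i=1..p. double_centered M (group_space (d i)) (\<rho> i) (\<lambda>w. U w i) (\<lambda>w. W w i) \<omega>)
     = dist_K2 p \<rho> (U \<omega>) (W \<omega>) - mean_dist p \<rho> (distr M N W) (U \<omega>) - mean_dist p \<rho> (distr M N U) (W \<omega>)
       + (tau M (dist_K p \<rho>) U W)\<^sup>2"
proof -
  have one: "AE \<omega> in M. double_centered M (group_space (d i)) (\<rho> i) (\<lambda>w. U w i) (\<lambda>w. W w i) \<omega>
      = \<rho> i (U \<omega> i) (W \<omega> i) - (\<integral>y. \<rho> i (U \<omega> i) (y i) \<partial>distr M N W) - (\<integral>x. \<rho> i (x i) (W \<omega> i) \<partial>distr M N U)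
        + (\<integral>w. \<rho> i (U w i) (W w i) \<partial>M)" if i: "i \<in> {1..p}" for i
  proof -
    let ?G = "group_space (d i)"
    note [measurable] = component_measurable[OF i]
    have \<rho>_m: "(\<lambda>z. \<rho> i (fst z) (snd z)) \<in> borel_measurable (?G \<Otimes>\<^sub>M ?G)"
      using ground_distance_measurable[OF ground[OF i]] by (simp add: case_prod_unfold)
    have Ui: "(\<lambda>w. U w i) \<in> measurable M ?G" and Wi: "(\<lambda>w. W w i) \<in> measurable M ?G" by measurable
    \<comment> \<open>The group laws are images of the vector laws, so mapping the product law under
      the projections to group \<open>i\<close> makes the two groups independent.\<close>
    have dU: "distr M ?G (\<lambda>w. U w i) = distr (distr M N U) ?G (\<lambda>x. x i)"
      and dW: "distr M ?G (\<lambda>w. W w i) = distr (distr M N W) ?G (\<lambda>x. x i)"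
      by (simp_all add: distr_distr comp_def)
    interpret D: prob_space "distr (distr M N W) ?G (\<lambda>x. x i)"
      unfolding dW[symmetric] by (rule prob_space_distr) simp
    have "distr M ?G (\<lambda>w. U w i) \<Otimes>\<^sub>M distr M ?G (\<lambda>w. W w i)
      = distr (distr M N U \<Otimes>\<^sub>M distr M N W) (?G \<Otimes>\<^sub>M ?G) (\<lambda>(x, y). (x i, y i))"
      unfolding dU dW by (rule pair_measure_distr) (auto intro: D.sigma_finite_measure_axioms)
    also have "\<dots> = distr M (?G \<Otimes>\<^sub>M ?G) (\<lambda>w. (U w i, W w i))"
      unfolding law[symmetric] by (subst distr_distr) (auto simp: comp_def)
    finally have law_i: "distr M (?G \<Otimes>\<^sub>M ?G) (\<lambda>w. (U w i, W w i)) = distr M ?G (\<lambda>w. U w i) \<Otimes>\<^sub>M distr M ?G (\<lambda>w. W w i)" ..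
    have int_i: "integrable M (\<lambda>w. (\<lambda>z. \<rho> i (fst z) (snd z)) (U w i, W w i))" using int_\<rho>[OF i] by simp
    from cond_exp_given_indep[OF Ui Wi law_i \<rho>_m int_i] AE_space
    show ?thesis
    proof eventually_elim
      case (elim \<omega>)
      have x: "U \<omega> i \<in> space ?G" "W \<omega> i \<in> space ?G"
        using measurable_space[OF Ui elim(3)] measurable_space[OF Wi elim(3)] by auto
      have \<rho>_sec: "(\<lambda>y. \<rho> i x y) \<in> borel_measurable ?G" "(\<lambda>y. \<rho> i y x) \<in> borel_measurable ?G" if "x \<in> space ?G" for x
        using measurable_compose[OF measurable_Pair1'[OF that] \<rho>_m] measurable_compose[OF measurable_Pair2'[OF that] \<rho>_m] by simp_all
      show ?case
        using elim(1,2) x \<rho>_sec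
        by (simp add: double_centered_def dU dW integral_distr)
    qed
  qed
  have "AE \<omega> in M. \<forall>i\<in>{1..p}. double_centered M (group_space (d i)) (\<rho> i) (\<lambda>w. U w i) (\<lambda>w. W w i) \<omega>
      = \<rho> i (U \<omega> i) (W \<omega> i) - (\<integral>y. \<rho> i (U \<omega> i) (y i) \<partial>distr M N W) - (\<integral>x. \<rho> i (x i) (W \<omega> i) \<partial>distr M N U)
        + (\<integral>w. \<rho> i (U w i) (W w i) \<partial>M)"
    using one by (intro AE_finite_allI) auto
  with AE_space show ?thesis
  proof eventually_elim
    case (elim \<omega>)
    have "(\<Sum>i=1..p. double_centered M (group_space (d i)) (\<rho> i) (\<lambda>w. U w i) (\<lambda>w. W w i) \<omega>)
      = dist_K2 p \<rho> (U \<omega>) (W \<omega>) - mean_dist p \<rho> (distr M N W) (U \<omega>) - (\<Sum>i=1..p. \<integral>x. \<rho> i (x i) (W \<omega> i) \<partial>distr M N U)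
        + (\<Sum>i=1..p. \<integral>w. \<rho> i (U w i) (W w i) \<partial>M)"
      using elim(2) by (simp add: sum.distrib sum_subtractf dist_K2_def mean_dist_def)
    then show ?case
      using measurable_space[OF W elim(1)] by (simp add: mean_dist_swap tau_square integral_K2)
  qed
qed

lemma H_eq:
  assumes pos: "0 < tau M (dist_K p \<rho>) U W"
  shows "AE \<omega> in M. H M p d \<rho> (tau M (dist_K p \<rho>) U W) U W \<omega>
    = (dist_K2 p \<rho> (U \<omega>) (W \<omega>) - mean_dist p \<rho> (distr M N W) (U \<omega>) - mean_dist p \<rho> (distr M N U) (W \<omega>))
       / tau M (dist_K p \<rho>) U W + tau M (dist_K p \<rho>) U W"
  using sum_double_centered
proof eventually_elim
  case (elim \<omega>)
  then show ?case unfolding H_def elim using pos by (simp add: add_divide_distrib power2_eq_square)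
qed

lemma H_measurable: "H M p d \<rho> t U W \<in> borel_measurable M"
proof -
  have "(\<lambda>\<omega>. \<rho> i (U \<omega> i) (W \<omega> i)) \<in> borel_measurable M" if "i \<in> {1..p}" for i
    using int_\<rho>[OF that] by (rule borel_measurable_integrable)
  moreover have "(\<lambda>w. U w i) \<in> measurable M (group_space (d i))" "(\<lambda>w. W w i) \<in> measurable M (group_space (d i))" if "i \<in> {1..p}" for i
    using measurable_compose[OF U component_measurable[OF that]] measurable_compose[OF W component_measurable[OF that]] by auto
  ultimately show ?thesis
    unfolding H_def[abs_def] double_centered_def
    by (intro borel_measurable_times borel_measurable_sum borel_measurable_add borel_measurable_diff borel_measurable_const
        cond_exp_given_measurable) auto
qed

lemma L_eq: "\<omega> \<in> space M \<Longrightarrow> L M (dist_K p \<rho>) U W \<omega>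
    = (dist_K2 p \<rho> (U \<omega>) (W \<omega>) - (tau M (dist_K p \<rho>) U W)\<^sup>2) / (tau M (dist_K p \<rho>) U W)\<^sup>2"
  using measurable_space[OF U] measurable_space[OF W] by (simp add: L_def dist_K_square)

end

section \<open>Remainder estimate and transfer from the population to the samples\<close>

text \<open>With s the root of \<open>k\<close> the error is exactly minus the square of s - t
  divided by t, and s + t is at least t. The bound therefore holds for every nonnegative
  \<open>k\<close>, without any smallness of \<open>L\<close>.\<close>

lemma sqrt_expansion:
  fixes t k :: real
  assumes t: "0 < t" and k: "0 \<le> k"
  shows "\<bar>2 * sqrt k - 2 * t - (k - t\<^sup>2) / t\<bar> \<le> t * ((k - t\<^sup>2) / t\<^sup>2)\<^sup>2"
proof -
  define s where "s = sqrt k"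
  have s: "s \<ge> 0" "k = s\<^sup>2" using k by (auto simp: s_def)
  have "2 * s - 2 * t - (s\<^sup>2 - t\<^sup>2) / t = - ((s - t)\<^sup>2 / t)"
    using t by (simp add: power2_eq_square field_simps)
  then have "\<bar>2 * s - 2 * t - (s\<^sup>2 - t\<^sup>2) / t\<bar> = (s - t)\<^sup>2 / t"
    using t by simp
  also have "\<dots> = t * ((s - t) / t)\<^sup>2"
    using t by (simp add: power2_eq_square)
  also have "\<dots> \<le> t * (((s - t) / t) * ((s + t) / t))\<^sup>2"
  proof -
    have "1 \<le> ((s + t) / t)\<^sup>2" using s(1) t by (intro one_le_power) simp
    then have "((s - t) / t)\<^sup>2 * 1 \<le> ((s - t) / t)\<^sup>2 * ((s + t) / t)\<^sup>2" by (intro mult_left_mono) auto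
    then show ?thesis unfolding power_mult_distrib using t by (intro mult_left_mono) auto
  qed
  also have "((s - t) / t) * ((s + t) / t) = (s\<^sup>2 - t\<^sup>2) / t\<^sup>2"
    by (simp add: power2_eq_square algebra_simps)
  finally show ?thesis by (simp only: s(2)[symmetric] s_def[symmetric])
qed

text \<open>Carries (ii) and (iv) from \<open>X\<close>, \<open>Y\<close> and their copies to the
  samples: smallness in probability of a function of a random element depends only on its law.
  Agreement almost everywhere for large \<open>p\<close> suffices, which suits conditional
  expectations and avoids \<open>p = 0\<close>.\<close>

lemma smallop1_transfer:
  assumes law: "\<And>p. distr (P p) (N p) (U p) = distr (P p) (N p) (U' p)"
    and meas: "\<And>p. U p \<in> measurable (P p) (N p)" "\<And>p. U' p \<in> measurable (P p) (N p)"
    and f: "\<And>p. f p \<in> borel_measurable (N p)"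
    and Z: "\<forall>\<^sub>F p in sequentially. AE \<omega> in P p. Z p \<omega> = f p (U p \<omega>)"
    and Z_m: "\<And>p. Z p \<in> borel_measurable (P p)"
    and small: "smallop1 P Z"
  shows "smallop1 P (\<lambda>p \<omega>. f p (U' p \<omega>))"
  unfolding smallop1_def
proof (intro allI impI)
  fix \<epsilon> :: real assume "\<epsilon> > 0"
  note [measurable] = meas f Z_m
  have eq: "measure (P p) {\<omega> \<in> space (P p). \<bar>f p (U' p \<omega>)\<bar> > \<epsilon>} = measure (P p) {\<omega> \<in> space (P p). \<bar>f p (U p \<omega>)\<bar> > \<epsilon>}" for p
  proof -
    have S: "{x \<in> space (N p). \<bar>f p x\<bar> > \<epsilon>} \<in> sets (N p)" by measurable
    have "{\<omega> \<in> space (P p). \<bar>f p (V \<omega>)\<bar> > \<epsilon>} = V -` {x \<in> space (N p). \<bar>f p x\<bar> > \<epsilon>} \<inter> space (P p)"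
      if "V \<in> measurable (P p) (N p)" for V
      using measurable_space[OF that] by auto
    then show ?thesis
      using measure_distr[OF meas(1) S] measure_distr[OF meas(2) S] law[of p] meas by simp
  qed
  have "\<forall>\<^sub>F p in sequentially. measure (P p) {\<omega> \<in> space (P p). \<bar>Z p \<omega>\<bar> > \<epsilon>} = measure (P p) {\<omega> \<in> space (P p). \<bar>f p (U' p \<omega>)\<bar> > \<epsilon>}"
    using Z
  proof eventually_elim
    case (elim p)
    have "measure (P p) {\<omega> \<in> space (P p). \<bar>Z p \<omega>\<bar> > \<epsilon>} = measure (P p) {\<omega> \<in> space (P p). \<bar>f p (U p \<omega>)\<bar> > \<epsilon>}"
    proof (rule measure_eq_AE)
      show "AE \<omega> in P p. (\<omega> \<in> {\<omega> \<in> space (P p). \<bar>Z p \<omega>\<bar> > \<epsilon>}) = (\<omega> \<in> {\<omega> \<in> space (P p). \<bar>f p (U p \<omega>)\<bar> > \<epsilon>})"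
        using elim by eventually_elim simp
    qed measurable
    then show ?case by (simp add: eq)
  qed
  moreover have "(\<lambda>p. measure (P p) {\<omega> \<in> space (P p). \<bar>Z p \<omega>\<bar> > \<epsilon>}) \<longlonglongrightarrow> 0"
    using small \<open>\<epsilon> > 0\<close> by (simp add: smallop1_def)
  ultimately show "(\<lambda>p. measure (P p) {\<omega> \<in> space (P p). \<bar>f p (U' p \<omega>)\<bar> > \<epsilon>}) \<longlonglongrightarrow> 0"
    by (rule Lim_transform_eventually[rotated])
qed

lemma bigOp_square_smallop1:
  assumes prob: "\<And>p. prob_space (P p)" and Z[measurable]: "\<And>p. Z p \<in> borel_measurable (P p)"
    and "bigOp P Z r" and c: "\<And>p. 0 \<le> c p" and rate: "(\<lambda>p. c p * (r p)\<^sup>2) \<longlonglongrightarrow> 0"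
  shows "smallop1 P (\<lambda>p \<omega>. c p * (Z p \<omega>)\<^sup>2)"
  unfolding smallop1_def
proof (intro allI impI tendstoI)
  fix \<epsilon> \<kappa> :: real assume \<epsilon>: "\<epsilon> > 0" and \<kappa>: "\<kappa> > 0"
  obtain C where C: "C > 0" "\<forall>\<^sub>F p in sequentially. measure (P p) {\<omega> \<in> space (P p). \<bar>Z p \<omega>\<bar> > C * r p} < \<kappa>"
    using assms(3) \<kappa> unfolding bigOp_def by blast
  have "(\<lambda>p. C\<^sup>2 * (c p * (r p)\<^sup>2)) \<longlonglongrightarrow> C\<^sup>2 * 0" by (intro tendsto_intros rate)
  then have "\<forall>\<^sub>F p in sequentially. C\<^sup>2 * (c p * (r p)\<^sup>2) < \<epsilon>"
    using \<epsilon> by (intro order_tendstoD(2)) auto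
  with C(2) show "\<forall>\<^sub>F p in sequentially. dist (measure (P p) {\<omega> \<in> space (P p). \<bar>c p * (Z p \<omega>)\<^sup>2\<bar> > \<epsilon>}) 0 < \<kappa>"
  proof eventually_elim
    case (elim p)
    interpret prob_space "P p" by (rule prob)
    have "{\<omega> \<in> space (P p). \<bar>c p * (Z p \<omega>)\<^sup>2\<bar> > \<epsilon>} \<subseteq> {\<omega> \<in> space (P p). \<bar>Z p \<omega>\<bar> > C * r p}"
    proof safe
      fix \<omega> assume *: "\<bar>c p * (Z p \<omega>)\<^sup>2\<bar> > \<epsilon>"
      show "\<bar>Z p \<omega>\<bar> > C * r p"
      proof (rule ccontr)
        assume "\<not> \<bar>Z p \<omega>\<bar> > C * r p"
        then have "(Z p \<omega>)\<^sup>2 \<le> (C * r p)\<^sup>2" by (metis abs_ge_zero not_less power2_abs power_mono)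
        then have "c p * (Z p \<omega>)\<^sup>2 \<le> C\<^sup>2 * (c p * (r p)\<^sup>2)"
          using mult_left_mono[OF _ c[of p]] by (fastforce simp: power_mult_distrib mult_ac)
        then show False using * elim(2) c[of p] by (simp add: abs_mult)
      qed
    qed
    then have "prob {\<omega> \<in> space (P p). \<bar>c p * (Z p \<omega>)\<^sup>2\<bar> > \<epsilon>} \<le> prob {\<omega> \<in> space (P p). \<bar>Z p \<omega>\<bar> > C * r p}"
      by (rule finite_measure_mono) measurable
    then show ?case using elim(1) by simp
  qed
qed

lemma (in prob_space) indep_vars_pair_law:
  assumes indep: "indep_vars (\<lambda>_. N) Z I" and ij: "i \<in> I" "j \<in> I" "i \<noteq> j"
  shows "distr M (N \<Otimes>\<^sub>M N) (\<lambda>\<omega>. (Z i \<omega>, Z j \<omega>)) = distr M N (Z i) \<Otimes>\<^sub>M distr M N (Z j)"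
proof -
  have "distr M (N \<Otimes>\<^sub>M N) (\<lambda>\<omega>. ((\<lambda>z. z i) (\<lambda>k\<in>{i}. Z k \<omega>), (\<lambda>z. z j) (\<lambda>k\<in>{j}. Z k \<omega>)))
    = distr M N (\<lambda>\<omega>. (\<lambda>z. z i) (\<lambda>k\<in>{i}. Z k \<omega>)) \<Otimes>\<^sub>M distr M N (\<lambda>\<omega>. (\<lambda>z. z j) (\<lambda>k\<in>{j}. Z k \<omega>))"
    by (rule distr_pair_indep_groups[OF indep]) (use ij in auto)
  then show ?thesis by simp
qed

text \<open>Applied to squared distances \<open>A\<close> and \<open>B\<close>: the product of
  \<open>\<tau>\<close> and \<open>L\<close> is affine in the squared distance, and the constants
  combine into \<open>c\<close>.\<close>

lemma (in prob_space) cond_exp_given_affine: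
  assumes U: "U \<in> measurable M N" and A: "integrable M A" and B: "integrable M B"
    and EA: "AE \<omega> in M. cond_exp_given M N U A \<omega> = \<alpha> (U \<omega>)"
    and EB: "AE \<omega> in M. cond_exp_given M N U B \<omega> = \<beta> (U \<omega>)"
    and f[measurable]: "f \<in> borel_measurable M" and f_eq: "\<And>\<omega>. \<omega> \<in> space M \<Longrightarrow> f \<omega> = a * A \<omega> - b * B \<omega> - c"
  shows "AE \<omega> in M. cond_exp_given M N U f \<omega> = a * \<alpha> (U \<omega>) - b * \<beta> (U \<omega>) - c"
proof -
  interpret F: finite_measure_subalgebra M "vimage_algebra (space M) U N" by (rule vimage_subalgebra[OF U])
  let ?E = "real_cond_exp M (vimage_algebra (space M) U N)"
  note [measurable] = borel_measurable_integrable[OF A] borel_measurable_integrable[OF B]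
  have 1: "AE \<omega> in M. ?E f \<omega> = ?E (\<lambda>\<omega>. (a * A \<omega> - b * B \<omega>) - c) \<omega>"
    by (rule F.real_cond_exp_cong) (auto simp: f_eq)
  have 2: "AE \<omega> in M. ?E (\<lambda>\<omega>. (a * A \<omega> - b * B \<omega>) - c) \<omega> = ?E (\<lambda>\<omega>. a * A \<omega> - b * B \<omega>) \<omega> - ?E (\<lambda>_. c) \<omega>"
    by (rule F.real_cond_exp_diff) (use A B in auto)
  have 3: "AE \<omega> in M. ?E (\<lambda>\<omega>. a * A \<omega> - b * B \<omega>) \<omega> = ?E (\<lambda>\<omega>. a * A \<omega>) \<omega> - ?E (\<lambda>\<omega>. b * B \<omega>) \<omega>"
    by (rule F.real_cond_exp_diff) (use A B in auto)
  have 4: "AE \<omega> in M. ?E (\<lambda>\<omega>. a * A \<omega>) \<omega> = a * ?E A \<omega>" "AE \<omega> in M. ?E (\<lambda>\<omega>. b * B \<omega>) \<omega> = b * ?E B \<omega>"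
    by (rule F.real_cond_exp_cmult; use A B in simp)+
  have 5: "AE \<omega> in M. ?E (\<lambda>_. c) \<omega> = c"
    by (rule F.real_cond_exp_F_meas) auto
  show ?thesis
    using 1 2 3 4 5 EA EB unfolding cond_exp_given_def by eventually_elim simp
qed

text \<open>\<open>H\<close> as a deterministic function of the pair that involves only the two
  marginal laws and the scale. Second moments of \<open>H\<close> at different pairs can thus be
  compared through their laws.\<close>

definition centered_kernel ::
    "nat \<Rightarrow> (nat \<Rightarrow> point \<Rightarrow> point \<Rightarrow> real) \<Rightarrow> data measure \<Rightarrow> data measure \<Rightarrow> real \<Rightarrow> data \<times> data \<Rightarrow> real" where
  "centered_kernel p \<rho> PU PW t z =
     (dist_K2 p \<rho> (fst z) (snd z) - mean_dist p \<rho> PW (fst z) - mean_dist p \<rho> PU (snd z)) / t + t"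

context indep_pair
begin

lemma tau_law: "tau M (dist_K p \<rho>) U W
    = sqrt (\<integral>z. (dist_K p \<rho> (fst z) (snd z))\<^sup>2 \<partial>(distr M N U \<Otimes>\<^sub>M distr M N W))"
proof -
  note [measurable] = dist_K_measurable
  show ?thesis unfolding tau_def law[symmetric] by (subst integral_distr) auto
qed

lemma remainder_bound:
  assumes pos: "0 < tau M (dist_K p \<rho>) U W"
  defines "t \<equiv> tau M (dist_K p \<rho>) U W"
  shows "AE \<omega> in M. \<bar>2 * dist_K p \<rho> (U \<omega>) (W \<omega>) - (H M p d \<rho> t U W \<omega>
      + mean_dist p \<rho> (distr M N W) (U \<omega>) / t + mean_dist p \<rho> (distr M N U) (W \<omega>) / t)\<bar>
    \<le> t * ((dist_K2 p \<rho> (U \<omega>) (W \<omega>) - t\<^sup>2) / t\<^sup>2)\<^sup>2"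
  using H_eq[OF pos] AE_space unfolding t_def[symmetric]
proof eventually_elim
  case (elim \<omega>)
  have t: "0 < t" using pos by (simp add: t_def)
  have k: "0 \<le> dist_K2 p \<rho> (U \<omega>) (W \<omega>)"
    using measurable_space[OF U elim(2)] measurable_space[OF W elim(2)] by (rule dist_K2_nonneg)
  \<comment> \<open>Adding the mean terms back to \<open>H\<close> leaves k/t + t, that is 2t + (k -
    t^2)/t, the first-order expansion of twice the root of k at t^2.\<close>
  have "2 * dist_K p \<rho> (U \<omega>) (W \<omega>) - (H M p d \<rho> t U W \<omega>
      + mean_dist p \<rho> (distr M N W) (U \<omega>) / t + mean_dist p \<rho> (distr M N U) (W \<omega>) / t)
    = 2 * sqrt (dist_K2 p \<rho> (U \<omega>) (W \<omega>)) - 2 * t - (dist_K2 p \<rho> (U \<omega>) (W \<omega>) - t\<^sup>2) / t"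
    unfolding elim(1) dist_K_eq using t by (simp add: diff_divide_distrib power2_eq_square)
  then show ?case using sqrt_expansion[OF t k] by simp
qed

lemma centered_kernel_measurable:
  "centered_kernel p \<rho> (distr M N U) (distr M N W) t \<in> borel_measurable (N \<Otimes>\<^sub>M N)"
proof -
  have [measurable]: "mean_dist p \<rho> (distr M N U) \<in> borel_measurable N" "mean_dist p \<rho> (distr M N W) \<in> borel_measurable N"
    by (intro mean_dist_measurable prob_space_distr; simp)+
  note [measurable] = dist_K2_measurable
  show ?thesis unfolding centered_kernel_def[abs_def] by measurable
qed

lemma integral_H_square:
  assumes pos: "0 < tau M (dist_K p \<rho>) U W"
  defines "t \<equiv> tau M (dist_K p \<rho>) U W"
  shows "(\<integral>\<omega>. (H M p d \<rho> t U W \<omega>)\<^sup>2 \<partial>M)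
    = (\<integral>z. (centered_kernel p \<rho> (distr M N U) (distr M N W) t z)\<^sup>2 \<partial>(distr M N U \<Otimes>\<^sub>M distr M N W))"
proof -
  note [measurable] = centered_kernel_measurable H_measurable
  have "(\<integral>\<omega>. (H M p d \<rho> t U W \<omega>)\<^sup>2 \<partial>M)
     = (\<integral>\<omega>. (centered_kernel p \<rho> (distr M N U) (distr M N W) t (U \<omega>, W \<omega>))\<^sup>2 \<partial>M)"
  proof (rule integral_cong_AE)
    show "AE \<omega> in M. (H M p d \<rho> t U W \<omega>)\<^sup>2 = (centered_kernel p \<rho> (distr M N U) (distr M N W) t (U \<omega>, W \<omega>))\<^sup>2"
      using H_eq[OF pos] unfolding t_def[symmetric] by eventually_elim (simp add: centered_kernel_def)
  qed measurable
  then show ?thesis unfolding law[symmetric] by (subst integral_distr) auto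
qed

end

section \<open>Expansion in the two-sample model\<close>

locale two_sample =
  fixes n m :: nat
    and P :: "nat \<Rightarrow> 'w measure"
    and d :: "nat \<Rightarrow> nat \<Rightarrow> nat"
    and \<rho> :: "nat \<Rightarrow> nat \<Rightarrow> point \<Rightarrow> point \<Rightarrow> real"
    and X X' Y Y' :: "nat \<Rightarrow> 'w \<Rightarrow> data"
    and Xs Ys :: "nat \<Rightarrow> nat \<Rightarrow> 'w \<Rightarrow> data"
    and K :: "nat \<Rightarrow> data \<Rightarrow> data \<Rightarrow> real"
    and \<tau> \<tau>X \<tau>Y :: "nat \<Rightarrow> real"
    and a a' a'' :: real
    and ap bp cp :: "nat \<Rightarrow> real"
    and \<sigma>2 \<sigma>X2 \<sigma>Y2 :: real
  assumes n: "4 \<le> n" and m: "4 \<le> m"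
    and prob: "\<And>p. prob_space (P p)"
    and population: "\<And>p. prob_space.indep_vars (P p) (\<lambda>_. data_space p (d p))
                           (\<lambda>j. [X p, Y p, X' p, Y' p] ! j) {..<4}"
    and copy_X: "\<And>p. distr (P p) (data_space p (d p)) (X' p) = distr (P p) (data_space p (d p)) (X p)"
    and copy_Y: "\<And>p. distr (P p) (data_space p (d p)) (Y' p) = distr (P p) (data_space p (d p)) (Y p)"
    and samples: "\<And>p. prob_space.indep_vars (P p) (\<lambda>_. data_space p (d p))
                        (case_sum (Xs p) (Ys p)) ({1..n} <+> {1..m})"
    and sample_X: "\<And>p k. k \<in> {1..n} \<Longrightarrow>
          distr (P p) (data_space p (d p)) (Xs p k) = distr (P p) (data_space p (d p)) (X p)"
    and sample_Y: "\<And>p l. l \<in> {1..m} \<Longrightarrow>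
          distr (P p) (data_space p (d p)) (Ys p l) = distr (P p) (data_space p (d p)) (Y p)"
    and ground: "\<And>p i. i \<in> {1..p} \<Longrightarrow> case_S1 (d p i) (\<rho> p i) \<or> case_S2 (d p i) (\<rho> p i)"
    and K_eq: "\<And>p. K p = dist_K p (\<rho> p)"
    and tau_eq: "\<And>p. \<tau> p = tau (P p) (K p) (X p) (Y p)"
    and tauX_eq: "\<And>p. \<tau>X p = tau (P p) (K p) (X p) (X' p)"
    and tauY_eq: "\<And>p. \<tau>Y p = tau (P p) (K p) (Y p) (Y' p)"
    and pos: "0 < a" "0 < a'" "0 < a''"
    and i_X: "\<And>p i. i \<in> {1..p} \<Longrightarrow> a \<le> (\<integral>\<omega>. \<rho> p i (X p \<omega> i) (X' p \<omega> i) \<partial>P p)"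
    and i_Y: "\<And>p i. i \<in> {1..p} \<Longrightarrow> a' \<le> (\<integral>\<omega>. \<rho> p i (Y p \<omega> i) (Y' p \<omega> i) \<partial>P p)"
    and i_XY: "\<And>p i. i \<in> {1..p} \<Longrightarrow> a'' \<le> (\<integral>\<omega>. \<rho> p i (X p \<omega> i) (Y p \<omega> i) \<partial>P p)"
    and ii_XY: "bigOp P (\<lambda>p. L (P p) (K p) (X p) (Y p)) ap"
    and ii_X: "bigOp P (\<lambda>p. L (P p) (K p) (X p) (X' p)) bp"
    and ii_Y: "bigOp P (\<lambda>p. L (P p) (K p) (Y p) (Y' p)) cp"
    and ii_rate: "(\<lambda>p. \<tau> p * (ap p)\<^sup>2 + \<tau>X p * (bp p)\<^sup>2 + \<tau>Y p * (cp p)\<^sup>2) \<longlonglongrightarrow> 0"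
    and iii_conv: "joint_conv P (entries n m)
          (\<lambda>p e. case e of
              XY k l \<Rightarrow> H (P p) p (d p) (\<rho> p) (\<tau> p) (Xs p k) (Ys p l)
            | XX s t \<Rightarrow> H (P p) p (d p) (\<rho> p) (\<tau>X p) (Xs p s) (Xs p t)
            | YY s t \<Rightarrow> H (P p) p (d p) (\<rho> p) (\<tau>Y p) (Ys p s) (Ys p t))
          (entries_limit n m \<sigma>2 \<sigma>X2 \<sigma>Y2)"
    and iii_XY: "\<And>k l. XY k l \<in> entries n m \<Longrightarrow>
          second_moment_tendsto P (\<lambda>p. H (P p) p (d p) (\<rho> p) (\<tau> p) (Xs p k) (Ys p l)) \<sigma>2"
    and iii_X: "\<And>s t. XX s t \<in> entries n m \<Longrightarrow>
          second_moment_tendsto P (\<lambda>p. H (P p) p (d p) (\<rho> p) (\<tau>X p) (Xs p s) (Xs p t)) \<sigma>X2"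
    and iii_Y: "\<And>s t. YY s t \<in> entries n m \<Longrightarrow>
          second_moment_tendsto P (\<lambda>p. H (P p) p (d p) (\<rho> p) (\<tau>Y p) (Ys p s) (Ys p t)) \<sigma>Y2"
    and nondegenerate: "\<sigma>2 \<noteq> 0 \<or> \<sigma>X2 \<noteq> 0 \<or> \<sigma>Y2 \<noteq> 0"
    and iv_X: "smallop1 P (\<lambda>p. cond_exp_given (P p) (data_space p (d p)) (X p)
          (\<lambda>\<omega>. \<tau> p * L (P p) (K p) (X p) (Y p) \<omega> - \<tau>X p * L (P p) (K p) (X p) (X' p) \<omega>))"
    and iv_Y: "smallop1 P (\<lambda>p. cond_exp_given (P p) (data_space p (d p)) (Y p)
          (\<lambda>\<omega>. \<tau> p * L (P p) (K p) (X p) (Y p) \<omega> - \<tau>Y p * L (P p) (K p) (Y p) (Y' p) \<omega>))"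
begin

abbreviation "DS p \<equiv> data_space p (d p)"
abbreviation "PX p \<equiv> distr (P p) (DS p) (X p)"
abbreviation "PY p \<equiv> distr (P p) (DS p) (Y p)"

lemma ground_distances: "ground_distances p (d p) (\<rho> p)"
  by unfold_locales (rule ground)

lemma population_measurable:
  "X p \<in> measurable (P p) (DS p)" "Y p \<in> measurable (P p) (DS p)" "X' p \<in> measurable (P p) (DS p)" "Y' p \<in> measurable (P p) (DS p)"
proof -
  interpret prob_space "P p" by (rule prob)
  have "random_variable (DS p) ([X p, Y p, X' p, Y' p] ! j)" if "j < 4" for j
    using population[of p] that by (auto simp: indep_vars_def2)
  from this[of 0] this[of 1] this[of 2] this[of 3]
  show "X p \<in> measurable (P p) (DS p)" "Y p \<in> measurable (P p) (DS p)" "X' p \<in> measurable (P p) (DS p)" "Y' p \<in> measurable (P p) (DS p)"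
    by (simp_all add: numeral_eq_Suc One_nat_def)
qed

lemma sample_measurable:
  "k \<in> {1..n} \<Longrightarrow> Xs p k \<in> measurable (P p) (DS p)" "l \<in> {1..m} \<Longrightarrow> Ys p l \<in> measurable (P p) (DS p)"
proof -
  interpret prob_space "P p" by (rule prob)
  have "random_variable (DS p) (case_sum (Xs p) (Ys p) j)" if "j \<in> {1..n} <+> {1..m}" for j
    using samples[of p] that by (auto simp: indep_vars_def2)
  from this[of "Inl k"] this[of "Inr l"]
  show "k \<in> {1..n} \<Longrightarrow> Xs p k \<in> measurable (P p) (DS p)" "l \<in> {1..m} \<Longrightarrow> Ys p l \<in> measurable (P p) (DS p)"
    by (simp_all add: Plus_def)
qed

lemma population_law:
  "distr (P p) (DS p \<Otimes>\<^sub>M DS p) (\<lambda>\<omega>. (X p \<omega>, Y p \<omega>)) = PX p \<Otimes>\<^sub>M PY p"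
  "distr (P p) (DS p \<Otimes>\<^sub>M DS p) (\<lambda>\<omega>. (X p \<omega>, X' p \<omega>)) = PX p \<Otimes>\<^sub>M PX p"
  "distr (P p) (DS p \<Otimes>\<^sub>M DS p) (\<lambda>\<omega>. (Y p \<omega>, Y' p \<omega>)) = PY p \<Otimes>\<^sub>M PY p"
proof -
  interpret prob_space "P p" by (rule prob)
  note * = indep_vars_pair_law[OF population[of p]]
  show "distr (P p) (DS p \<Otimes>\<^sub>M DS p) (\<lambda>\<omega>. (X p \<omega>, Y p \<omega>)) = PX p \<Otimes>\<^sub>M PY p"
    using *[of 0 1] by (simp add: One_nat_def)
  show "distr (P p) (DS p \<Otimes>\<^sub>M DS p) (\<lambda>\<omega>. (X p \<omega>, X' p \<omega>)) = PX p \<Otimes>\<^sub>M PX p"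
    using *[of 0 2] by (simp add: numeral_2_eq_2 copy_X)
  show "distr (P p) (DS p \<Otimes>\<^sub>M DS p) (\<lambda>\<omega>. (Y p \<omega>, Y' p \<omega>)) = PY p \<Otimes>\<^sub>M PY p"
    using *[of 1 3] by (simp add: numeral_3_eq_3 One_nat_def copy_Y)
qed

lemma sample_law:
  "k \<in> {1..n} \<Longrightarrow> l \<in> {1..m} \<Longrightarrow> distr (P p) (DS p \<Otimes>\<^sub>M DS p) (\<lambda>\<omega>. (Xs p k \<omega>, Ys p l \<omega>)) = PX p \<Otimes>\<^sub>M PY p"
  "s \<in> {1..n} \<Longrightarrow> t \<in> {1..n} \<Longrightarrow> s \<noteq> t \<Longrightarrow> distr (P p) (DS p \<Otimes>\<^sub>M DS p) (\<lambda>\<omega>. (Xs p s \<omega>, Xs p t \<omega>)) = PX p \<Otimes>\<^sub>M PX p"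
  "s' \<in> {1..m} \<Longrightarrow> t' \<in> {1..m} \<Longrightarrow> s' \<noteq> t' \<Longrightarrow> distr (P p) (DS p \<Otimes>\<^sub>M DS p) (\<lambda>\<omega>. (Ys p s' \<omega>, Ys p t' \<omega>)) = PY p \<Otimes>\<^sub>M PY p"
proof -
  interpret prob_space "P p" by (rule prob)
  note * = indep_vars_pair_law[OF samples[of p]]
  show "k \<in> {1..n} \<Longrightarrow> l \<in> {1..m} \<Longrightarrow> distr (P p) (DS p \<Otimes>\<^sub>M DS p) (\<lambda>\<omega>. (Xs p k \<omega>, Ys p l \<omega>)) = PX p \<Otimes>\<^sub>M PY p"
    using *[of "Inl k" "Inr l"] by (simp add: sample_X sample_Y Plus_def)
  show "s \<in> {1..n} \<Longrightarrow> t \<in> {1..n} \<Longrightarrow> s \<noteq> t \<Longrightarrow> distr (P p) (DS p \<Otimes>\<^sub>M DS p) (\<lambda>\<omega>. (Xs p s \<omega>, Xs p t \<omega>)) = PX p \<Otimes>\<^sub>M PX p"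
    using *[of "Inl s" "Inl t"] by (simp add: sample_X Plus_def)
  show "s' \<in> {1..m} \<Longrightarrow> t' \<in> {1..m} \<Longrightarrow> s' \<noteq> t' \<Longrightarrow> distr (P p) (DS p \<Otimes>\<^sub>M DS p) (\<lambda>\<omega>. (Ys p s' \<omega>, Ys p t' \<omega>)) = PY p \<Otimes>\<^sub>M PY p"
    using *[of "Inr s'" "Inr t'"] by (simp add: sample_Y Plus_def)
qed

text \<open>Integrability comes out of the positive lower bound in (i): the integral of a function
  that is not integrable is 0 by convention. Equality of laws then passes it on to the
  samples.\<close>

lemma indep_pair_transfer:
  assumes "U \<in> measurable (P p) (DS p)" "W \<in> measurable (P p) (DS p)"
    "U0 \<in> measurable (P p) (DS p)" "W0 \<in> measurable (P p) (DS p)"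
    and law: "distr (P p) (DS p \<Otimes>\<^sub>M DS p) (\<lambda>\<omega>. (U \<omega>, W \<omega>)) = distr (P p) (DS p) U0 \<Otimes>\<^sub>M distr (P p) (DS p) W0"
    and law0: "distr (P p) (DS p \<Otimes>\<^sub>M DS p) (\<lambda>\<omega>. (U0 \<omega>, W0 \<omega>)) = distr (P p) (DS p) U0 \<Otimes>\<^sub>M distr (P p) (DS p) W0"
    and margins: "distr (P p) (DS p) U = distr (P p) (DS p) U0" "distr (P p) (DS p) W = distr (P p) (DS p) W0"
    and bound: "\<And>i. i \<in> {1..p} \<Longrightarrow> \<kappa> \<le> (\<integral>\<omega>. \<rho> p i (U0 \<omega> i) (W0 \<omega> i) \<partial>P p)" and \<kappa>: "0 < \<kappa>"
  shows "indep_pair p (d p) (\<rho> p) (P p) U W"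
proof -
  interpret ground_distances p "d p" "\<rho> p" by (rule ground_distances)
  interpret prob_space "P p" by (rule prob)
  note [measurable] = assms(1-4)
  have "integrable (P p) (\<lambda>\<omega>. \<rho> p i (U \<omega> i) (W \<omega> i))" if i: "i \<in> {1..p}" for i
  proof -
    note [measurable] = \<rho>_measurable[OF i]
    have "integrable (P p) (\<lambda>\<omega>. \<rho> p i (U0 \<omega> i) (W0 \<omega> i))"
      using bound[OF i] \<kappa> not_integrable_integral_eq by force
    then have "integrable (distr (P p) (DS p \<Otimes>\<^sub>M DS p) (\<lambda>\<omega>. (U0 \<omega>, W0 \<omega>))) (\<lambda>z. \<rho> p i (fst z i) (snd z i))"
      by (subst integrable_distr_eq) auto
    then have "integrable (distr (P p) (DS p \<Otimes>\<^sub>M DS p) (\<lambda>\<omega>. (U \<omega>, W \<omega>))) (\<lambda>z. \<rho> p i (fst z i) (snd z i))"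
      unfolding law law0 .
    then show ?thesis by (subst (asm) integrable_distr_eq) auto
  qed
  then show ?thesis by unfold_locales (auto simp: assms law)
qed

lemma pairs:
  "indep_pair p (d p) (\<rho> p) (P p) (X p) (Y p)"
  "indep_pair p (d p) (\<rho> p) (P p) (X p) (X' p)"
  "indep_pair p (d p) (\<rho> p) (P p) (Y p) (Y' p)"
  "k \<in> {1..n} \<Longrightarrow> l \<in> {1..m} \<Longrightarrow> indep_pair p (d p) (\<rho> p) (P p) (Xs p k) (Ys p l)"
  "s \<in> {1..n} \<Longrightarrow> t \<in> {1..n} \<Longrightarrow> s \<noteq> t \<Longrightarrow> indep_pair p (d p) (\<rho> p) (P p) (Xs p s) (Xs p t)"
  "s' \<in> {1..m} \<Longrightarrow> t' \<in> {1..m} \<Longrightarrow> s' \<noteq> t' \<Longrightarrow> indep_pair p (d p) (\<rho> p) (P p) (Ys p s') (Ys p t')"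
proof -
  note pop = population_measurable[of p] population_law[of p]
  show "indep_pair p (d p) (\<rho> p) (P p) (X p) (Y p)"
    by (rule indep_pair_transfer[where ?U0.0="X p" and ?W0.0="Y p" and \<kappa>=a'']) (use pop pos i_XY in auto)
  show "indep_pair p (d p) (\<rho> p) (P p) (X p) (X' p)"
    by (rule indep_pair_transfer[where ?U0.0="X p" and ?W0.0="X' p" and \<kappa>=a]) (use pop pos i_X copy_X in auto)
  show "indep_pair p (d p) (\<rho> p) (P p) (Y p) (Y' p)"
    by (rule indep_pair_transfer[where ?U0.0="Y p" and ?W0.0="Y' p" and \<kappa>=a']) (use pop pos i_Y copy_Y in auto)
  show "indep_pair p (d p) (\<rho> p) (P p) (Xs p k) (Ys p l)" if "k \<in> {1..n}" "l \<in> {1..m}"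
    by (rule indep_pair_transfer[where ?U0.0="X p" and ?W0.0="Y p" and \<kappa>=a''])
      (use that pop pos i_XY sample_measurable sample_law sample_X sample_Y in auto)
  show "indep_pair p (d p) (\<rho> p) (P p) (Xs p s) (Xs p t)" if "s \<in> {1..n}" "t \<in> {1..n}" "s \<noteq> t"
    by (rule indep_pair_transfer[where ?U0.0="X p" and ?W0.0="X' p" and \<kappa>=a])
      (use that pop pos i_X sample_measurable sample_law sample_X copy_X in auto)
  show "indep_pair p (d p) (\<rho> p) (P p) (Ys p s') (Ys p t')" if "s' \<in> {1..m}" "t' \<in> {1..m}" "s' \<noteq> t'"
    by (rule indep_pair_transfer[where ?U0.0="Y p" and ?W0.0="Y' p" and \<kappa>=a'])
      (use that pop pos i_Y sample_measurable sample_law sample_Y copy_Y in auto)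
qed

lemma tau_samples:
  "k \<in> {1..n} \<Longrightarrow> l \<in> {1..m} \<Longrightarrow> tau (P p) (dist_K p (\<rho> p)) (Xs p k) (Ys p l) = \<tau> p"
  "s \<in> {1..n} \<Longrightarrow> t \<in> {1..n} \<Longrightarrow> s \<noteq> t \<Longrightarrow> tau (P p) (dist_K p (\<rho> p)) (Xs p s) (Xs p t) = \<tau>X p"
  "s' \<in> {1..m} \<Longrightarrow> t' \<in> {1..m} \<Longrightarrow> s' \<noteq> t' \<Longrightarrow> tau (P p) (dist_K p (\<rho> p)) (Ys p s') (Ys p t') = \<tau>Y p"
proof -
  note eqs = K_eq tau_eq tauX_eq tauY_eq pairs[THEN indep_pair.tau_law] sample_X sample_Y copy_X copy_Y
  show "k \<in> {1..n} \<Longrightarrow> l \<in> {1..m} \<Longrightarrow> tau (P p) (dist_K p (\<rho> p)) (Xs p k) (Ys p l) = \<tau> p"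
    by (simp add: eqs)
  show "s \<in> {1..n} \<Longrightarrow> t \<in> {1..n} \<Longrightarrow> s \<noteq> t \<Longrightarrow> tau (P p) (dist_K p (\<rho> p)) (Xs p s) (Xs p t) = \<tau>X p"
    by (simp add: eqs)
  show "s' \<in> {1..m} \<Longrightarrow> t' \<in> {1..m} \<Longrightarrow> s' \<noteq> t' \<Longrightarrow> tau (P p) (dist_K p (\<rho> p)) (Ys p s') (Ys p t') = \<tau>Y p"
    by (simp add: eqs)
qed

lemma tau_nonneg: "0 \<le> \<tau> p" "0 \<le> \<tau>X p" "0 \<le> \<tau>Y p"
  unfolding tau_eq tauX_eq tauY_eq K_eq
  using indep_pair.tau_nonneg[OF pairs(1)] indep_pair.tau_nonneg[OF pairs(2)] indep_pair.tau_nonneg[OF pairs(3)] by auto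

text \<open>For \<open>p = 0\<close> the distance is identically 0 and so are the scales; this is
  why estimates that divide by them are stated for large \<open>p\<close>.\<close>

lemma tau_pos:
  assumes p: "1 \<le> p"
  shows "0 < \<tau> p" "0 < \<tau>X p" "0 < \<tau>Y p"
proof -
  have pos_of_bound: "0 < tau (P p) (K p) U W"
    if "indep_pair p (d p) (\<rho> p) (P p) U W" "\<And>i. i \<in> {1..p} \<Longrightarrow> \<kappa> \<le> (\<integral>\<omega>. \<rho> p i (U \<omega> i) (W \<omega> i) \<partial>P p)" "0 < \<kappa>" for U W \<kappa>
  proof -
    interpret indep_pair p "d p" "\<rho> p" "P p" U W by fact
    have "0 < (\<Sum>i=1..p. \<kappa>)" using p \<open>0 < \<kappa>\<close> by simp
    also have "\<dots> \<le> (\<Sum>i=1..p. \<integral>\<omega>. \<rho> p i (U \<omega> i) (W \<omega> i) \<partial>P p)" by (intro sum_mono that)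
    finally have "0 < (tau (P p) (K p) U W)\<^sup>2" by (simp add: K_eq tau_square integral_K2)
    then show ?thesis using tau_nonneg by (auto simp: K_eq less_le)
  qed
  show "0 < \<tau> p" unfolding tau_eq by (rule pos_of_bound[OF pairs(1) i_XY pos(3)])
  show "0 < \<tau>X p" unfolding tauX_eq by (rule pos_of_bound[OF pairs(2) i_X pos(1)])
  show "0 < \<tau>Y p" unfolding tauY_eq by (rule pos_of_bound[OF pairs(3) i_Y pos(2)])
qed

definition V :: "nat \<Rightarrow> entry \<Rightarrow> 'w \<Rightarrow> real" where
  "V p e = (case e of
              XY k l \<Rightarrow> H (P p) p (d p) (\<rho> p) (\<tau> p) (Xs p k) (Ys p l)
            | XX s t \<Rightarrow> H (P p) p (d p) (\<rho> p) (\<tau>X p) (Xs p s) (Xs p t)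
            | YY s t \<Rightarrow> H (P p) p (d p) (\<rho> p) (\<tau>Y p) (Ys p s) (Ys p t))"

text \<open>Defined as an exact difference, so that the expansion of the statistics holds at every
  sample point and only the smallness of \<open>R\<close> is probabilistic.\<close>

definition R :: "nat \<Rightarrow> entry \<Rightarrow> 'w \<Rightarrow> real" where
  "R p e \<omega> = (case e of
      XY k l \<Rightarrow> 2 * K p (Xs p k \<omega>) (Ys p l \<omega>) - (V p (XY k l) \<omega> + mean_dist p (\<rho> p) (PY p) (Xs p k \<omega>) / \<tau> p + mean_dist p (\<rho> p) (PX p) (Ys p l \<omega>) / \<tau> p)
    | XX s t \<Rightarrow> 2 * K p (Xs p s \<omega>) (Xs p t \<omega>) - (V p (XX s t) \<omega> + mean_dist p (\<rho> p) (PX p) (Xs p s \<omega>) / \<tau>X p + mean_dist p (\<rho> p) (PX p) (Xs p t \<omega>) / \<tau>X p)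
    | YY s t \<Rightarrow> 2 * K p (Ys p s \<omega>) (Ys p t \<omega>) - (V p (YY s t) \<omega> + mean_dist p (\<rho> p) (PY p) (Ys p s \<omega>) / \<tau>Y p + mean_dist p (\<rho> p) (PY p) (Ys p t \<omega>) / \<tau>Y p))"

text \<open>The conditional expectations of assumption (iv), given \<open>X = x\<close> and \<open>Y = y\<close>.\<close>

definition \<eta>X :: "nat \<Rightarrow> data \<Rightarrow> real" where
  "\<eta>X p x = (1 / \<tau> p) * mean_dist p (\<rho> p) (PY p) x - (1 / \<tau>X p) * mean_dist p (\<rho> p) (PX p) x - (\<tau> p - \<tau>X p)"

definition \<eta>Y :: "nat \<Rightarrow> data \<Rightarrow> real" where
  "\<eta>Y p y = (1 / \<tau> p) * mean_dist p (\<rho> p) (PX p) y - (1 / \<tau>Y p) * mean_dist p (\<rho> p) (PY p) y - (\<tau> p - \<tau>Y p)"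

lemma entries_cases:
  assumes "e \<in> entries n m"
  obtains (XY) k l where "e = XY k l" "k \<in> {1..n}" "l \<in> {1..m}"
    | (XX) s t where "e = XX s t" "s \<in> {1..n}" "t \<in> {1..n}" "s \<noteq> t"
    | (YY) s t where "e = YY s t" "s \<in> {1..m}" "t \<in> {1..m}" "s \<noteq> t"
  using assms by (auto simp: entries_def)

lemma V_measurable: "e \<in> entries n m \<Longrightarrow> V p e \<in> borel_measurable (P p)"
  by (erule entries_cases) (simp_all add: V_def indep_pair.H_measurable pairs)

text \<open>The common argument for the three blocks. By (ii) the scale times the squared
  \<open>L\<close> vanishes for the population pair; it is a function of that pair, so the same
  function vanishes at a sample pair and dominates the remainder there.\<close>

lemma vanishes_R_aux:
  assumes U0: "U0 = X \<and> W0 = Y \<and> T = \<tau> \<or> U0 = X \<and> W0 = X' \<and> T = \<tau>X \<or> U0 = Y \<and> W0 = Y' \<and> T = \<tau>Y"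
    and big: "bigOp P (\<lambda>p. L (P p) (K p) (U0 p) (W0 p)) r" and rate: "(\<lambda>p. T p * (r p)\<^sup>2) \<longlonglongrightarrow> 0"
    and T: "\<And>p. T p = tau (P p) (K p) (U0 p) (W0 p)"
    and U: "\<And>p. U p \<in> measurable (P p) (DS p)" and W: "\<And>p. W p \<in> measurable (P p) (DS p)"
    and law: "\<And>p. distr (P p) (DS p \<Otimes>\<^sub>M DS p) (\<lambda>\<omega>. (U p \<omega>, W p \<omega>)) = distr (P p) (DS p \<Otimes>\<^sub>M DS p) (\<lambda>\<omega>. (U0 p \<omega>, W0 p \<omega>))"
    and bound: "\<And>p. 1 \<le> p \<Longrightarrow> AE \<omega> in P p. \<bar>Z p \<omega>\<bar> \<le> T p * ((dist_K2 p (\<rho> p) (U p \<omega>) (W p \<omega>) - (T p)\<^sup>2) / (T p)\<^sup>2)\<^sup>2"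
  shows "vanishes P Z"
proof -
  have pair: "indep_pair p (d p) (\<rho> p) (P p) (U0 p) (W0 p)" for p
    using U0 pairs(1-3)[of p] by auto
  have T_nonneg: "0 \<le> T p" for p using U0 tau_nonneg by auto
  define f where "f p z = T p * ((dist_K2 p (\<rho> p) (fst z) (snd z) - (T p)\<^sup>2) / (T p)\<^sup>2)\<^sup>2" for p z
  have f_m: "f p \<in> borel_measurable (DS p \<Otimes>\<^sub>M DS p)" for p
  proof -
    interpret ground_distances p "d p" "\<rho> p" by (rule ground_distances)
    note [measurable] = dist_K2_measurable
    show ?thesis unfolding f_def by measurable
  qed
  have L_m: "L (P p) (K p) (U0 p) (W0 p) \<in> borel_measurable (P p)" for p
  proof -
    interpret indep_pair p "d p" "\<rho> p" "P p" "U0 p" "W0 p" by (rule pair)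
    note [measurable] = dist_K_measurable
    have "(\<lambda>\<omega>. (\<lambda>z. dist_K p (\<rho> p) (fst z) (snd z)) (U0 p \<omega>, W0 p \<omega>)) \<in> borel_measurable (P p)" by measurable
    then show ?thesis unfolding L_def[abs_def] K_eq by simp
  qed
  have small: "smallop1 P (\<lambda>p \<omega>. T p * (L (P p) (K p) (U0 p) (W0 p) \<omega>)\<^sup>2)"
    by (rule bigOp_square_smallop1[OF prob L_m big T_nonneg rate])
  have pair0_m: "(\<lambda>\<omega>. (U0 p \<omega>, W0 p \<omega>)) \<in> measurable (P p) (DS p \<Otimes>\<^sub>M DS p)" for p
    using indep_pair.U[OF pair] indep_pair.W[OF pair] by (rule measurable_Pair)
  have pair_m: "(\<lambda>\<omega>. (U p \<omega>, W p \<omega>)) \<in> measurable (P p) (DS p \<Otimes>\<^sub>M DS p)" for p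
    using U W by (rule measurable_Pair)
  have L_f: "\<forall>\<^sub>F p in sequentially. AE \<omega> in P p. T p * (L (P p) (K p) (U0 p) (W0 p) \<omega>)\<^sup>2 = f p (U0 p \<omega>, W0 p \<omega>)"
  proof (rule always_eventually, rule allI, rule AE_I2)
    fix p \<omega> assume "\<omega> \<in> space (P p)"
    from indep_pair.L_eq[OF pair this]
    show "T p * (L (P p) (K p) (U0 p) (W0 p) \<omega>)\<^sup>2 = f p (U0 p \<omega>, W0 p \<omega>)"
      by (simp add: f_def K_eq T)
  qed
  have TL_m: "(\<lambda>\<omega>. T p * (L (P p) (K p) (U0 p) (W0 p) \<omega>)\<^sup>2) \<in> borel_measurable (P p)" for p
    using L_m[of p] by measurable
  have "smallop1 P (\<lambda>p \<omega>. f p (U p \<omega>, W p \<omega>))"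
    by (rule smallop1_transfer[OF law[symmetric] pair0_m pair_m f_m L_f TL_m small])
  then have van: "vanishes P (\<lambda>p \<omega>. f p (U p \<omega>, W p \<omega>))"
    by (rule vanishes_smallop1[rotated]) (rule measurable_compose[OF pair_m f_m])
  have "\<forall>\<^sub>F p in sequentially. AE \<omega> in P p. \<bar>Z p \<omega>\<bar> \<le> 1 * \<bar>f p (U p \<omega>, W p \<omega>)\<bar>"
    using eventually_ge_at_top[of 1]
  proof eventually_elim
    case (elim p)
    from bound[OF elim] show ?case
      by eventually_elim (use T_nonneg[of p] in \<open>simp add: f_def abs_mult\<close>)
  qed
  then show ?thesis by (rule vanishes_AE_bound[OF prob van])
qed

lemma rates:
  "(\<lambda>p. \<tau> p * (ap p)\<^sup>2) \<longlonglongrightarrow> 0" "(\<lambda>p. \<tau>X p * (bp p)\<^sup>2) \<longlonglongrightarrow> 0" "(\<lambda>p. \<tau>Y p * (cp p)\<^sup>2) \<longlonglongrightarrow> 0"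
proof -
  have nonneg: "0 \<le> \<tau> p * (ap p)\<^sup>2" "0 \<le> \<tau>X p * (bp p)\<^sup>2" "0 \<le> \<tau>Y p * (cp p)\<^sup>2" for p
    using tau_nonneg[of p] by auto
  show "(\<lambda>p. \<tau> p * (ap p)\<^sup>2) \<longlonglongrightarrow> 0"
    by (rule tendsto_sandwich[OF _ _ tendsto_const ii_rate]) (use nonneg in \<open>auto intro!: always_eventually add_nonneg_nonneg\<close>)
  show "(\<lambda>p. \<tau>X p * (bp p)\<^sup>2) \<longlonglongrightarrow> 0"
    by (rule tendsto_sandwich[OF _ _ tendsto_const ii_rate]) (use nonneg in \<open>auto intro!: always_eventually add_increasing add_increasing2\<close>)
  show "(\<lambda>p. \<tau>Y p * (cp p)\<^sup>2) \<longlonglongrightarrow> 0"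
    by (rule tendsto_sandwich[OF _ _ tendsto_const ii_rate]) (use nonneg in \<open>auto intro!: always_eventually add_increasing\<close>)
qed

lemma vanishes_R: "e \<in> entries n m \<Longrightarrow> vanishes P (\<lambda>p. R p e)"
proof (erule entries_cases)
  fix k l assume e: "e = XY k l" and kl: "k \<in> {1..n}" "l \<in> {1..m}"
  show ?thesis
  proof (rule vanishes_R_aux[OF _ ii_XY rates(1) tau_eq sample_measurable(1)[OF kl(1)] sample_measurable(2)[OF kl(2)]])
    fix p :: nat assume "1 \<le> p"
    then show "AE \<omega> in P p. \<bar>R p e \<omega>\<bar> \<le> \<tau> p * ((dist_K2 p (\<rho> p) (Xs p k \<omega>) (Ys p l \<omega>) - (\<tau> p)\<^sup>2) / (\<tau> p)\<^sup>2)\<^sup>2"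
      using indep_pair.remainder_bound[OF pairs(4)[OF kl, of p], unfolded tau_samples(1)[OF kl] sample_X[OF kl(1)] sample_Y[OF kl(2)],
          OF tau_pos(1)]
      by (simp add: R_def V_def e K_eq)
  qed (simp_all add: sample_law(1)[OF kl] population_law)
next
  fix s t assume e: "e = XX s t" and st: "s \<in> {1..n}" "t \<in> {1..n}" "s \<noteq> t"
  show ?thesis
  proof (rule vanishes_R_aux[OF _ ii_X rates(2) tauX_eq sample_measurable(1)[OF st(1)] sample_measurable(1)[OF st(2)]])
    fix p :: nat assume "1 \<le> p"
    then show "AE \<omega> in P p. \<bar>R p e \<omega>\<bar> \<le> \<tau>X p * ((dist_K2 p (\<rho> p) (Xs p s \<omega>) (Xs p t \<omega>) - (\<tau>X p)\<^sup>2) / (\<tau>X p)\<^sup>2)\<^sup>2"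
      using indep_pair.remainder_bound[OF pairs(5)[OF st, of p], unfolded tau_samples(2)[OF st] sample_X[OF st(1)] sample_X[OF st(2)],
          OF tau_pos(2)]
      by (simp add: R_def V_def e K_eq)
  qed (simp_all add: sample_law(2)[OF st] population_law)
next
  fix s t assume e: "e = YY s t" and st: "s \<in> {1..m}" "t \<in> {1..m}" "s \<noteq> t"
  show ?thesis
  proof (rule vanishes_R_aux[OF _ ii_Y rates(3) tauY_eq sample_measurable(2)[OF st(1)] sample_measurable(2)[OF st(2)]])
    fix p :: nat assume "1 \<le> p"
    then show "AE \<omega> in P p. \<bar>R p e \<omega>\<bar> \<le> \<tau>Y p * ((dist_K2 p (\<rho> p) (Ys p s \<omega>) (Ys p t \<omega>) - (\<tau>Y p)\<^sup>2) / (\<tau>Y p)\<^sup>2)\<^sup>2"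
      using indep_pair.remainder_bound[OF pairs(6)[OF st, of p], unfolded tau_samples(3)[OF st] sample_Y[OF st(1)] sample_Y[OF st(2)],
          OF tau_pos(3)]
      by (simp add: R_def V_def e K_eq)
  qed (simp_all add: sample_law(3)[OF st] population_law)
qed

lemma scaled_L_eq:
  assumes "indep_pair p (d p) (\<rho> p) (P p) U W" "\<omega> \<in> space (P p)"
    and t: "t = tau (P p) (K p) U W" "0 < t"
  shows "t * L (P p) (K p) U W \<omega> = (1 / t) * dist_K2 p (\<rho> p) (U \<omega>) (W \<omega>) - t"
proof -
  have "t * ((k - t\<^sup>2) / t\<^sup>2) = (1 / t) * k - t" for k
    using t(2) by (simp add: power2_eq_square field_simps)
  then show ?thesis
    using indep_pair.L_eq[OF assms(1,2)] by (simp only: K_eq t(1))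
qed

lemma L_measurable:
  assumes "indep_pair p (d p) (\<rho> p) (P p) U W"
  shows "L (P p) (K p) U W \<in> borel_measurable (P p)"
proof -
  interpret indep_pair p "d p" "\<rho> p" "P p" U W by fact
  note [measurable] = dist_K_measurable
  have "(\<lambda>\<omega>. (\<lambda>z. dist_K p (\<rho> p) (fst z) (snd z)) (U \<omega>, W \<omega>)) \<in> borel_measurable (P p)" by measurable
  then show ?thesis unfolding L_def[abs_def] K_eq by simp
qed

lemma mean_dist_PX_PY_measurable:
  "mean_dist p (\<rho> p) (PX p) \<in> borel_measurable (DS p)" "mean_dist p (\<rho> p) (PY p) \<in> borel_measurable (DS p)"
proof -
  interpret ground_distances p "d p" "\<rho> p" by (rule ground_distances)
  interpret prob_space "P p" by (rule prob)
  show "mean_dist p (\<rho> p) (PX p) \<in> borel_measurable (DS p)" "mean_dist p (\<rho> p) (PY p) \<in> borel_measurable (DS p)"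
    by (intro mean_dist_measurable prob_space_distr population_measurable; simp)+
qed

text \<open>The quantities in (iv) are affine in squared distances, so independence evaluates their
  conditional expectations as \<open>\<eta>X\<close> and \<open>\<eta>Y\<close> at the population
  vectors. Equality in law moves them to each observation.\<close>

lemma vanishes_\<eta>:
  "k \<in> {1..n} \<Longrightarrow> vanishes P (\<lambda>p \<omega>. \<eta>X p (Xs p k \<omega>))"
  "l \<in> {1..m} \<Longrightarrow> vanishes P (\<lambda>p \<omega>. \<eta>Y p (Ys p l \<omega>))"
proof -
  note [measurable] = mean_dist_PX_PY_measurable L_measurable[OF pairs(1)] L_measurable[OF pairs(2)] L_measurable[OF pairs(3)]
  have \<eta>_m[measurable]: "\<eta>X p \<in> borel_measurable (DS p)" "\<eta>Y p \<in> borel_measurable (DS p)" for p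
    unfolding \<eta>X_def \<eta>Y_def by measurable
  show "vanishes P (\<lambda>p \<omega>. \<eta>X p (Xs p k \<omega>))" if k: "k \<in> {1..n}"
  proof (rule vanishes_smallop1)
    show "(\<lambda>\<omega>. \<eta>X p (Xs p k \<omega>)) \<in> borel_measurable (P p)" for p
      using sample_measurable(1)[OF k, of p] by measurable
    show "smallop1 P (\<lambda>p \<omega>. \<eta>X p (Xs p k \<omega>))"
    proof (rule smallop1_transfer[OF _ population_measurable(1) sample_measurable(1)[OF k] \<eta>_m(1) _ _ iv_X])
      show "cond_exp_given (P p) (DS p) (X p) (\<lambda>\<omega>. \<tau> p * L (P p) (K p) (X p) (Y p) \<omega> - \<tau>X p * L (P p) (K p) (X p) (X' p) \<omega>)
          \<in> borel_measurable (P p)" for p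
        by (rule prob_space.cond_exp_given_measurable[OF prob population_measurable(1)])
      show "\<forall>\<^sub>F p in sequentially. AE \<omega> in P p. cond_exp_given (P p) (DS p) (X p)
         (\<lambda>\<omega>. \<tau> p * L (P p) (K p) (X p) (Y p) \<omega> - \<tau>X p * L (P p) (K p) (X p) (X' p) \<omega>) \<omega> = \<eta>X p (X p \<omega>)"
        using eventually_ge_at_top[of 1]
      proof eventually_elim
        case (elim p)
        interpret prob_space "P p" by (rule prob)
        have EB: "AE \<omega> in P p. cond_exp_given (P p) (DS p) (X p) (\<lambda>\<omega>. dist_K2 p (\<rho> p) (X p \<omega>) (X' p \<omega>)) \<omega> = mean_dist p (\<rho> p) (PX p) (X p \<omega>)"
          using indep_pair.cond_exp_K2(1)[OF pairs(2)[of p]] by (simp add: copy_X)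
        show ?case
          unfolding \<eta>X_def
        proof (rule cond_exp_given_affine[where U="X p" and N="DS p"
              and A="\<lambda>\<omega>. dist_K2 p (\<rho> p) (X p \<omega>) (Y p \<omega>)" and B="\<lambda>\<omega>. dist_K2 p (\<rho> p) (X p \<omega>) (X' p \<omega>)"
              and \<alpha>="mean_dist p (\<rho> p) (PY p)" and \<beta>="mean_dist p (\<rho> p) (PX p)"
              and a="1 / \<tau> p" and b="1 / \<tau>X p" and c="\<tau> p - \<tau>X p",
              OF population_measurable(1)[of p] indep_pair.integrable_K2[OF pairs(1)[of p]]
            indep_pair.integrable_K2[OF pairs(2)[of p]] indep_pair.cond_exp_K2(1)[OF pairs(1)[of p]] EB])
          show "(\<lambda>\<omega>. \<tau> p * L (P p) (K p) (X p) (Y p) \<omega> - \<tau>X p * L (P p) (K p) (X p) (X' p) \<omega>) \<in> borel_measurable (P p)"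
            by measurable
          fix \<omega> assume \<omega>: "\<omega> \<in> space (P p)"
          show "\<tau> p * L (P p) (K p) (X p) (Y p) \<omega> - \<tau>X p * L (P p) (K p) (X p) (X' p) \<omega>
            = 1 / \<tau> p * dist_K2 p (\<rho> p) (X p \<omega>) (Y p \<omega>) - 1 / \<tau>X p * dist_K2 p (\<rho> p) (X p \<omega>) (X' p \<omega>) - (\<tau> p - \<tau>X p)"
            using scaled_L_eq[OF pairs(1) \<omega> tau_eq tau_pos(1)[OF elim]] scaled_L_eq[OF pairs(2) \<omega> tauX_eq tau_pos(2)[OF elim]]
            by simp
        qed
      qed
    qed (rule sample_X[OF k, symmetric])
  qed
  show "vanishes P (\<lambda>p \<omega>. \<eta>Y p (Ys p l \<omega>))" if l: "l \<in> {1..m}"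
  proof (rule vanishes_smallop1)
    show "(\<lambda>\<omega>. \<eta>Y p (Ys p l \<omega>)) \<in> borel_measurable (P p)" for p
      using sample_measurable(2)[OF l, of p] by measurable
    show "smallop1 P (\<lambda>p \<omega>. \<eta>Y p (Ys p l \<omega>))"
    proof (rule smallop1_transfer[OF _ population_measurable(2) sample_measurable(2)[OF l] \<eta>_m(2) _ _ iv_Y])
      show "cond_exp_given (P p) (DS p) (Y p) (\<lambda>\<omega>. \<tau> p * L (P p) (K p) (X p) (Y p) \<omega> - \<tau>Y p * L (P p) (K p) (Y p) (Y' p) \<omega>)
          \<in> borel_measurable (P p)" for p
        by (rule prob_space.cond_exp_given_measurable[OF prob population_measurable(2)])
      show "\<forall>\<^sub>F p in sequentially. AE \<omega> in P p. cond_exp_given (P p) (DS p) (Y p)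
         (\<lambda>\<omega>. \<tau> p * L (P p) (K p) (X p) (Y p) \<omega> - \<tau>Y p * L (P p) (K p) (Y p) (Y' p) \<omega>) \<omega> = \<eta>Y p (Y p \<omega>)"
        using eventually_ge_at_top[of 1]
      proof eventually_elim
        case (elim p)
        interpret prob_space "P p" by (rule prob)
        have EB: "AE \<omega> in P p. cond_exp_given (P p) (DS p) (Y p) (\<lambda>\<omega>. dist_K2 p (\<rho> p) (Y p \<omega>) (Y' p \<omega>)) \<omega> = mean_dist p (\<rho> p) (PY p) (Y p \<omega>)"
          using indep_pair.cond_exp_K2(1)[OF pairs(3)[of p]] by (simp add: copy_Y)
        \<comment> \<open>In the pair of \<open>X\<close> and \<open>Y\<close> the conditioning
          variable is now the second component.\<close>
        have EA: "AE \<omega> in P p. cond_exp_given (P p) (DS p) (Y p) (\<lambda>\<omega>. dist_K2 p (\<rho> p) (X p \<omega>) (Y p \<omega>)) \<omega> = mean_dist p (\<rho> p) (PX p) (Y p \<omega>)"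
          by (rule indep_pair.cond_exp_K2(2)[OF pairs(1)[of p]])
        show ?case
          unfolding \<eta>Y_def
        proof (rule cond_exp_given_affine[where U="Y p" and N="DS p"
              and A="\<lambda>\<omega>. dist_K2 p (\<rho> p) (X p \<omega>) (Y p \<omega>)" and B="\<lambda>\<omega>. dist_K2 p (\<rho> p) (Y p \<omega>) (Y' p \<omega>)"
              and \<alpha>="mean_dist p (\<rho> p) (PX p)" and \<beta>="mean_dist p (\<rho> p) (PY p)"
              and a="1 / \<tau> p" and b="1 / \<tau>Y p" and c="\<tau> p - \<tau>Y p",
              OF population_measurable(2)[of p] indep_pair.integrable_K2[OF pairs(1)[of p]]
            indep_pair.integrable_K2[OF pairs(3)[of p]] EA EB])
          show "(\<lambda>\<omega>. \<tau> p * L (P p) (K p) (X p) (Y p) \<omega> - \<tau>Y p * L (P p) (K p) (Y p) (Y' p) \<omega>) \<in> borel_measurable (P p)"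
            by measurable
          fix \<omega> assume \<omega>: "\<omega> \<in> space (P p)"
          show "\<tau> p * L (P p) (K p) (X p) (Y p) \<omega> - \<tau>Y p * L (P p) (K p) (Y p) (Y' p) \<omega>
            = 1 / \<tau> p * dist_K2 p (\<rho> p) (X p \<omega>) (Y p \<omega>) - 1 / \<tau>Y p * dist_K2 p (\<rho> p) (Y p \<omega>) (Y' p \<omega>) - (\<tau> p - \<tau>Y p)"
            using scaled_L_eq[OF pairs(1) \<omega> tau_eq tau_pos(1)[OF elim]] scaled_L_eq[OF pairs(3) \<omega> tauY_eq tau_pos(3)[OF elim]]
            by simp
        qed
      qed
    qed (rule sample_Y[OF l, symmetric])
  qed
qed

end

section \<open>The limit laws\<close>

lemma prob_space_entries_limit: "prob_space (entries_limit n m \<sigma>2 \<sigma>X2 \<sigma>Y2)"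
  unfolding entries_limit_def by (rule prob_space_PiM) (rule prob_space_normal_law)

lemma sets_entries_limit: "sets (entries_limit n m \<sigma>2 \<sigma>X2 \<sigma>Y2) = sets (PiM (entries n m) (\<lambda>_. borel))"
  unfolding entries_limit_def by (rule sets_PiM_cong) simp_all

lemma a_nm_pos:
  assumes "4 \<le> n" "4 \<le> m"
  shows "0 < a_nm n m"
proof -
  have "0 < 1 / (real n * real m)" "0 < 1 / (2 * real n * (real n - 1))" "0 < 1 / (2 * real m * (real m - 1))"
    using assms by auto
  then have "0 < 1 / (real n * real m) + 1 / (2 * real n * (real n - 1)) + 1 / (2 * real m * (real m - 1))"
    by linarith
  then show ?thesis unfolding a_nm_def by (rule real_sqrt_gt_zero)
qed

lemma AE_normal_law_neq: "AE z in normal_law 0 1. z \<noteq> (c::real)"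
proof -
  have "AE z in lborel. z \<noteq> c" by (rule AE_lborel_singleton)
  then have "AE z in lborel. 0 < ennreal (std_normal_density z) \<longrightarrow> z \<noteq> c" by eventually_elim simp
  then show ?thesis unfolding normal_law_0_1 by (subst AE_density) simp_all
qed

lemma distr_normal_shift:
  assumes M: "prob_space M" and sets_M: "sets M = sets borel"
  shows "normal_law c 1 \<Otimes>\<^sub>M M = distr (normal_law 0 1 \<Otimes>\<^sub>M M) (borel \<Otimes>\<^sub>M borel) (\<lambda>(z, q). (c + z, q))"
proof -
  interpret M: prob_space M by fact
  note [measurable_cong] = sets_M
  have "normal_law c 1 = distr (normal_law 0 1) borel (\<lambda>z. c + z)"
    unfolding normal_law_0_1 by (simp add: normal_law_def)
  moreover have "distr M borel (\<lambda>q. q) = M" by (rule distr_id2) (simp add: sets_M)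
  moreover have "distr (normal_law 0 1) borel (\<lambda>z. c + z) \<Otimes>\<^sub>M distr M borel (\<lambda>q. q)
    = distr (normal_law 0 1 \<Otimes>\<^sub>M M) (borel \<Otimes>\<^sub>M borel) (\<lambda>(z, q). (c + z, q))"
    by (rule pair_measure_distr) (auto simp: \<open>distr M borel (\<lambda>q. q) = M\<close> M.sigma_finite_measure_axioms)
  ultimately show ?thesis by simp
qed

context
  fixes n m :: nat and \<sigma>2 \<sigma>X2 \<sigma>Y2 :: real
  assumes n: "4 \<le> n" and m: "4 \<le> m"
    and nonneg: "0 \<le> \<sigma>2" "0 \<le> \<sigma>X2" "0 \<le> \<sigma>Y2" and nondeg: "\<sigma>2 \<noteq> 0 \<or> \<sigma>X2 \<noteq> 0 \<or> \<sigma>Y2 \<noteq> 0"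
begin

private abbreviation (input) "\<mu> \<equiv> entries_limit n m \<sigma>2 \<sigma>X2 \<sigma>Y2"
private abbreviation (input) "\<sigma> \<equiv> sigma_nm n m \<sigma>2 \<sigma>X2 \<sigma>Y2"
private abbreviation (input) "M \<equiv> M_law n m \<sigma>2 \<sigma>X2 \<sigma>Y2"

lemma stat_pair_measurable: "(\<lambda>w. (lin_stat n m w, quad_stat n m w)) \<in> measurable \<mu> (borel \<Otimes>\<^sub>M borel)"
proof -
  note [measurable_cong] = sets_entries_limit
  note [measurable] = quad_stat_measurable[OF n m]
  show ?thesis by measurable
qed

text \<open>For a fixed value of the quadratic form the equation has a single solution in the
  Gaussian coordinate, since \<open>\<sigma>\<close> is positive, and a single point is null.
  Independence turns this into a statement about the joint law.\<close>

lemma ratio_no_atom: "AE w in \<mu>. lin_stat n m w + \<Delta> - t * (a_nm n m * sqrt (quad_stat n m w)) \<noteq> 0"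
proof -
  interpret A: prob_space "normal_law 0 1" by (rule prob_space_normal_law)
  interpret B: prob_space M by (rule prob_space_M_law)
  interpret pair_sigma_finite "normal_law 0 1" M ..
  have \<sigma>: "0 < \<sigma>" by (rule sigma_nm_pos[OF n m nonneg nondeg])
  let ?Q = "\<lambda>z q. \<sigma> * z + \<Delta> - t * (a_nm n m * sqrt q) \<noteq> 0"
  have Q_m: "{x \<in> space (normal_law 0 1 \<Otimes>\<^sub>M M). ?Q (fst x) (snd x)} \<in> sets (normal_law 0 1 \<Otimes>\<^sub>M M)"
    by measurable
  have "AE q in M. AE z in normal_law 0 1. ?Q z q"
  proof (rule AE_I2)
    fix q
    have "?Q z q" if "z \<noteq> (t * (a_nm n m * sqrt q) - \<Delta>) / \<sigma>" for z
      using that \<sigma> by (auto simp: field_simps)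
    then show "AE z in normal_law 0 1. ?Q z q"
      using AE_normal_law_neq[of "(t * (a_nm n m * sqrt q) - \<Delta>) / \<sigma>"] by (auto elim: eventually_mono)
  qed
  \<comment> \<open>The exclusion is natural for fixed \<open>q\<close>, while the product measure
    has the Gaussian coordinate first, hence the exchange of quantifiers.\<close>
  then have "AE z in normal_law 0 1. AE q in M. ?Q z q"
    by (rule iffD2[OF AE_commute[OF Q_m]])
  then have "AE x in normal_law 0 1 \<Otimes>\<^sub>M M. ?Q (fst x) (snd x)"
    using Q_m by (intro AE_pair_measure) auto
  then have "AE x in distr (normal_law 0 1 \<Otimes>\<^sub>M M) (borel \<Otimes>\<^sub>M borel) (\<lambda>(z, q). (\<sigma> * z, q)).
      fst x + \<Delta> - t * (a_nm n m * sqrt (snd x)) \<noteq> 0"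
    by (subst AE_distr_iff) (auto simp: case_prod_unfold)
  then show ?thesis
    unfolding limit_statistics_law(1)[OF n m nonneg nondeg, symmetric]
    by (subst (asm) AE_distr_iff[OF stat_pair_measurable]) auto
qed

text \<open>The shift \<open>\<Delta>\<close> is absorbed into the mean of the Gaussian variable.
  With \<open>\<Delta> = 0\<close> the same law serves for the centered statistic.\<close>

lemma ratio_limit_law:
  "distr \<mu> borel (\<lambda>w. (lin_stat n m w + \<Delta>) / (a_nm n m * sqrt (quad_stat n m w)))
    = distr (normal_law (\<Delta> / \<sigma>) 1 \<Otimes>\<^sub>M M) borel (\<lambda>(z, q). \<sigma> * z / (a_nm n m * sqrt q))"
proof -
  have \<sigma>: "0 < \<sigma>" by (rule sigma_nm_pos[OF n m nonneg nondeg])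
  have scale: "\<sigma> * (\<Delta> / \<sigma> + z) = \<sigma> * z + \<Delta>" for z
    using \<sigma> by (simp add: field_simps)
  have "distr \<mu> borel (\<lambda>w. (lin_stat n m w + \<Delta>) / (a_nm n m * sqrt (quad_stat n m w)))
    = distr (distr \<mu> (borel \<Otimes>\<^sub>M borel) (\<lambda>w. (lin_stat n m w, quad_stat n m w))) borel (\<lambda>(z, q). (z + \<Delta>) / (a_nm n m * sqrt q))"
    by (subst distr_distr[OF _ stat_pair_measurable]) (simp_all add: comp_def)
  also have "\<dots> = distr (normal_law 0 1 \<Otimes>\<^sub>M M) borel (\<lambda>(z, q). (\<sigma> * z + \<Delta>) / (a_nm n m * sqrt q))"
    unfolding limit_statistics_law(1)[OF n m nonneg nondeg]
    by (subst distr_distr) (simp_all add: comp_def case_prod_unfold)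
  also have "\<dots> = distr (distr (normal_law 0 1 \<Otimes>\<^sub>M M) (borel \<Otimes>\<^sub>M borel) (\<lambda>(z, q). (\<Delta> / \<sigma> + z, q))) borel
      (\<lambda>(z, q). \<sigma> * z / (a_nm n m * sqrt q))"
    by (subst distr_distr) (simp_all add: comp_def case_prod_unfold scale)
  also have "\<dots> = distr (normal_law (\<Delta> / \<sigma>) 1 \<Otimes>\<^sub>M M) borel (\<lambda>(z, q). \<sigma> * z / (a_nm n m * sqrt q))"
    by (subst distr_normal_shift[OF prob_space_M_law sets_M_law]) (rule refl)
  finally show ?thesis .
qed

text \<open>For equal variances \<open>\<sigma>\<close> is \<open>sqrt \<sigma>2\<close> times
  \<open>a_nm n m\<close>, so the unknown variance cancels from the ratio. The normalisation by
  \<open>a_nm\<close> is chosen for this purpose.\<close>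

lemma ratio_limit_student:
  assumes eq: "\<sigma>X2 = \<sigma>2" "\<sigma>Y2 = \<sigma>2"
  shows "distr \<mu> borel (\<lambda>w. lin_stat n m w / (a_nm n m * sqrt (quad_stat n m w)))
    = student_t ((n - 1) * (m - 1) + v n + v m)"
proof -
  let ?D = "(n - 1) * (m - 1) + v n + v m"
  have \<sigma>2: "0 < \<sigma>2" using nonneg nondeg eq by auto
  have "\<sigma> = sqrt (\<sigma>2 * (1 / (real n * real m) + 1 / (2 * real n * (real n - 1)) + 1 / (2 * real m * (real m - 1))))"
    by (simp add: sigma_nm_def eq distrib_left)
  then have \<sigma>: "\<sigma> = sqrt \<sigma>2 * a_nm n m" by (simp only: real_sqrt_mult a_nm_def)
  have ratio: "\<sigma> * z / (a_nm n m * sqrt (\<sigma>2 * q)) = z / sqrt q" for z q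
    using \<sigma>2 a_nm_pos[OF n m] by (simp add: \<sigma> real_sqrt_mult)
  have "distr \<mu> borel (\<lambda>w. lin_stat n m w / (a_nm n m * sqrt (quad_stat n m w)))
    = distr (distr \<mu> (borel \<Otimes>\<^sub>M borel) (\<lambda>w. (lin_stat n m w, quad_stat n m w))) borel (\<lambda>(z, q). z / (a_nm n m * sqrt q))"
    by (subst distr_distr[OF _ stat_pair_measurable]) (simp_all add: comp_def)
  also have "\<dots> = distr (normal_law 0 1 \<Otimes>\<^sub>M chi_square ?D) borel (\<lambda>(z, q). \<sigma> * z / (a_nm n m * sqrt (\<sigma>2 * (q / real ?D))))"
    unfolding limit_statistics_law(2)[OF n m nonneg nondeg eq]
    by (subst distr_distr) (simp_all add: comp_def case_prod_unfold)
  also have "\<dots> = student_t ?D"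
    unfolding student_t_def ratio ..
  finally show ?thesis .
qed

end

section \<open>Limit of the two-sample statistics\<close>

context two_sample
begin

lemma K_measurable:
  assumes "U \<in> measurable (P p) (DS p)" "W \<in> measurable (P p) (DS p)"
  shows "(\<lambda>\<omega>. K p (U \<omega>) (W \<omega>)) \<in> borel_measurable (P p)"
proof -
  interpret ground_distances p "d p" "\<rho> p" by (rule ground_distances)
  show ?thesis
    using measurable_compose[OF measurable_Pair[OF assms] dist_K_measurable] by (simp add: K_eq)
qed

lemma statistics_measurable:
  "(\<lambda>\<omega>. energy_stat (K p) n m (\<lambda>k. Xs p k \<omega>) (\<lambda>l. Ys p l \<omega>)) \<in> borel_measurable (P p)"
  "(\<lambda>\<omega>. S_stat (K p) n m (\<lambda>k. Xs p k \<omega>) (\<lambda>l. Ys p l \<omega>)) \<in> borel_measurable (P p)"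
proof -
  note K_m = K_measurable sample_measurable
  have K_hat_m: "(\<lambda>\<omega>. K_hat (K p) n m (\<lambda>k. Xs p k \<omega>) (\<lambda>l. Ys p l \<omega>) k l) \<in> borel_measurable (P p)"
    if "k \<in> {1..n}" "l \<in> {1..m}" for k l
    unfolding K_hat_def using that
    by (intro borel_measurable_add borel_measurable_diff borel_measurable_times borel_measurable_sum borel_measurable_const K_m) auto
  have UX_m: "(\<lambda>\<omega>. U_centered n (\<lambda>i j. K p (Xs p i \<omega>) (Xs p j \<omega>)) k l) \<in> borel_measurable (P p)"
    if "k \<in> {1..n}" "l \<in> {1..n}" for k l
    unfolding U_centered_def using that
    by (cases "k = l") (simp, simp only: if_False,
        intro borel_measurable_add borel_measurable_diff borel_measurable_times borel_measurable_sum borel_measurable_const K_m, auto)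
  have UY_m: "(\<lambda>\<omega>. U_centered m (\<lambda>i j. K p (Ys p i \<omega>) (Ys p j \<omega>)) k l) \<in> borel_measurable (P p)"
    if "k \<in> {1..m}" "l \<in> {1..m}" for k l
    unfolding U_centered_def using that
    by (cases "k = l") (simp, simp only: if_False,
        intro borel_measurable_add borel_measurable_diff borel_measurable_times borel_measurable_sum borel_measurable_const K_m, auto)
  show "(\<lambda>\<omega>. energy_stat (K p) n m (\<lambda>k. Xs p k \<omega>) (\<lambda>l. Ys p l \<omega>)) \<in> borel_measurable (P p)"
    unfolding energy_stat_def
    by (intro borel_measurable_diff borel_measurable_times borel_measurable_sum borel_measurable_const K_m) auto
  show "(\<lambda>\<omega>. S_stat (K p) n m (\<lambda>k. Xs p k \<omega>) (\<lambda>l. Ys p l \<omega>)) \<in> borel_measurable (P p)"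
    unfolding S_stat_def cdCov2_def D2_def
    by (intro borel_measurable_add borel_measurable_divide borel_measurable_times borel_measurable_sum borel_measurable_const
        borel_measurable_power K_hat_m UX_m UY_m) auto
qed

lemma statistics_expansion:
  assumes \<omega>: "\<omega> \<in> space (P p)"
  shows "S_stat (K p) n m (\<lambda>k. Xs p k \<omega>) (\<lambda>l. Ys p l \<omega>) = quad_stat n m (\<lambda>e. V p e \<omega> + R p e \<omega>)"
    and "energy_stat (K p) n m (\<lambda>k. Xs p k \<omega>) (\<lambda>l. Ys p l \<omega>) = lin_stat n m (\<lambda>e. V p e \<omega> + R p e \<omega>)
      + (2 * \<tau> p - \<tau>X p - \<tau>Y p) + (\<Sum>k=1..n. \<eta>X p (Xs p k \<omega>)) / real n + (\<Sum>l=1..m. \<eta>Y p (Ys p l \<omega>)) / real m"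
proof -
  interpret ground_distances p "d p" "\<rho> p" by (rule ground_distances)
  define g h gx hy where "g k = mean_dist p (\<rho> p) (PY p) (Xs p k \<omega>) / \<tau> p" "h l = mean_dist p (\<rho> p) (PX p) (Ys p l \<omega>) / \<tau> p"
    "gx k = mean_dist p (\<rho> p) (PX p) (Xs p k \<omega>) / \<tau>X p" "hy l = mean_dist p (\<rho> p) (PY p) (Ys p l \<omega>) / \<tau>Y p" for k l
  have Xsp: "Xs p k \<omega> \<in> space (DS p)" if "k \<in> {1..n}" for k using measurable_space[OF sample_measurable(1)[OF that] \<omega>] .
  have Ysp: "Ys p k \<omega> \<in> space (DS p)" if "k \<in> {1..m}" for k using measurable_space[OF sample_measurable(2)[OF that] \<omega>] .
  have sym: "K p x y = K p y x" if "x \<in> space (DS p)" "y \<in> space (DS p)" for x y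
    using dist_K2_sym[OF that] by (simp add: K_eq dist_K_eq)
  have diag: "K p x x = 0" if "x \<in> space (DS p)" for x
    using dist_K_diag[OF that] by (simp add: K_eq)
  have symX: "K p (Xs p s \<omega>) (Xs p t \<omega>) = K p (Xs p t \<omega>) (Xs p s \<omega>)" if "s \<in> {1..n}" "t \<in> {1..n}" for s t
    by (intro sym Xsp that)
  have symY: "K p (Ys p s \<omega>) (Ys p t \<omega>) = K p (Ys p t \<omega>) (Ys p s \<omega>)" if "s \<in> {1..m}" "t \<in> {1..m}" for s t
    by (intro sym Ysp that)
  have diagX: "K p (Xs p s \<omega>) (Xs p s \<omega>) = 0" if "s \<in> {1..n}" for s
    by (intro diag Xsp that)
  have diagY: "K p (Ys p s \<omega>) (Ys p s \<omega>) = 0" if "s \<in> {1..m}" for s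
    by (intro diag Ysp that)
  note * = statistics_of_expansion[where K="K p" and x="\<lambda>k. Xs p k \<omega>" and y="\<lambda>l. Ys p l \<omega>"
      and w="\<lambda>e. V p e \<omega> + R p e \<omega>" and g=g and h=h and gx=gx and hy=hy, OF n m _ _ _ symX symY diagX diagY]
  show "S_stat (K p) n m (\<lambda>k. Xs p k \<omega>) (\<lambda>l. Ys p l \<omega>) = quad_stat n m (\<lambda>e. V p e \<omega> + R p e \<omega>)"
    by (rule *(1)) (simp_all add: R_def g_h_gx_hy_def)
  have "energy_stat (K p) n m (\<lambda>k. Xs p k \<omega>) (\<lambda>l. Ys p l \<omega>) = lin_stat n m (\<lambda>e. V p e \<omega> + R p e \<omega>)
      + (\<Sum>k=1..n. g k - gx k) / real n + (\<Sum>l=1..m. h l - hy l) / real m"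
    by (rule *(2)) (simp_all add: R_def g_h_gx_hy_def)
  \<comment> \<open>The two mean terms of an observation in \<open>X\<close> differ by the
    conditional expectation of (iv) plus \<open>\<tau> p - \<tau>X p\<close>. Averaging leaves this
    constant, and the second sample supplies \<open>\<tau> p - \<tau>Y p\<close>.\<close>
  also have "(\<Sum>k=1..n. g k - gx k) = (\<Sum>k=1..n. \<eta>X p (Xs p k \<omega>)) + real n * (\<tau> p - \<tau>X p)"
  proof -
    have "(\<Sum>k=1..n. g k - gx k) = (\<Sum>k=1..n. \<eta>X p (Xs p k \<omega>) + (\<tau> p - \<tau>X p))"
      by (intro sum.cong refl) (simp add: g_h_gx_hy_def \<eta>X_def)
    then show ?thesis by (simp add: sum.distrib)
  qed
  also have "(\<Sum>l=1..m. h l - hy l) = (\<Sum>l=1..m. \<eta>Y p (Ys p l \<omega>)) + real m * (\<tau> p - \<tau>Y p)"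
  proof -
    have "(\<Sum>l=1..m. h l - hy l) = (\<Sum>l=1..m. \<eta>Y p (Ys p l \<omega>) + (\<tau> p - \<tau>Y p))"
      by (intro sum.cong refl) (simp add: g_h_gx_hy_def \<eta>Y_def)
    then show ?thesis by (simp add: sum.distrib)
  qed
  finally show "energy_stat (K p) n m (\<lambda>k. Xs p k \<omega>) (\<lambda>l. Ys p l \<omega>) = lin_stat n m (\<lambda>e. V p e \<omega> + R p e \<omega>)
      + (2 * \<tau> p - \<tau>X p - \<tau>Y p) + (\<Sum>k=1..n. \<eta>X p (Xs p k \<omega>)) / real n + (\<Sum>l=1..m. \<eta>Y p (Ys p l \<omega>)) / real m"
    using n m by (simp add: add_divide_distrib)
qed

text \<open>The limiting variances are arbitrary reals a priori; they inherit their sign from the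
  second moments that converge to them.\<close>

lemma variances_nonneg: "0 \<le> \<sigma>2" "0 \<le> \<sigma>X2" "0 \<le> \<sigma>Y2"
proof -
  have e: "XY 1 1 \<in> entries n m" "XX 1 2 \<in> entries n m" "YY 1 2 \<in> entries n m" using n m by (auto simp: entries_def)
  have lim: "0 \<le> s" if "second_moment_tendsto P Z s" for Z s
    using that unfolding second_moment_tendsto_def by (auto intro!: LIMSEQ_le_const)
  show "0 \<le> \<sigma>2" "0 \<le> \<sigma>X2" "0 \<le> \<sigma>Y2"
    using lim[OF iii_XY[OF e(1)]] lim[OF iii_X[OF e(2)]] lim[OF iii_Y[OF e(3)]] by auto
qed

text \<open>The free centering \<open>c\<close> treats all claims at once: the centered statistic
  has \<open>c p\<close> equal to \<open>2 * \<tau> p - \<tau>X p - \<tau>Y p\<close> and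
  \<open>\<Delta> = 0\<close>, while \<open>c p = 0\<close> gives \<open>T_stat\<close>.\<close>

lemma statistic_conv:
  assumes c: "(\<lambda>p. 2 * \<tau> p - \<tau>X p - \<tau>Y p - c p) \<longlonglongrightarrow> \<Delta>"
  shows "weak_conv_m
     (\<lambda>p. distr (P p) borel (\<lambda>\<omega>. (energy_stat (K p) n m (\<lambda>k. Xs p k \<omega>) (\<lambda>l. Ys p l \<omega>) - c p)
        / (a_nm n m * sqrt (S_stat (K p) n m (\<lambda>k. Xs p k \<omega>) (\<lambda>l. Ys p l \<omega>)))))
     (distr (entries_limit n m \<sigma>2 \<sigma>X2 \<sigma>Y2) borel (\<lambda>w. (lin_stat n m w + \<Delta>) / (a_nm n m * sqrt (quad_stat n m w))))"
proof -
  let ?I = "entries n m" and ?\<mu> = "entries_limit n m \<sigma>2 \<sigma>X2 \<sigma>Y2" and ?a = "a_nm n m"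
  obtain C where C: "C \<ge> 0" "\<And>w w' \<epsilon>. (\<And>e. e \<in> ?I \<Longrightarrow> \<bar>w e - w' e\<bar> \<le> \<epsilon>) \<Longrightarrow>
      \<bar>lin_stat n m w - lin_stat n m w'\<bar> \<le> C * \<epsilon> \<and> \<bar>sqrt (quad_stat n m w) - sqrt (quad_stat n m w')\<bar> \<le> C * \<epsilon>"
    using stat_lipschitz[OF n m] by blast
  note a = a_nm_pos[OF n m]
  have sum_R: "vanishes P (\<lambda>p \<omega>. \<Sum>e\<in>?I. \<bar>R p e \<omega>\<bar>)"
  proof (rule vanishes_sum[OF prob])
    fix e assume "e \<in> ?I"
    show "vanishes P (\<lambda>p \<omega>. \<bar>R p e \<omega>\<bar>)"
      by (rule vanishes_AE_bound[OF prob vanishes_R[OF \<open>e \<in> ?I\<close>], where C=1]) auto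
  qed
  \<comment> \<open>The sum of all absolute remainders dominates each one and serves as the
    tolerance in the Lipschitz estimate.\<close>
  have close: "\<bar>lin_stat n m (\<lambda>e. V p e \<omega> + R p e \<omega>) - lin_stat n m (\<lambda>e\<in>?I. V p e \<omega>)\<bar> \<le> C * (\<Sum>e\<in>?I. \<bar>R p e \<omega>\<bar>)
      \<and> \<bar>sqrt (quad_stat n m (\<lambda>e. V p e \<omega> + R p e \<omega>)) - sqrt (quad_stat n m (\<lambda>e\<in>?I. V p e \<omega>))\<bar> \<le> C * (\<Sum>e\<in>?I. \<bar>R p e \<omega>\<bar>)" for p \<omega>
    by (rule C(2)) (auto intro: member_le_sum)
  have lin_close: "vanishes P (\<lambda>p \<omega>. lin_stat n m (\<lambda>e. V p e \<omega> + R p e \<omega>) - lin_stat n m (\<lambda>e\<in>?I. V p e \<omega>))"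
    by (rule vanishes_AE_bound[OF prob sum_R, where C=C]) (use close in \<open>auto simp: sum_nonneg\<close>)
  have quad_close: "vanishes P (\<lambda>p \<omega>. sqrt (S_stat (K p) n m (\<lambda>k. Xs p k \<omega>) (\<lambda>l. Ys p l \<omega>)) - sqrt (quad_stat n m (\<lambda>e\<in>?I. V p e \<omega>)))"
    by (rule vanishes_AE_bound[OF prob sum_R, where C=C])
       (use close in \<open>auto simp: sum_nonneg statistics_expansion intro!: always_eventually AE_I2\<close>)
  have \<eta>: "vanishes P (\<lambda>p \<omega>. (1 / real n) * (\<Sum>k=1..n. \<eta>X p (Xs p k \<omega>)) + (1 / real m) * (\<Sum>l=1..m. \<eta>Y p (Ys p l \<omega>)))"
    by (intro vanishes_add[OF prob] vanishes_cmult[OF prob] vanishes_sum[OF prob] vanishes_\<eta>) auto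
  have \<Delta>: "vanishes P (\<lambda>p \<omega>. 2 * \<tau> p - \<tau>X p - \<tau>Y p - c p - \<Delta>)"
    by (rule vanishes_const) (use c in \<open>simp add: LIM_zero_iff\<close>)
  note total = vanishes_add[OF prob vanishes_add[OF prob lin_close \<eta>] \<Delta>]
  have energy_close: "vanishes P (\<lambda>p \<omega>. energy_stat (K p) n m (\<lambda>k. Xs p k \<omega>) (\<lambda>l. Ys p l \<omega>) - c p - (lin_stat n m (\<lambda>e\<in>?I. V p e \<omega>) + \<Delta>))"
    by (rule vanishes_AE_bound[OF prob total, where C=1])
       (auto simp: statistics_expansion intro!: always_eventually AE_I2)
  show ?thesis
  proof (rule ratio_weak_conv[OF prob, where I="?I" and V=V and f="\<lambda>w. lin_stat n m w + \<Delta>" and g="\<lambda>w. ?a * sqrt (quad_stat n m w)"])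
    show "joint_conv P ?I V ?\<mu>" using iii_conv unfolding V_def .
    show "V p e \<in> borel_measurable (P p)" if "e \<in> ?I" for p e using that by (rule V_measurable)
    show "continuous_on (\<Pi>\<^sub>E e\<in>?I. UNIV) (\<lambda>w. lin_stat n m w + \<Delta>)"
      by (intro continuous_intros lin_stat_continuous)
    show "continuous_on (\<Pi>\<^sub>E e\<in>?I. UNIV) (\<lambda>w. ?a * sqrt (quad_stat n m w))"
      by (intro continuous_intros quad_stat_continuous n m)
    show "vanishes P (\<lambda>p \<omega>. ?a * sqrt (S_stat (K p) n m (\<lambda>k. Xs p k \<omega>) (\<lambda>l. Ys p l \<omega>)) - ?a * sqrt (quad_stat n m (\<lambda>e\<in>?I. V p e \<omega>)))"
      using vanishes_cmult[OF prob quad_close, of ?a] by (simp add: right_diff_distrib)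
    show "AE w in ?\<mu>. 0 < ?a * sqrt (quad_stat n m w)"
      using limit_statistics_law(3)[OF n m variances_nonneg nondegenerate] by eventually_elim (use a in simp)
    show "AE w in ?\<mu>. lin_stat n m w + \<Delta> - t * (?a * sqrt (quad_stat n m w)) \<noteq> 0" for t
      by (rule ratio_no_atom[OF n m variances_nonneg nondegenerate])
    show "(\<lambda>\<omega>. energy_stat (K p) n m (\<lambda>k. Xs p k \<omega>) (\<lambda>l. Ys p l \<omega>) - c p) \<in> borel_measurable (P p)" for p
      by (rule borel_measurable_diff[OF statistics_measurable(1)]) simp
    show "(\<lambda>\<omega>. ?a * sqrt (S_stat (K p) n m (\<lambda>k. Xs p k \<omega>) (\<lambda>l. Ys p l \<omega>))) \<in> borel_measurable (P p)" for p
      using measurable_compose[OF statistics_measurable(2) borel_measurable_sqrt] by (rule borel_measurable_times[OF borel_measurable_const])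
    show "(\<lambda>w. lin_stat n m w + \<Delta>) \<in> borel_measurable (PiM ?I (\<lambda>_. borel))" by measurable
    show "(\<lambda>w. ?a * sqrt (quad_stat n m w)) \<in> borel_measurable (PiM ?I (\<lambda>_. borel))"
      by (intro borel_measurable_times borel_measurable_const measurable_compose[OF quad_stat_measurable[OF n m] borel_measurable_sqrt])
  qed (rule energy_close prob_space_entries_limit sets_entries_limit)+
qed

text \<open>Under equality of the laws the three kinds of entries have as second moment the integral
  of one kernel over one product law, so their limits coincide. Equality of the scales comes first,
  because the kernel involves them.\<close>

lemma null_hypothesis:
  assumes H0: "\<And>p. PX p = PY p"
  shows "\<tau>X p = \<tau> p" "\<tau>Y p = \<tau> p" "\<sigma>X2 = \<sigma>2" "\<sigma>Y2 = \<sigma>2"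
proof -
  have \<tau>_eq: "\<tau>X p = \<tau> p" "\<tau>Y p = \<tau> p" for p
    unfolding tau_eq tauX_eq tauY_eq K_eq pairs[THEN indep_pair.tau_law] by (simp_all add: copy_X copy_Y H0)
  show "\<tau>X p = \<tau> p" "\<tau>Y p = \<tau> p" by (rule \<tau>_eq)+
  have mem: "1 \<in> {1..n}" "2 \<in> {1..n}" "1 \<in> {1..m}" "2 \<in> {1..m}" "(1::nat) \<noteq> 2" using n m by auto
  have e: "XY 1 1 \<in> entries n m" "XX 1 2 \<in> entries n m" "YY 1 2 \<in> entries n m" using n m by (auto simp: entries_def)
  let ?k = "\<lambda>p. \<integral>z. (centered_kernel p (\<rho> p) (PY p) (PY p) (\<tau> p) z)\<^sup>2 \<partial>(PY p \<Otimes>\<^sub>M PY p)"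
  have lim: "?k \<longlonglongrightarrow> s" if "second_moment_tendsto P Z s" "\<And>p. 1 \<le> p \<Longrightarrow> (\<integral>\<omega>. (Z p \<omega>)\<^sup>2 \<partial>P p) = ?k p" for Z s
  proof (rule Lim_transform_eventually)
    show "(\<lambda>p. \<integral>\<omega>. (Z p \<omega>)\<^sup>2 \<partial>P p) \<longlonglongrightarrow> s" using that(1) by (simp add: second_moment_tendsto_def)
    show "\<forall>\<^sub>F p in sequentially. (\<integral>\<omega>. (Z p \<omega>)\<^sup>2 \<partial>P p) = ?k p"
      using eventually_ge_at_top[of 1] by eventually_elim (rule that(2))
  qed
  have 1: "?k \<longlonglongrightarrow> \<sigma>2"
  proof (rule lim[OF iii_XY[OF e(1)]])
    fix p :: nat assume p: "1 \<le> p"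
    show "(\<integral>\<omega>. (H (P p) p (d p) (\<rho> p) (\<tau> p) (Xs p 1) (Ys p 1) \<omega>)\<^sup>2 \<partial>P p) = ?k p"
      using indep_pair.integral_H_square[OF pairs(4)[OF mem(1,3), of p]] tau_pos(1)[OF p]
      unfolding tau_samples(1)[OF mem(1,3)] sample_X[OF mem(1)] sample_Y[OF mem(3)] H0 by simp
  qed
  have 2: "?k \<longlonglongrightarrow> \<sigma>X2"
  proof (rule lim[OF iii_X[OF e(2)]])
    fix p :: nat assume p: "1 \<le> p"
    show "(\<integral>\<omega>. (H (P p) p (d p) (\<rho> p) (\<tau>X p) (Xs p 1) (Xs p 2) \<omega>)\<^sup>2 \<partial>P p) = ?k p"
      using indep_pair.integral_H_square[OF pairs(5)[OF mem(1,2,5), of p]] tau_pos(2)[OF p]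
      unfolding tau_samples(2)[OF mem(1,2,5)] sample_X[OF mem(1)] sample_X[OF mem(2)] H0 \<tau>_eq by simp
  qed
  have 3: "?k \<longlonglongrightarrow> \<sigma>Y2"
  proof (rule lim[OF iii_Y[OF e(3)]])
    fix p :: nat assume p: "1 \<le> p"
    show "(\<integral>\<omega>. (H (P p) p (d p) (\<rho> p) (\<tau>Y p) (Ys p 1) (Ys p 2) \<omega>)\<^sup>2 \<partial>P p) = ?k p"
      using indep_pair.integral_H_square[OF pairs(6)[OF mem(3,4,5), of p]] tau_pos(3)[OF p]
      unfolding tau_samples(3)[OF mem(3,4,5)] sample_Y[OF mem(3)] sample_Y[OF mem(4)] H0 \<tau>_eq by simp
  qed
  show "\<sigma>X2 = \<sigma>2" "\<sigma>Y2 = \<sigma>2"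
    using LIMSEQ_unique[OF 1 2] LIMSEQ_unique[OF 1 3] by auto
qed

end

theorem theorem4p2:
  fixes n m :: nat
    and P :: "nat \<Rightarrow> 'w measure"
    and d :: "nat \<Rightarrow> nat \<Rightarrow> nat"
    and \<rho> :: "nat \<Rightarrow> nat \<Rightarrow> point \<Rightarrow> point \<Rightarrow> real"
    and X X' Y Y' :: "nat \<Rightarrow> 'w \<Rightarrow> data"
    and Xs Ys :: "nat \<Rightarrow> nat \<Rightarrow> 'w \<Rightarrow> data"
    and K :: "nat \<Rightarrow> data \<Rightarrow> data \<Rightarrow> real"
    and \<tau> \<tau>X \<tau>Y :: "nat \<Rightarrow> real"
    and a A a' A' a'' A'' :: real
    and ap bp cp :: "nat \<Rightarrow> real"
    and \<sigma>2 \<sigma>X2 \<sigma>Y2 :: real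
  assumes n: "4 \<le> n" and m: "4 \<le> m"
    and prob: "\<And>p. prob_space (P p)"
    and dims: "\<exists>D. \<forall>p. \<forall>i\<in>{1..p}. 1 \<le> d p i \<and> d p i \<le> D"
    and population: "\<And>p. prob_space.indep_vars (P p) (\<lambda>_. data_space p (d p))
                           (\<lambda>j. [X p, Y p, X' p, Y' p] ! j) {..<4}"
    and copy_X: "\<And>p. distr (P p) (data_space p (d p)) (X' p) = distr (P p) (data_space p (d p)) (X p)"
    and copy_Y: "\<And>p. distr (P p) (data_space p (d p)) (Y' p) = distr (P p) (data_space p (d p)) (Y p)"
    and samples: "\<And>p. prob_space.indep_vars (P p) (\<lambda>_. data_space p (d p))
                        (case_sum (Xs p) (Ys p)) ({1..n} <+> {1..m})"
    and sample_X: "\<And>p k. k \<in> {1..n} \<Longrightarrow>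
          distr (P p) (data_space p (d p)) (Xs p k) = distr (P p) (data_space p (d p)) (X p)"
    and sample_Y: "\<And>p l. l \<in> {1..m} \<Longrightarrow>
          distr (P p) (data_space p (d p)) (Ys p l) = distr (P p) (data_space p (d p)) (Y p)"
    and cases: "(\<forall>p. \<forall>i\<in>{1..p}. case_S1 (d p i) (\<rho> p i)) \<or> (\<forall>p. \<forall>i\<in>{1..p}. case_S2 (d p i) (\<rho> p i))"
    and K_eq: "\<And>p. K p = dist_K p (\<rho> p)"
    and tau_eq: "\<And>p. \<tau> p = tau (P p) (K p) (X p) (Y p)"
    and tauX_eq: "\<And>p. \<tau>X p = tau (P p) (K p) (X p) (X' p)"
    and tauY_eq: "\<And>p. \<tau>Y p = tau (P p) (K p) (Y p) (Y' p)"
    and i_const: "0 < a" "a \<le> A" "0 < a'" "a' \<le> A'" "0 < a''" "a'' \<le> A''"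
    and i_X: "\<And>p i. i \<in> {1..p} \<Longrightarrow>
          (\<integral>\<omega>. \<rho> p i (X p \<omega> i) (X' p \<omega> i) \<partial>P p) \<in> {a..A}"
    and i_Y: "\<And>p i. i \<in> {1..p} \<Longrightarrow>
          (\<integral>\<omega>. \<rho> p i (Y p \<omega> i) (Y' p \<omega> i) \<partial>P p) \<in> {a'..A'}"
    and i_XY: "\<And>p i. i \<in> {1..p} \<Longrightarrow>
          (\<integral>\<omega>. \<rho> p i (X p \<omega> i) (Y p \<omega> i) \<partial>P p) \<in> {a''..A''}"
    and ii_pos: "\<And>p. 0 < ap p" "\<And>p. 0 < bp p" "\<And>p. 0 < cp p"
    and ii_null: "ap \<longlonglongrightarrow> 0" "bp \<longlonglongrightarrow> 0" "cp \<longlonglongrightarrow> 0"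
    and ii_XY: "bigOp P (\<lambda>p. L (P p) (K p) (X p) (Y p)) ap"
    and ii_X: "bigOp P (\<lambda>p. L (P p) (K p) (X p) (X' p)) bp"
    and ii_Y: "bigOp P (\<lambda>p. L (P p) (K p) (Y p) (Y' p)) cp"
    and ii_rate: "(\<lambda>p. \<tau> p * (ap p)\<^sup>2 + \<tau>X p * (bp p)\<^sup>2 + \<tau>Y p * (cp p)\<^sup>2) \<longlonglongrightarrow> 0"
    and iii_conv: "joint_conv P (entries n m)
          (\<lambda>p e. case e of
              XY k l \<Rightarrow> H (P p) p (d p) (\<rho> p) (\<tau> p) (Xs p k) (Ys p l)
            | XX s t \<Rightarrow> H (P p) p (d p) (\<rho> p) (\<tau>X p) (Xs p s) (Xs p t)
            | YY s t \<Rightarrow> H (P p) p (d p) (\<rho> p) (\<tau>Y p) (Ys p s) (Ys p t))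
          (entries_limit n m \<sigma>2 \<sigma>X2 \<sigma>Y2)"
    and iii_XY: "\<And>k l. XY k l \<in> entries n m \<Longrightarrow>
          second_moment_tendsto P (\<lambda>p. H (P p) p (d p) (\<rho> p) (\<tau> p) (Xs p k) (Ys p l)) \<sigma>2"
    and iii_X: "\<And>s t. XX s t \<in> entries n m \<Longrightarrow>
          second_moment_tendsto P (\<lambda>p. H (P p) p (d p) (\<rho> p) (\<tau>X p) (Xs p s) (Xs p t)) \<sigma>X2"
    and iii_Y: "\<And>s t. YY s t \<in> entries n m \<Longrightarrow>
          second_moment_tendsto P (\<lambda>p. H (P p) p (d p) (\<rho> p) (\<tau>Y p) (Ys p s) (Ys p t)) \<sigma>Y2"
    and nondegenerate: "\<sigma>2 \<noteq> 0 \<or> \<sigma>X2 \<noteq> 0 \<or> \<sigma>Y2 \<noteq> 0"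
    and iv_X: "smallop1 P (\<lambda>p. cond_exp_given (P p) (data_space p (d p)) (X p)
          (\<lambda>\<omega>. \<tau> p * L (P p) (K p) (X p) (Y p) \<omega> - \<tau>X p * L (P p) (K p) (X p) (X' p) \<omega>))"
    and iv_Y: "smallop1 P (\<lambda>p. cond_exp_given (P p) (data_space p (d p)) (Y p)
          (\<lambda>\<omega>. \<tau> p * L (P p) (K p) (X p) (Y p) \<omega> - \<tau>Y p * L (P p) (K p) (Y p) (Y' p) \<omega>))"
  shows "weak_conv_m
           (\<lambda>p. distr (P p) borel (\<lambda>\<omega>.
              (energy_stat (K p) n m (\<lambda>k. Xs p k \<omega>) (\<lambda>l. Ys p l \<omega>) - (2 * \<tau> p - \<tau>X p - \<tau>Y p))
              / (a_nm n m * sqrt (S_stat (K p) n m (\<lambda>k. Xs p k \<omega>) (\<lambda>l. Ys p l \<omega>)))))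
           (distr (normal_law 0 1 \<Otimes>\<^sub>M M_law n m \<sigma>2 \<sigma>X2 \<sigma>Y2) borel
              (\<lambda>(z, q). sigma_nm n m \<sigma>2 \<sigma>X2 \<sigma>Y2 * z / (a_nm n m * sqrt q)))
       \<and> (\<forall>\<Delta>. (\<lambda>p. 2 * \<tau> p - \<tau>X p - \<tau>Y p) \<longlonglongrightarrow> \<Delta> \<longrightarrow>
            weak_conv_m
              (\<lambda>p. distr (P p) borel (\<lambda>\<omega>. T_stat (K p) n m (\<lambda>k. Xs p k \<omega>) (\<lambda>l. Ys p l \<omega>)))
              (distr (normal_law (\<Delta> / sigma_nm n m \<sigma>2 \<sigma>X2 \<sigma>Y2) 1 \<Otimes>\<^sub>M M_law n m \<sigma>2 \<sigma>X2 \<sigma>Y2) borel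
                 (\<lambda>(z, q). sigma_nm n m \<sigma>2 \<sigma>X2 \<sigma>Y2 * z / (a_nm n m * sqrt q))))
       \<and> ((\<forall>p. distr (P p) (data_space p (d p)) (X p) = distr (P p) (data_space p (d p)) (Y p)) \<longrightarrow>
            weak_conv_m
              (\<lambda>p. distr (P p) borel (\<lambda>\<omega>. T_stat (K p) n m (\<lambda>k. Xs p k \<omega>) (\<lambda>l. Ys p l \<omega>)))
              (student_t ((n - 1) * (m - 1) + v n + v m)))"
proof -
  have ground: "case_S1 (d p i) (\<rho> p i) \<or> case_S2 (d p i) (\<rho> p i)" if "i \<in> {1..p}" for p i
    using cases that by blast
  have lower_X: "a \<le> (\<integral>\<omega>. \<rho> p i (X p \<omega> i) (X' p \<omega> i) \<partial>P p)" if "i \<in> {1..p}" for p i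
    using i_X[OF that] by simp
  have lower_Y: "a' \<le> (\<integral>\<omega>. \<rho> p i (Y p \<omega> i) (Y' p \<omega> i) \<partial>P p)" if "i \<in> {1..p}" for p i
    using i_Y[OF that] by simp
  have lower_XY: "a'' \<le> (\<integral>\<omega>. \<rho> p i (X p \<omega> i) (Y p \<omega> i) \<partial>P p)" if "i \<in> {1..p}" for p i
    using i_XY[OF that] by simp
  interpret two_sample n m P d \<rho> X X' Y Y' Xs Ys K \<tau> \<tau>X \<tau>Y a a' a'' ap bp cp \<sigma>2 \<sigma>X2 \<sigma>Y2
    by (rule two_sample.intro)
      (assumption | rule n m prob population copy_X copy_Y samples sample_X sample_Y ground K_eq tau_eq tauX_eq tauY_eq
        i_const(1,3,5) lower_X lower_Y lower_XY ii_XY ii_X ii_Y ii_rate iii_conv iii_XY iii_X iii_Y nondegenerate iv_X iv_Y)+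
  note laws = ratio_limit_law[OF n m variances_nonneg nondegenerate]
  show ?thesis
  proof (intro conjI allI impI)
    have "(\<lambda>p. 2 * \<tau> p - \<tau>X p - \<tau>Y p - (2 * \<tau> p - \<tau>X p - \<tau>Y p)) \<longlonglongrightarrow> 0" by simp
    from statistic_conv[OF this] laws[of 0]
    show "weak_conv_m
           (\<lambda>p. distr (P p) borel (\<lambda>\<omega>.
              (energy_stat (K p) n m (\<lambda>k. Xs p k \<omega>) (\<lambda>l. Ys p l \<omega>) - (2 * \<tau> p - \<tau>X p - \<tau>Y p))
              / (a_nm n m * sqrt (S_stat (K p) n m (\<lambda>k. Xs p k \<omega>) (\<lambda>l. Ys p l \<omega>)))))
           (distr (normal_law 0 1 \<Otimes>\<^sub>M M_law n m \<sigma>2 \<sigma>X2 \<sigma>Y2) borel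
              (\<lambda>(z, q). sigma_nm n m \<sigma>2 \<sigma>X2 \<sigma>Y2 * z / (a_nm n m * sqrt q)))"
      by simp
  next
    fix \<Delta> assume "(\<lambda>p. 2 * \<tau> p - \<tau>X p - \<tau>Y p) \<longlonglongrightarrow> \<Delta>"
    then have "(\<lambda>p. 2 * \<tau> p - \<tau>X p - \<tau>Y p - 0) \<longlonglongrightarrow> \<Delta>" by simp
    from statistic_conv[OF this]
    show "weak_conv_m
              (\<lambda>p. distr (P p) borel (\<lambda>\<omega>. T_stat (K p) n m (\<lambda>k. Xs p k \<omega>) (\<lambda>l. Ys p l \<omega>)))
              (distr (normal_law (\<Delta> / sigma_nm n m \<sigma>2 \<sigma>X2 \<sigma>Y2) 1 \<Otimes>\<^sub>M M_law n m \<sigma>2 \<sigma>X2 \<sigma>Y2) borel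
                 (\<lambda>(z, q). sigma_nm n m \<sigma>2 \<sigma>X2 \<sigma>Y2 * z / (a_nm n m * sqrt q)))"
      unfolding laws T_stat_def diff_0_right .
  next
    assume "\<forall>p. distr (P p) (data_space p (d p)) (X p) = distr (P p) (data_space p (d p)) (Y p)"
    then have H0: "\<And>p. PX p = PY p" by blast
    \<comment> \<open>All three scales coincide here, so the shift is zero for every
      \<open>p\<close> and the Gaussian factor is centered.\<close>
    have "(\<lambda>p. 2 * \<tau> p - \<tau>X p - \<tau>Y p - 0) \<longlonglongrightarrow> 0" by (simp add: null_hypothesis(1,2)[OF H0])
    from statistic_conv[OF this]
    show "weak_conv_m
              (\<lambda>p. distr (P p) borel (\<lambda>\<omega>. T_stat (K p) n m (\<lambda>k. Xs p k \<omega>) (\<lambda>l. Ys p l \<omega>)))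
              (student_t ((n - 1) * (m - 1) + v n + v m))"
      using ratio_limit_student[OF n m variances_nonneg nondegenerate null_hypothesis(3,4)[OF H0]]
      by (simp add: T_stat_def)
  qed
qed

end
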